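(* Let $B^{Kh}:=H_*\bigl(\bigoplus_{i,j=0}^m\mathrm{Hom}_A(Q_i,Q_j)\bigr)$ be the homology of the Hom algebra associated to the basis $\widetilde{\mathcal Q}$, and let $B^{HF}:=\mathcal{A}(\mathcal{Z}_{\mathcal Q},1)$ be the $1$-moving strands algebra associated to the arc diagram $\mathcal{Z}_{\mathcal Q}$. There exists a filtration on $B^{HF}$ whose associated graded algebra is isomorphic, as an ungraded algebra, to $B^{Kh}$. Accordingly, one obtains a spectral sequence whose $E^1$ page is isomorphic to $B^{Kh}$ and whose $E^\infty$ page is isomorphic to $B^{HF}$.
   Context: $\mathbb{F}=\mathbb{Z}/2\mathbb{Z}$; fix an integer $m\ge0$. A filtration on an algebra is an increasing family of subspaces $\mathcal{F}_i$, $i\in\mathbb Z$, with $\mathcal{F}_i\cdot\mathcal{F}_j\subseteq\mathcal{F}_{i+j}$ (and preserved by the differential, if any); the associated graded algebra is $\bigoplus_i\mathcal{F}_i/\mathcal{F}_{i-1}$. The $E^1$ page of the spectral sequence is the homology of the associated graded algebra, and by convention the $E^\infty$ page means the homology algebra of the total complex. **$A$, $Q_j$ and $B^{Kh}$.** $A=A_m$ is the quotient of the path algebra over $\mathbb F$ of the quiver with vertices $0,\dots,m$ and one edge $i\to i+1$ and one edge $i+1\to i$ for each $0\le i<m$, by the relations $(i-1|i|i+1)=0$, $(i+1|i|i-1)=0$, $(i|i+1|i)=(i|i-1|i)$ for $0<i<m$, and $(0|1|0)=0$. Here $(i_0|i_1|\dots|i_r)$ denotes the path traversing those vertices in order, and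 multiplication is concatenation. $P_i=A(i)$ is the left module of paths ending at $i$. $Q_j$ is the complex of left $A$-modules $0\to P_0\xrightarrow{\cdot(0|1)}P_1\xrightarrow{\cdot(1|2)}\cdots\xrightarrow{\cdot(j-1|j)}P_j\to0$ (this is the complex attached to the $j$-th curve of the basis $\widetilde{\mathcal Q}$). $\mathrm{Hom}_A(Q_i,Q_j)$ is the complex of left $A$-module maps with differential $D(F)=\partial F+F\partial$, and $\bigoplus_{i,j}\mathrm{Hom}_A(Q_i,Q_j)$ is a dg algebra, the product of $f\in\mathrm{Hom}_A(Q_i,Q_j)$ and $g\in\mathrm{Hom}_A(Q_j,Q_k)$ being "$f$ followed by $g$". **$B^{HF}$.** The $1$-moving strands algebra is $B^{HF}=\bigoplus_{i,j=0}^m{}_iB^{HF}_j$ with ${}_iB^{HF}_j$ equal to $0$ for $i<j$, spanned by ${}_i\mathbb 1_i$ for $i=j$, and with basis ${}_i\rho_j,{}_i\sigma_j$ for $i>j$. The multiplication ${}_iB^{HF}_j\otimes{}_kB^{HF}_\ell\to{}_iB^{HF}_\ell$ is zero unless $j=k$; ${}_i\mathbb 1_i\cdot a=a\cdot{}_j\mathbb 1_j=a$ for $a\in{}_iB_j^{HF}$; ${}_i\rho_j\,{}_j\rho_k={}_i\rho_k$, ${}_i\sigma_j\,{}_j\sigma_k={}_i\sigma_k$, ${}_i\rho_j\,{}_j\sigma_k={}_i\sigma_j\,{}_j\rho_k=0$; its differential and all higher $A_\infty$ operations vanish. *)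

theory Defs
  imports "HOL-Algebra.QuotRing" "HOL-Library.Poly_Mapping" "HOL-Library.Z2"
begin

text \<open>
  The ground field is \<^typ>\<open>bit\<close>, i.e. the field with two elements.  An algebra over it is a
  (unital, associative) ring in which \<open>x + x = 0\<close>; the scalars act as \<open>0\<close> and as the identity, so
  subspaces are the same thing as additive subgroups, linear maps the same thing as additive maps,
  and isomorphisms of algebras the same thing as isomorphisms of rings.
\<close>

definition f2_algebra :: "('a, 'b) ring_scheme \<Rightarrow> bool" where
  "f2_algebra R \<longleftrightarrow> ring R \<and> (\<forall>x\<in>carrier R. x \<oplus>\<^bsub>R\<^esub> x = \<zero>\<^bsub>R\<^esub>)"

text \<open>No signs are needed in the Leibniz rule, the characteristic being two.\<close>

definition dg_algebra :: "('a, 'b) ring_scheme \<Rightarrow> ('a \<Rightarrow> 'a) \<Rightarrow> bool" where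
  "dg_algebra R d \<longleftrightarrow>
     f2_algebra R \<and>
     (\<forall>x\<in>carrier R. d x \<in> carrier R) \<and>
     (\<forall>x\<in>carrier R. \<forall>y\<in>carrier R. d (x \<oplus>\<^bsub>R\<^esub> y) = d x \<oplus>\<^bsub>R\<^esub> d y) \<and>
     (\<forall>x\<in>carrier R. d (d x) = \<zero>\<^bsub>R\<^esub>) \<and>
     (\<forall>x\<in>carrier R. \<forall>y\<in>carrier R.
        d (x \<otimes>\<^bsub>R\<^esub> y) = (d x \<otimes>\<^bsub>R\<^esub> y) \<oplus>\<^bsub>R\<^esub> (x \<otimes>\<^bsub>R\<^esub> d y))"

definition cycles :: "('a, 'b) ring_scheme \<Rightarrow> ('a \<Rightarrow> 'a) \<Rightarrow> 'a set" where
  "cycles R d = {x \<in> carrier R. d x = \<zero>\<^bsub>R\<^esub>}"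

definition boundaries :: "('a, 'b) ring_scheme \<Rightarrow> ('a \<Rightarrow> 'a) \<Rightarrow> 'a set" where
  "boundaries R d = d ` carrier R"

definition homology :: "('a, 'b) ring_scheme \<Rightarrow> ('a \<Rightarrow> 'a) \<Rightarrow> 'a set ring" where
  "homology R d = (R\<lparr>carrier := cycles R d\<rparr>) Quot (boundaries R d)"


section \<open>Filtrations and their spectral sequences\<close>

definition algebra_filtration ::
  "('a, 'b) ring_scheme \<Rightarrow> ('a \<Rightarrow> 'a) \<Rightarrow> (int \<Rightarrow> 'a set) \<Rightarrow> bool" where
  "algebra_filtration R d F \<longleftrightarrow>
     (\<forall>i. additive_subgroup (F i) R) \<and>
     (\<forall>i j. i \<le> j \<longrightarrow> F i \<subseteq> F j) \<and>
     (\<forall>i j. \<forall>x\<in>F i. \<forall>y\<in>F j. x \<otimes>\<^bsub>R\<^esub> y \<in> F (i + j)) \<and>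
     (\<forall>i. \<forall>x\<in>F i. d x \<in> F i)"

text \<open>
  Only the additive structure of this ring record is meaningful: it is the quotient
  vector space \<open>Z p / B p\<close>.
\<close>

definition subquotient ::
  "('a, 'b) ring_scheme \<Rightarrow> (int \<Rightarrow> 'a set) \<Rightarrow> (int \<Rightarrow> 'a set) \<Rightarrow> int \<Rightarrow> 'a set ring" where
  "subquotient R Z B p = (R\<lparr>carrier := Z p\<rparr>) Quot (B p)"

text \<open>
  The direct sum over all integers \<open>p\<close> of the spaces \<open>Z p / B p\<close>, with the product induced by
  that of \<open>R\<close>, which sends degrees \<open>p\<close> and \<open>q\<close> to degree \<open>p + q\<close>.
\<close>

definition graded_quotient ::
  "('a, 'b) ring_scheme \<Rightarrow> (int \<Rightarrow> 'a set) \<Rightarrow> (int \<Rightarrow> 'a set) \<Rightarrow> (int \<Rightarrow> 'a set) ring" where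
  "graded_quotient R Z B =
     \<lparr>carrier = {u. (\<forall>p. u p \<in> carrier (subquotient R Z B p)) \<and> finite {p. u p \<noteq> B p}},
      mult = (\<lambda>u v n. \<Oplus>\<^bsub>subquotient R Z B n\<^esub>p\<in>{p. u p \<noteq> B p \<and> v (n - p) \<noteq> B (n - p)}.
                (\<Union>x\<in>u p. \<Union>y\<in>v (n - p). B n +>\<^bsub>R\<^esub> (x \<otimes>\<^bsub>R\<^esub> y))),
      one = (\<lambda>p. if p = 0 then B p +>\<^bsub>R\<^esub> \<one>\<^bsub>R\<^esub> else B p),
      zero = B,
      add = (\<lambda>u v p. u p \<oplus>\<^bsub>subquotient R Z B p\<^esub> v p)\<rparr>"

text \<open>The map of degree \<open>-r\<close> induced by \<open>d\<close> on a graded quotient.\<close>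

definition graded_diff ::
  "('a, 'b) ring_scheme \<Rightarrow> ('a \<Rightarrow> 'a) \<Rightarrow> (int \<Rightarrow> 'a set) \<Rightarrow> int \<Rightarrow>
     (int \<Rightarrow> 'a set) \<Rightarrow> (int \<Rightarrow> 'a set)" where
  "graded_diff R d B r u = (\<lambda>p. \<Union>x\<in>u (p + r). B p +>\<^bsub>R\<^esub> d x)"

definition assoc_graded ::
  "('a, 'b) ring_scheme \<Rightarrow> (int \<Rightarrow> 'a set) \<Rightarrow> (int \<Rightarrow> 'a set) ring" where
  "assoc_graded R F = graded_quotient R F (\<lambda>i. F (i - 1))"

definition assoc_graded_diff ::
  "('a, 'b) ring_scheme \<Rightarrow> ('a \<Rightarrow> 'a) \<Rightarrow> (int \<Rightarrow> 'a set) \<Rightarrow>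
     (int \<Rightarrow> 'a set) \<Rightarrow> (int \<Rightarrow> 'a set)" where
  "assoc_graded_diff R d F = graded_diff R d (\<lambda>i. F (i - 1)) 0"

definition E1_page ::
  "('a, 'b) ring_scheme \<Rightarrow> ('a \<Rightarrow> 'a) \<Rightarrow> (int \<Rightarrow> 'a set) \<Rightarrow> (int \<Rightarrow> 'a set) set ring" where
  "E1_page R d F = homology (assoc_graded R F) (assoc_graded_diff R d F)"

text \<open>By convention, the limit page is the homology algebra of the total complex.\<close>

definition Einf_page :: "('a, 'b) ring_scheme \<Rightarrow> ('a \<Rightarrow> 'a) \<Rightarrow> 'a set ring" where
  "Einf_page R d = homology R d"

text \<open>
  The standard pages of the spectral sequence of a filtered complex:
  \<open>E r p = Z r p / (Z (r - 1) (p - 1) + d (Z (r - 1) (p + r - 1)))\<close>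
  with \<open>Z r p = {x \<in> F p. d x \<in> F (p - r)}\<close>.
\<close>

definition ss_Z :: "('a \<Rightarrow> 'a) \<Rightarrow> (int \<Rightarrow> 'a set) \<Rightarrow> int \<Rightarrow> int \<Rightarrow> 'a set" where
  "ss_Z d F r p = {x \<in> F p. d x \<in> F (p - r)}"

definition ss_B ::
  "('a, 'b) ring_scheme \<Rightarrow> ('a \<Rightarrow> 'a) \<Rightarrow> (int \<Rightarrow> 'a set) \<Rightarrow> int \<Rightarrow> int \<Rightarrow> 'a set" where
  "ss_B R d F r p = ss_Z d F (r - 1) (p - 1) <+>\<^bsub>R\<^esub> d ` ss_Z d F (r - 1) (p + r - 1)"

definition ss_page ::
  "('a, 'b) ring_scheme \<Rightarrow> ('a \<Rightarrow> 'a) \<Rightarrow> (int \<Rightarrow> 'a set) \<Rightarrow> nat \<Rightarrow> (int \<Rightarrow> 'a set) ring" where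
  "ss_page R d F r = graded_quotient R (ss_Z d F (int r)) (ss_B R d F (int r))"

definition ss_diff ::
  "('a, 'b) ring_scheme \<Rightarrow> ('a \<Rightarrow> 'a) \<Rightarrow> (int \<Rightarrow> 'a set) \<Rightarrow> nat \<Rightarrow>
     (int \<Rightarrow> 'a set) \<Rightarrow> (int \<Rightarrow> 'a set)" where
  "ss_diff R d F r = graded_diff R d (ss_B R d F (int r)) (int r)"

definition spectral_sequence :: "(nat \<Rightarrow> 'a ring) \<Rightarrow> (nat \<Rightarrow> 'a \<Rightarrow> 'a) \<Rightarrow> bool" where
  "spectral_sequence E \<delta> \<longleftrightarrow>
     (\<forall>r\<ge>1. dg_algebra (E r) (\<delta> r) \<and> homology (E r) (\<delta> r) \<simeq> E (Suc r))"


section \<open>Algebras with a multiplicative basis\<close>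

definition bilinear_ext ::
  "('b \<Rightarrow> 'b \<Rightarrow> 'b option) \<Rightarrow> ('b \<Rightarrow>\<^sub>0 bit) \<Rightarrow> ('b \<Rightarrow>\<^sub>0 bit) \<Rightarrow> ('b \<Rightarrow>\<^sub>0 bit)" where
  "bilinear_ext \<mu> f g =
     (\<Sum>a\<in>Poly_Mapping.keys f. \<Sum>b\<in>Poly_Mapping.keys g.
        case \<mu> a b of None \<Rightarrow> 0
        | Some c \<Rightarrow> Poly_Mapping.single c (Poly_Mapping.lookup f a * Poly_Mapping.lookup g b))"

text \<open>
  The vector space with basis \<open>S\<close>; \<open>\<mu>\<close> multiplies basis elements (\<^const>\<open>None\<close> being the product
  zero), and the unit is the sum of the finitely many idempotents in \<open>U\<close>.
\<close>

definition basis_algebra ::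
  "'b set \<Rightarrow> ('b \<Rightarrow> 'b \<Rightarrow> 'b option) \<Rightarrow> 'b set \<Rightarrow> ('b \<Rightarrow>\<^sub>0 bit) ring" where
  "basis_algebra S \<mu> U =
     \<lparr>carrier = {f. Poly_Mapping.keys f \<subseteq> S},
      mult = bilinear_ext \<mu>,
      one = (\<Sum>u\<in>U. Poly_Mapping.single u 1),
      zero = 0,
      add = (+)\<rparr>"


section \<open>The quiver algebra \<open>A\<close>\<close>

text \<open>
  A path is the list of the vertices it visits; there is at most one edge from any vertex to any
  other, so this list determines the path.
\<close>

definition quiver_paths :: "nat \<Rightarrow> nat list set" where
  "quiver_paths m =
     {p. p \<noteq> [] \<and> set p \<subseteq> {..m} \<and> successively (\<lambda>i j. j = Suc i \<or> i = Suc j) p}"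

definition path_concat :: "nat list \<Rightarrow> nat list \<Rightarrow> nat list option" where
  "path_concat p q = (if last p = hd q then Some (p @ tl q) else None)"

definition path_algebra :: "nat \<Rightarrow> (nat list \<Rightarrow>\<^sub>0 bit) ring" where
  "path_algebra m = basis_algebra (quiver_paths m) path_concat ((\<lambda>i. [i]) ` {..m})"

abbreviation path_elem :: "nat list \<Rightarrow> (nat list \<Rightarrow>\<^sub>0 bit)" where
  "path_elem p \<equiv> Poly_Mapping.single p 1"

text \<open>For \<open>m = 0\<close> there is no path \<open>(0|1|0)\<close>, hence no relation.\<close>

definition A_relations :: "nat \<Rightarrow> (nat list \<Rightarrow>\<^sub>0 bit) set" where
  "A_relations m =
     {path_elem [i - 1, i, i + 1] | i. 0 < i \<and> i < m} \<union>
     {path_elem [i + 1, i, i - 1] | i. 0 < i \<and> i < m} \<union>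
     {path_elem [i, i + 1, i] - path_elem [i, i - 1, i] | i. 0 < i \<and> i < m} \<union>
     (if 0 < m then {path_elem [0, 1, 0]} else {})"

definition A_ideal :: "nat \<Rightarrow> (nat list \<Rightarrow>\<^sub>0 bit) set" where
  "A_ideal m = Idl\<^bsub>path_algebra m\<^esub> (A_relations m)"

type_synonym A_elem = "(nat list \<Rightarrow>\<^sub>0 bit) set"

definition A_alg :: "nat \<Rightarrow> A_elem ring" where
  "A_alg m = path_algebra m Quot A_ideal m"

definition A_path :: "nat \<Rightarrow> nat list \<Rightarrow> A_elem" where
  "A_path m p = A_ideal m +>\<^bsub>path_algebra m\<^esub> path_elem p"


section \<open>The complexes \<open>Q j\<close> and the algebra \<open>B\<^sup>K\<^sup>h\<close>\<close>

definition P_mod :: "nat \<Rightarrow> nat \<Rightarrow> A_elem set" where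
  "P_mod m i = {a \<otimes>\<^bsub>A_alg m\<^esub> A_path m [i] | a. a \<in> carrier (A_alg m)}"

text \<open>The total module of the complex \<open>Q j\<close>, i.e. the direct sum of \<open>P 0, \<dots>, P j\<close>.\<close>

definition Q_mod :: "nat \<Rightarrow> nat \<Rightarrow> (nat \<Rightarrow> A_elem) set" where
  "Q_mod m j = (\<Pi>\<^sub>E k\<in>{..j}. P_mod m k)"

definition Q_zero :: "nat \<Rightarrow> nat \<Rightarrow> (nat \<Rightarrow> A_elem)" where
  "Q_zero m j = (\<lambda>k\<in>{..j}. \<zero>\<^bsub>A_alg m\<^esub>)"

definition Q_add :: "nat \<Rightarrow> nat \<Rightarrow> (nat \<Rightarrow> A_elem) \<Rightarrow> (nat \<Rightarrow> A_elem) \<Rightarrow> (nat \<Rightarrow> A_elem)" where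
  "Q_add m j x y = (\<lambda>k\<in>{..j}. x k \<oplus>\<^bsub>A_alg m\<^esub> y k)"

definition Q_act :: "nat \<Rightarrow> nat \<Rightarrow> A_elem \<Rightarrow> (nat \<Rightarrow> A_elem) \<Rightarrow> (nat \<Rightarrow> A_elem)" where
  "Q_act m j a x = (\<lambda>k\<in>{..j}. a \<otimes>\<^bsub>A_alg m\<^esub> x k)"

definition Q_diff :: "nat \<Rightarrow> nat \<Rightarrow> (nat \<Rightarrow> A_elem) \<Rightarrow> (nat \<Rightarrow> A_elem)" where
  "Q_diff m j x =
     (\<lambda>k\<in>{..j}. if k = 0 then \<zero>\<^bsub>A_alg m\<^esub> else x (k - 1) \<otimes>\<^bsub>A_alg m\<^esub> A_path m [k - 1, k])"

type_synonym Q_map = "(nat \<Rightarrow> A_elem) \<Rightarrow> (nat \<Rightarrow> A_elem)"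

text \<open>
  The complexes being bounded, the direct sum over all degrees of the homogeneous module maps from
  \<open>Q i\<close> to \<open>Q j\<close> consists of all module maps between the total modules.
\<close>

definition Q_Hom :: "nat \<Rightarrow> nat \<Rightarrow> nat \<Rightarrow> Q_map set" where
  "Q_Hom m i j =
     {f \<in> Q_mod m i \<rightarrow>\<^sub>E Q_mod m j.
        (\<forall>x\<in>Q_mod m i. \<forall>y\<in>Q_mod m i. f (Q_add m i x y) = Q_add m j (f x) (f y)) \<and>
        (\<forall>a\<in>carrier (A_alg m). \<forall>x\<in>Q_mod m i. f (Q_act m i a x) = Q_act m j a (f x))}"

definition Q_Hom_diff :: "nat \<Rightarrow> nat \<Rightarrow> nat \<Rightarrow> Q_map \<Rightarrow> Q_map" where
  "Q_Hom_diff m i j f = (\<lambda>x\<in>Q_mod m i. Q_add m j (Q_diff m j (f x)) (f (Q_diff m i x)))"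

text \<open>
  The component \<open>(i, j)\<close> of an element lies in \<^term>\<open>Q_Hom m i j\<close>.  In the product of
  \<open>f\<close> and \<open>g\<close>, the map \<open>f\<close> is applied first.
\<close>

definition Hom_alg :: "nat \<Rightarrow> (nat \<times> nat \<Rightarrow> Q_map) ring" where
  "Hom_alg m =
     \<lparr>carrier = (\<Pi>\<^sub>E (i, j)\<in>{..m} \<times> {..m}. Q_Hom m i j),
      mult = (\<lambda>f g. \<lambda>(i, k)\<in>{..m} \<times> {..m}. \<lambda>x\<in>Q_mod m i.
                \<lambda>l\<in>{..k}. \<Oplus>\<^bsub>A_alg m\<^esub>j\<in>{..m}. g (j, k) (f (i, j) x) l),
      one = (\<lambda>(i, j)\<in>{..m} \<times> {..m}. \<lambda>x\<in>Q_mod m i. if i = j then x else Q_zero m j),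
      zero = (\<lambda>(i, j)\<in>{..m} \<times> {..m}. \<lambda>x\<in>Q_mod m i. Q_zero m j),
      add = (\<lambda>f g. \<lambda>(i, j)\<in>{..m} \<times> {..m}. \<lambda>x\<in>Q_mod m i. Q_add m j (f (i, j) x) (g (i, j) x))\<rparr>"

definition Hom_diff :: "nat \<Rightarrow> (nat \<times> nat \<Rightarrow> Q_map) \<Rightarrow> (nat \<times> nat \<Rightarrow> Q_map)" where
  "Hom_diff m f = (\<lambda>(i, j)\<in>{..m} \<times> {..m}. Q_Hom_diff m i j (f (i, j)))"

definition B_Kh :: "nat \<Rightarrow> (nat \<times> nat \<Rightarrow> Q_map) set ring" where
  "B_Kh m = homology (Hom_alg m) (Hom_diff m)"


section \<open>The 1-moving strands algebra \<open>B\<^sup>H\<^sup>F\<close>\<close>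

datatype strand = StrandId nat | StrandRho nat nat | StrandSigma nat nat

definition strands :: "nat \<Rightarrow> strand set" where
  "strands m =
     {StrandId i | i. i \<le> m} \<union> {StrandRho i j | i j. j < i \<and> i \<le> m} \<union> {StrandSigma i j | i j. j < i \<and> i \<le> m}"

fun strand_mult :: "strand \<Rightarrow> strand \<Rightarrow> strand option" where
  "strand_mult (StrandId i) (StrandId j) = (if i = j then Some (StrandId i) else None)"
| "strand_mult (StrandId i) (StrandRho j k) = (if i = j then Some (StrandRho j k) else None)"
| "strand_mult (StrandId i) (StrandSigma j k) = (if i = j then Some (StrandSigma j k) else None)"
| "strand_mult (StrandRho i j) (StrandId k) = (if j = k then Some (StrandRho i j) else None)"
| "strand_mult (StrandSigma i j) (StrandId k) = (if j = k then Some (StrandSigma i j) else None)"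
| "strand_mult (StrandRho i j) (StrandRho k l) = (if j = k then Some (StrandRho i l) else None)"
| "strand_mult (StrandSigma i j) (StrandSigma k l) = (if j = k then Some (StrandSigma i l) else None)"
| "strand_mult (StrandRho i j) (StrandSigma k l) = None"
| "strand_mult (StrandSigma i j) (StrandRho k l) = None"

definition B_HF :: "nat \<Rightarrow> (strand \<Rightarrow>\<^sub>0 bit) ring" where
  "B_HF m = basis_algebra (strands m) strand_mult (StrandId ` {..m})"

definition B_HF_diff :: "(strand \<Rightarrow>\<^sub>0 bit) \<Rightarrow> (strand \<Rightarrow>\<^sub>0 bit)" where
  "B_HF_diff x = 0"

end

theory Submission
  imports Defs "HOL-Algebra.Subrings"
begin

text \<open>
  The algebra \<open>B\<^sup>K\<^sup>h\<close> has a basis \<open>a\<^sub>i\<^sub>j\<close> (\<open>i \<ge> j\<close>), \<open>b\<^sub>i\<^sub>j\<close> (\<open>i > j\<close>) with \<open>a a = a\<close>, \<open>a b = b a = b\<close> and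
  \<open>b b = 0\<close> whenever the indices match: \<open>a\<^sub>i\<^sub>j\<close> is the projection of \<open>Q\<^sub>i\<close> onto \<open>Q\<^sub>j\<close>, and \<open>b\<^sub>i\<^sub>j\<close> is
  given by the maps \<open>P\<^sub>k\<^sub>+\<^sub>1 \<rightarrow> P\<^sub>k\<close>, \<open>k \<le> j\<close>, multiplying by \<open>(k+1|k)\<close>.  In \<open>B\<^sup>H\<^sup>F\<close> the elements
  \<open>a = \<rho> + \<sigma>\<close> and \<open>b = \<sigma>\<close> satisfy the same relations except that \<open>b b = b\<close>.  Hence, putting \<open>a\<close> in
  degree 0 and \<open>b\<close> in degree 1, one obtains a filtration whose associated graded algebra is
  \<open>B\<^sup>K\<^sup>h\<close>; as \<open>B\<^sup>H\<^sup>F\<close> has no differential, the spectral sequence is constant.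

  For the homology of \<open>Hom(Q\<^sub>i, Q\<^sub>j)\<close>, identify the total module of \<open>Q\<^sub>i\<close> with \<open>A e\<^sub>i\<close>, where
  \<open>e\<^sub>i = (0) + \<dots> + (i)\<close>.  Module maps from \<open>Q\<^sub>i\<close> to \<open>Q\<^sub>j\<close> are then right multiplications by elements of
  \<open>e\<^sub>i A e\<^sub>j\<close>, the whole Hom algebra has a multiplicative basis, its differential is a commutator, and
  an explicit contraction retracts it onto the span of the \<open>a\<^sub>i\<^sub>j\<close> and \<open>b\<^sub>i\<^sub>j\<close>.
\<close>

section \<open>Algebras with a multiplicative basis\<close>

abbreviation bas :: "'a \<Rightarrow> 'a \<Rightarrow>\<^sub>0 bit" where
  "bas a \<equiv> Poly_Mapping.single a 1"

abbreviation obas :: "'a option \<Rightarrow> 'a \<Rightarrow>\<^sub>0 bit" where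
  "obas x \<equiv> case x of None \<Rightarrow> 0 | Some c \<Rightarrow> bas c"

text \<open>Every nonzero coefficient is one, so an element is the sum of the basis vectors in its
  support and a linear extension needs no scalars.\<close>

definition lin :: "('a \<Rightarrow> ('b \<Rightarrow>\<^sub>0 bit)) \<Rightarrow> ('a \<Rightarrow>\<^sub>0 bit) \<Rightarrow> ('b \<Rightarrow>\<^sub>0 bit)" where
  "lin g x = (\<Sum>a\<in>Poly_Mapping.keys x. g a)"

lemma pm_self_add [simp]: "(x :: 'a \<Rightarrow>\<^sub>0 bit) + x = 0"
  by (rule poly_mapping_eqI) (simp add: lookup_add)

lemma pm_self_add_left [simp]: "(x :: 'a \<Rightarrow>\<^sub>0 bit) + (x + y) = y"
  by (simp flip: add.assoc)

lemma pm_uminus [simp]: "- (x :: 'a \<Rightarrow>\<^sub>0 bit) = x"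
  by (rule minus_unique) simp

lemma pm_diff [simp]: "(x :: 'a \<Rightarrow>\<^sub>0 bit) - y = x + y"
  by (simp only: diff_conv_add_uminus pm_uminus)

lemma pm_eq_iff: "(x :: 'a \<Rightarrow>\<^sub>0 bit) = y \<longleftrightarrow> x + y = 0"
  using eq_iff_diff_eq_0[of x y] by simp

lemma lin_superset:
  assumes "finite S" "Poly_Mapping.keys x \<subseteq> S"
  shows "lin g x = (\<Sum>a\<in>S. if Poly_Mapping.lookup x a = 0 then 0 else g a)"
  unfolding lin_def using assms
  by (intro sum.mono_neutral_cong_left) (auto simp: in_keys_iff)

lemma lin_0 [simp]: "lin g 0 = 0"
  by (simp add: lin_def)

lemma lin_bas [simp]: "lin g (bas a) = g a"
  by (simp add: lin_def)

lemma lin_add [simp]: "lin g (x + y) = lin g x + lin g y"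
proof -
  let ?S = "Poly_Mapping.keys x \<union> Poly_Mapping.keys y"
  have sub: "Poly_Mapping.keys (x + y) \<subseteq> ?S"
    by (rule Poly_Mapping.keys_add)
  have "lin g (x + y) = (\<Sum>a\<in>?S. if Poly_Mapping.lookup (x + y) a = 0 then 0 else g a)"
    using sub by (intro lin_superset) auto
  also have "\<dots> = (\<Sum>a\<in>?S. (if Poly_Mapping.lookup x a = 0 then 0 else g a)
                          + (if Poly_Mapping.lookup y a = 0 then 0 else g a))"
    by (intro sum.cong refl) (auto simp: lookup_add)
  also have "\<dots> = lin g x + lin g y"
    by (simp add: sum.distrib lin_superset[of ?S x] lin_superset[of ?S y])
  finally show ?thesis .
qed

lemma lin_sum [simp]: "lin g (sum f I) = (\<Sum>i\<in>I. lin g (f i))"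
  by (induction I rule: infinite_finite_induct) auto

lemma lin_zero_fun [simp]: "lin (\<lambda>a. 0) x = 0"
  by (simp add: lin_def)

lemma lin_add_fun: "lin (\<lambda>a. g a + h a) x = lin g x + lin h x"
  by (simp add: lin_def sum.distrib)

lemma lin_cong: "(\<And>a. a \<in> Poly_Mapping.keys x \<Longrightarrow> g a = h a) \<Longrightarrow> lin g x = lin h x"
  by (simp add: lin_def)

lemma lin_lin: "lin g (lin h x) = lin (\<lambda>a. lin g (h a)) x"
  by (simp add: lin_def[of h] lin_def[of "\<lambda>a. lin g (h a)"])

lemma lin_bas_id [simp]: "lin bas x = x"
proof (rule poly_mapping_eqI)
  fix k
  have "Poly_Mapping.lookup (lin bas x) k = (\<Sum>a\<in>Poly_Mapping.keys x. if a = k then 1 else 0)"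
    by (simp add: lin_def lookup_sum lookup_single when_def)
  then show "Poly_Mapping.lookup (lin bas x) k = Poly_Mapping.lookup x k"
    by (auto simp: in_keys_iff)
qed

lemma keys_lin:
  assumes "\<And>a. a \<in> Poly_Mapping.keys x \<Longrightarrow> Poly_Mapping.keys (g a) \<subseteq> S"
  shows "Poly_Mapping.keys (lin g x) \<subseteq> S"
  unfolding lin_def by (rule order_trans[OF Poly_Mapping.keys_sum]) (use assms in auto)

lemma keys_plus_subset:
  "Poly_Mapping.keys x \<subseteq> S \<Longrightarrow> Poly_Mapping.keys y \<subseteq> S \<Longrightarrow> Poly_Mapping.keys (x + y) \<subseteq> S"
  using Poly_Mapping.keys_add[of x y] by blast

lemma keys_sum_subset:
  "(\<And>i. i \<in> I \<Longrightarrow> Poly_Mapping.keys (f i) \<subseteq> S) \<Longrightarrow> Poly_Mapping.keys (sum f I) \<subseteq> S"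
  by (rule order_trans[OF Poly_Mapping.keys_sum]) auto

text \<open>An element is the sum of its support, so an additive property has to be checked on basis
  vectors only, without a case for scalars. Most linear identities below are reduced to basis
  vectors in this way.\<close>

lemma pm_induct [consumes 1, case_names zero bas add]:
  assumes "Poly_Mapping.keys (x :: 'a \<Rightarrow>\<^sub>0 bit) \<subseteq> S"
    and "P 0"
    and "\<And>a. a \<in> S \<Longrightarrow> P (bas a)"
    and "\<And>x y. Poly_Mapping.keys x \<subseteq> S \<Longrightarrow> Poly_Mapping.keys y \<subseteq> S \<Longrightarrow> P x \<Longrightarrow> P y \<Longrightarrow> P (x + y)"
  shows "P x"
proof -
  have "P (\<Sum>a\<in>I. bas a)" if "finite I" "I \<subseteq> S" for I
    using that
  proof (induction I)
    case (insert a I)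
    then have "Poly_Mapping.keys (\<Sum>a\<in>I. bas a) \<subseteq> S" "P (\<Sum>a\<in>I. bas a)" "a \<in> S"
      by (auto intro!: keys_sum_subset del: subsetI)
    then show ?case
      using insert.hyps assms(3)[of a] by (simp add: assms(4))
  qed (simp add: assms(2))
  from this[of "Poly_Mapping.keys x"] assms(1) show ?thesis
    by (simp flip: lin_def)
qed

section \<open>Bilinear extension of a partial multiplication\<close>

lemma bilinear_ext_lin: "bilinear_ext \<mu> f g = lin (\<lambda>a. lin (\<lambda>b. obas (\<mu> a b)) g) f"
  unfolding bilinear_ext_def lin_def
proof (intro sum.cong refl)
  fix a b
  assume "a \<in> Poly_Mapping.keys f" "b \<in> Poly_Mapping.keys g"
  then have "Poly_Mapping.lookup f a = 1" "Poly_Mapping.lookup g b = 1"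
    by (auto simp: in_keys_iff)
  then show "(case \<mu> a b of None \<Rightarrow> 0
      | Some c \<Rightarrow> Poly_Mapping.single c (Poly_Mapping.lookup f a * Poly_Mapping.lookup g b)) =
    obas (\<mu> a b)"
    by (simp split: option.split)
qed

lemma bilinear_ext_add_left [simp]:
  "bilinear_ext \<mu> (f + f') g = bilinear_ext \<mu> f g + bilinear_ext \<mu> f' g"
  by (simp add: bilinear_ext_lin)

lemma bilinear_ext_add_right [simp]:
  "bilinear_ext \<mu> f (g + g') = bilinear_ext \<mu> f g + bilinear_ext \<mu> f g'"
  by (simp add: bilinear_ext_lin lin_add_fun)

lemma bilinear_ext_0_left [simp]: "bilinear_ext \<mu> 0 g = 0"
  by (simp add: bilinear_ext_lin)

lemma bilinear_ext_0_right [simp]: "bilinear_ext \<mu> f 0 = 0"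
  by (simp add: bilinear_ext_lin)

lemma bilinear_ext_sum_left [simp]:
  "bilinear_ext \<mu> (sum f I) g = (\<Sum>i\<in>I. bilinear_ext \<mu> (f i) g)"
  by (induction I rule: infinite_finite_induct) auto

lemma bilinear_ext_sum_right [simp]:
  "bilinear_ext \<mu> f (sum g I) = (\<Sum>i\<in>I. bilinear_ext \<mu> f (g i))"
  by (induction I rule: infinite_finite_induct) auto

lemma bilinear_ext_bas [simp]: "bilinear_ext \<mu> (bas a) (bas b) = obas (\<mu> a b)"
  by (simp add: bilinear_ext_lin)

text \<open>Both sides are trilinear, so basis vectors suffice. The hypothesis with
  \<open>Option.bind\<close> says that the two triple products are the same basis vector or both
  vanish.\<close>

lemma bilinear_ext_assoc:
  assumes "\<And>a b c. a \<in> S \<Longrightarrow> b \<in> S \<Longrightarrow> c \<in> S \<Longrightarrow>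
      Option.bind (\<mu> a b) (\<lambda>x. \<mu> x c) = Option.bind (\<mu> b c) (\<mu> a)"
    and "Poly_Mapping.keys x \<subseteq> S" "Poly_Mapping.keys y \<subseteq> S" "Poly_Mapping.keys z \<subseteq> S"
  shows "bilinear_ext \<mu> (bilinear_ext \<mu> x y) z = bilinear_ext \<mu> x (bilinear_ext \<mu> y z)"
  using assms(2)
proof (induction x rule: pm_induct)
  case (bas a)
  show ?case using assms(3)
  proof (induction y rule: pm_induct)
    case (bas b)
    show ?case using assms(4)
    proof (induction z rule: pm_induct)
      case (bas c)
      show ?case
        using assms(1)[OF \<open>a \<in> S\<close> \<open>b \<in> S\<close> \<open>c \<in> S\<close>] by (auto split: option.splits)
    qed auto
  qed auto
qed auto

text \<open>The unit conditions say that on each side exactly one idempotent of \<open>U\<close>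
  fixes a given basis element and all others kill it, which makes the sum over \<open>U\<close> a
  two-sided unit.\<close>

locale mult_basis =
  fixes S :: "'b set" and \<mu> :: "'b \<Rightarrow> 'b \<Rightarrow> 'b option" and U :: "'b set"
  assumes closed: "a \<in> S \<Longrightarrow> b \<in> S \<Longrightarrow> \<mu> a b = Some c \<Longrightarrow> c \<in> S"
    and assoc: "a \<in> S \<Longrightarrow> b \<in> S \<Longrightarrow> c \<in> S \<Longrightarrow>
      Option.bind (\<mu> a b) (\<lambda>x. \<mu> x c) = Option.bind (\<mu> b c) (\<mu> a)"
    and units: "finite U" "U \<subseteq> S"
    and left_unit: "a \<in> S \<Longrightarrow> \<exists>u\<in>U. \<mu> u a = Some a \<and> (\<forall>v\<in>U - {u}. \<mu> v a = None)"
    and right_unit: "a \<in> S \<Longrightarrow> \<exists>u\<in>U. \<mu> a u = Some a \<and> (\<forall>v\<in>U - {u}. \<mu> a v = None)"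
begin

abbreviation R where "R \<equiv> basis_algebra S \<mu> U"

lemma carrier_iff: "x \<in> carrier R \<longleftrightarrow> Poly_Mapping.keys x \<subseteq> S"
  by (simp add: basis_algebra_def)

lemma mult_eq: "x \<otimes>\<^bsub>R\<^esub> y = bilinear_ext \<mu> x y"
  and add_eq: "x \<oplus>\<^bsub>R\<^esub> y = x + y"
  and zero_eq: "\<zero>\<^bsub>R\<^esub> = 0"
  and one_eq: "\<one>\<^bsub>R\<^esub> = (\<Sum>u\<in>U. bas u)"
  by (simp_all add: basis_algebra_def)

lemma mult_closed:
  "Poly_Mapping.keys x \<subseteq> S \<Longrightarrow> Poly_Mapping.keys y \<subseteq> S \<Longrightarrow>
     Poly_Mapping.keys (bilinear_ext \<mu> x y) \<subseteq> S"
  unfolding bilinear_ext_lin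
proof (intro keys_lin)
  fix a b
  assume "Poly_Mapping.keys x \<subseteq> S" "Poly_Mapping.keys y \<subseteq> S"
    and "a \<in> Poly_Mapping.keys x" "b \<in> Poly_Mapping.keys y"
  then have "a \<in> S" "b \<in> S" by blast+
  then show "Poly_Mapping.keys (obas (\<mu> a b)) \<subseteq> S"
    using closed[of a b] by (cases "\<mu> a b") auto
qed

lemmas mult_assoc = bilinear_ext_assoc[of S, OF assoc]

lemma one_left:
  assumes "Poly_Mapping.keys x \<subseteq> S"
  shows "bilinear_ext \<mu> (\<Sum>u\<in>U. bas u) x = x"
  using assms
proof (induction x rule: pm_induct)
  case (bas a)
  obtain u where u: "u \<in> U" "\<mu> u a = Some a" "\<forall>v\<in>U - {u}. \<mu> v a = None"
    using left_unit[OF bas] by blast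
  have "bilinear_ext \<mu> (\<Sum>u\<in>U. bas u) (bas a) = (\<Sum>v\<in>U. if v = u then bas a else 0)"
    using u by (auto intro!: sum.cong)
  with u units show ?case by simp
qed (auto simp del: bilinear_ext_sum_left)

lemma one_right:
  assumes "Poly_Mapping.keys x \<subseteq> S"
  shows "bilinear_ext \<mu> x (\<Sum>u\<in>U. bas u) = x"
  using assms
proof (induction x rule: pm_induct)
  case (bas a)
  obtain u where u: "u \<in> U" "\<mu> a u = Some a" "\<forall>v\<in>U - {u}. \<mu> a v = None"
    using right_unit[OF bas] by blast
  have "bilinear_ext \<mu> (bas a) (\<Sum>u\<in>U. bas u) = (\<Sum>v\<in>U. if v = u then bas a else 0)"
    using u by (auto intro!: sum.cong)
  with u units show ?case by simp
qed (auto simp del: bilinear_ext_sum_right)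

lemma ring: "ring R"
proof (rule ringI)
  show "abelian_group R"
  proof (rule abelian_groupI)
    fix x assume "x \<in> carrier R"
    then show "\<exists>y\<in>carrier R. y \<oplus>\<^bsub>R\<^esub> x = \<zero>\<^bsub>R\<^esub>"
      by (intro bexI[of _ x]) (auto simp: add_eq zero_eq)
  qed (auto simp: add_eq zero_eq carrier_iff add_ac intro!: keys_plus_subset del: subsetI)
  show "Group.monoid R"
    using units by (intro monoidI)
      (auto simp: mult_eq one_eq carrier_iff mult_assoc simp del: bilinear_ext_sum_left bilinear_ext_sum_right
        intro!: mult_closed one_left one_right keys_sum_subset del: subsetI)
qed (auto simp: mult_eq add_eq)

lemma f2: "f2_algebra R"
  using ring by (simp add: f2_algebra_def add_eq zero_eq)

end

section \<open>Differential graded algebras and their homology\<close>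

text \<open>In characteristic two the commutator with \<open>e\<close> is \<open>e x + x e\<close>.
  Applied twice it leaves \<open>e x e\<close> twice and terms with \<open>e e\<close>; in the
  Leibniz rule the term \<open>x e y\<close> occurs twice and cancels.\<close>

lemma dg_algebra_commutator:
  assumes R: "f2_algebra R" and e: "e \<in> carrier R" and ee: "e \<otimes>\<^bsub>R\<^esub> e = \<zero>\<^bsub>R\<^esub>"
  shows "dg_algebra R (\<lambda>x. (e \<otimes>\<^bsub>R\<^esub> x) \<oplus>\<^bsub>R\<^esub> (x \<otimes>\<^bsub>R\<^esub> e))"
proof -
  interpret ring R using R by (simp add: f2_algebra_def)
  have two: "x \<oplus>\<^bsub>R\<^esub> x = \<zero>\<^bsub>R\<^esub>" if "x \<in> carrier R" for x
    using R that by (simp add: f2_algebra_def)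
  have two': "x \<oplus>\<^bsub>R\<^esub> (x \<oplus>\<^bsub>R\<^esub> y) = y" if "x \<in> carrier R" "y \<in> carrier R" for x y
    using that by (simp add: two flip: a_assoc)
  have e0: "e \<otimes>\<^bsub>R\<^esub> (e \<otimes>\<^bsub>R\<^esub> x) = \<zero>\<^bsub>R\<^esub>" if "x \<in> carrier R" for x
    using that e ee by (simp flip: m_assoc)
  show ?thesis
    unfolding dg_algebra_def
    using R e by (auto simp: l_distr r_distr a_ac m_assoc two two' e0 ee)
qed

text \<open>Everything comes from the Leibniz rule: products of cycles are cycles, and for a cycle
  \<open>x\<close> the product of \<open>x\<close> with \<open>d y\<close> is \<open>d\<close> of
  the product of \<open>x\<close> with \<open>y\<close>, on either side.\<close>

lemma dg_cycles_ideal: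
  assumes "dg_algebra R d"
  shows "ring (R\<lparr>carrier := cycles R d\<rparr>)"
    and "ideal (boundaries R d) (R\<lparr>carrier := cycles R d\<rparr>)"
proof -
  interpret ring R using assms by (simp add: dg_algebra_def f2_algebra_def)
  have two: "x \<oplus>\<^bsub>R\<^esub> x = \<zero>\<^bsub>R\<^esub>" if "x \<in> carrier R" for x
    using assms that by (simp add: dg_algebra_def f2_algebra_def)
  have neg: "\<ominus>\<^bsub>R\<^esub> x = x" if "x \<in> carrier R" for x
    using that two by (simp add: minus_equality)
  have d_closed: "d x \<in> carrier R" if "x \<in> carrier R" for x
    using assms that by (simp add: dg_algebra_def)
  have d_add: "d (x \<oplus>\<^bsub>R\<^esub> y) = d x \<oplus>\<^bsub>R\<^esub> d y" if "x \<in> carrier R" "y \<in> carrier R" for x y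
    using assms that by (simp add: dg_algebra_def)
  have d_mult: "d (x \<otimes>\<^bsub>R\<^esub> y) = (d x \<otimes>\<^bsub>R\<^esub> y) \<oplus>\<^bsub>R\<^esub> (x \<otimes>\<^bsub>R\<^esub> d y)"
    if "x \<in> carrier R" "y \<in> carrier R" for x y
    using assms that by (simp add: dg_algebra_def)
  have dd: "d (d x) = \<zero>\<^bsub>R\<^esub>" if "x \<in> carrier R" for x
    using assms that by (simp add: dg_algebra_def)
  have d0: "d \<zero>\<^bsub>R\<^esub> = \<zero>\<^bsub>R\<^esub>"
    using d_add[of "\<zero>\<^bsub>R\<^esub>" "\<zero>\<^bsub>R\<^esub>"] two d_closed by simp
  \<comment> \<open>The Leibniz rule for the product of the unit with itself gives twice the same
    term.\<close>
  have d1: "d \<one>\<^bsub>R\<^esub> = \<zero>\<^bsub>R\<^esub>"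
    using d_mult[of "\<one>\<^bsub>R\<^esub>" "\<one>\<^bsub>R\<^esub>"] two d_closed by simp
  have "subring (cycles R d) R"
    by (rule subringI) (auto simp: cycles_def neg d1 d_mult d_add)
  then show cyc: "ring (R\<lparr>carrier := cycles R d\<rparr>)"
    by (rule subring_is_ring)
  show "ideal (boundaries R d) (R\<lparr>carrier := cycles R d\<rparr>)"
  proof (rule idealI[OF cyc])
    interpret C: ring "R\<lparr>carrier := cycles R d\<rparr>" by (rule cyc)
    have inv: "inv\<^bsub>add_monoid (R\<lparr>carrier := cycles R d\<rparr>)\<^esub> x = x" if "x \<in> cycles R d" for x
      using C.minus_equality[of x x] that two[of x] by (simp add: a_inv_def cycles_def)
    show "subgroup (boundaries R d) (add_monoid (R\<lparr>carrier := cycles R d\<rparr>))"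
    proof (rule group.subgroupI)
      show "group (add_monoid (R\<lparr>carrier := cycles R d\<rparr>))"
        by (rule C.a_group)
      show "boundaries R d \<subseteq> carrier (add_monoid (R\<lparr>carrier := cycles R d\<rparr>))"
        by (auto simp: boundaries_def cycles_def dd d_closed)
      then show "inv\<^bsub>add_monoid (R\<lparr>carrier := cycles R d\<rparr>)\<^esub> x \<in> boundaries R d"
        if "x \<in> boundaries R d" for x
        using inv[of x] that by auto
      show "x \<otimes>\<^bsub>add_monoid (R\<lparr>carrier := cycles R d\<rparr>)\<^esub> y \<in> boundaries R d"
        if "x \<in> boundaries R d" "y \<in> boundaries R d" for x y
        using that by (force simp: boundaries_def simp flip: d_add)
    qed (auto simp: boundaries_def)
  next
    fix a x assume "a \<in> boundaries R d" "x \<in> carrier (R\<lparr>carrier := cycles R d\<rparr>)"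
    then obtain y where y: "y \<in> carrier R" "a = d y" "x \<in> carrier R" "d x = \<zero>\<^bsub>R\<^esub>"
      by (auto simp: boundaries_def cycles_def)
    then have "x \<otimes>\<^bsub>R\<^esub> a = d (x \<otimes>\<^bsub>R\<^esub> y)" "a \<otimes>\<^bsub>R\<^esub> x = d (y \<otimes>\<^bsub>R\<^esub> x)"
      by (simp_all add: d_mult d_closed)
    with y show "x \<otimes>\<^bsub>R\<lparr>carrier := cycles R d\<rparr>\<^esub> a \<in> boundaries R d"
      "a \<otimes>\<^bsub>R\<lparr>carrier := cycles R d\<rparr>\<^esub> x \<in> boundaries R d"
      by (auto simp: boundaries_def)
  qed
qed

text \<open>The hypotheses say that \<open>\<iota>\<close> takes values in cycles, that only zero
  becomes a boundary, and that every homology class is hit. So the map to classes is a bijective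
  ring homomorphism, and homology can be computed without choosing representatives.\<close>

lemma homology_iso:
  assumes dg: "dg_algebra R d" and T: "ring T" and \<iota>: "\<iota> \<in> ring_hom T R"
    and cyc: "\<And>t. t \<in> carrier T \<Longrightarrow> d (\<iota> t) = \<zero>\<^bsub>R\<^esub>"
    and inj: "\<And>t. t \<in> carrier T \<Longrightarrow> \<iota> t \<in> boundaries R d \<Longrightarrow> t = \<zero>\<^bsub>T\<^esub>"
    and surj: "\<And>z. z \<in> cycles R d \<Longrightarrow> \<exists>t\<in>carrier T. \<exists>b\<in>boundaries R d. z = b \<oplus>\<^bsub>R\<^esub> \<iota> t"
  shows "T \<simeq> homology R d"
proof -
  let ?C = "R\<lparr>carrier := cycles R d\<rparr>" and ?B = "boundaries R d"
  interpret T: ring T by (rule T)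
  interpret C: ring ?C by (rule dg_cycles_ideal(1)[OF dg])
  interpret B: ideal ?B ?C by (rule dg_cycles_ideal(2)[OF dg])
  have hom: "\<iota> \<in> ring_hom T ?C"
    using \<iota> cyc by (auto simp: ring_hom_def cycles_def)
  define h where "h = (+>\<^bsub>?C\<^esub>) ?B \<circ> \<iota>"
  have h: "h \<in> ring_hom T (homology R d)"
    unfolding h_def homology_def by (rule ring_hom_trans[OF hom B.rcos_ring_hom])
  interpret h: ring_hom_ring T "homology R d" h
    using B.quotient_is_ring h by (intro ring_hom_ringI2 T) (simp_all add: homology_def)
  have \<iota>C: "\<iota> t \<in> cycles R d" if "t \<in> carrier T" for t
    using ring_hom_closed[OF hom that] by simp
  have zero: "\<zero>\<^bsub>homology R d\<^esub> = ?B"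
    by (simp add: homology_def FactRing_def)
  have "a_kernel T (homology R d) h = {\<zero>\<^bsub>T\<^esub>}"
  proof
    show "a_kernel T (homology R d) h \<subseteq> {\<zero>\<^bsub>T\<^esub>}"
    proof
      fix t assume "t \<in> a_kernel T (homology R d) h"
      then have t: "t \<in> carrier T" "?B +>\<^bsub>?C\<^esub> \<iota> t = ?B"
        by (auto simp: a_kernel_def' zero h_def)
      with \<iota>C[of t] B.a_rcos_self[of "\<iota> t"] have "\<iota> t \<in> ?B" by simp
      with inj t show "t \<in> {\<zero>\<^bsub>T\<^esub>}" by simp
    qed
    show "{\<zero>\<^bsub>T\<^esub>} \<subseteq> a_kernel T (homology R d) h"
      unfolding a_kernel_def' using h.hom_zero T.zero_closed by blast
  qed
  then have "inj_on h (carrier T)"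
    by (rule h.trivial_ker_imp_inj)
  moreover have "h ` carrier T = carrier (homology R d)"
  proof
    show "carrier (homology R d) \<subseteq> h ` carrier T"
    proof
      fix X assume "X \<in> carrier (homology R d)"
      then obtain z where z: "z \<in> cycles R d" "X = ?B +>\<^bsub>?C\<^esub> z"
        by (auto simp: homology_def FactRing_def A_RCOSETS_def' a_r_coset_def')
      obtain t b where tb: "t \<in> carrier T" "b \<in> ?B" "z = b \<oplus>\<^bsub>R\<^esub> \<iota> t"
        using surj[OF z(1)] by blast
      have "z \<in> ?B +>\<^bsub>?C\<^esub> \<iota> t"
        using tb by (auto simp: a_r_coset_def')
      then have "?B +>\<^bsub>?C\<^esub> \<iota> t = X"
        unfolding z(2) by (rule B.a_repr_independence') (simp add: \<iota>C tb)
      with tb show "X \<in> h ` carrier T"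
        by (auto simp: h_def)
    qed
  qed auto
  ultimately show ?thesis
    using h by (auto simp: is_ring_iso_def ring_iso_def bij_betw_def)
qed

text \<open>The target is not known to be a ring beforehand, so additivity alone cannot identify its
  zero; this is why \<open>h0\<close> is a hypothesis.\<close>

lemma f2_algebra_iso:
  assumes R: "f2_algebra R" and h: "h \<in> ring_iso R S" and h0: "h \<zero>\<^bsub>R\<^esub> = \<zero>\<^bsub>S\<^esub>"
  shows "f2_algebra S"
proof -
  interpret ring R using R by (simp add: f2_algebra_def)
  have "ring (S\<lparr>zero := h \<zero>\<^bsub>R\<^esub>\<rparr>)"
    by (rule ring_iso_imp_img_ring[OF h])
  then have "ring S" by (simp add: h0)
  moreover have "y \<oplus>\<^bsub>S\<^esub> y = \<zero>\<^bsub>S\<^esub>" if "y \<in> carrier S" for y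
  proof -
    have "carrier S = h ` carrier R"
      using h by (simp add: ring_iso_def bij_betw_def)
    with that obtain x where "x \<in> carrier R" "y = h x"
      by auto
    then show ?thesis
      using R h h0 by (auto simp: ring_iso_def f2_algebra_def simp flip: ring_hom_add)
  qed
  ultimately show ?thesis by (simp add: f2_algebra_def)
qed

lemma dg_algebra_iso:
  assumes dg: "dg_algebra R d" and h: "h \<in> ring_iso R S" and h0: "h \<zero>\<^bsub>R\<^esub> = \<zero>\<^bsub>S\<^esub>"
    and hd: "\<And>x. x \<in> carrier R \<Longrightarrow> d' (h x) = h (d x)"
  shows "dg_algebra S d'"
proof -
  interpret ring R using dg by (simp add: dg_algebra_def f2_algebra_def)
  have hom: "h \<in> ring_hom R S" and S: "carrier S = h ` carrier R"
    using h by (auto simp: ring_iso_def bij_betw_def)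
  have dg': "\<And>x. x \<in> carrier R \<Longrightarrow> d x \<in> carrier R"
    "\<And>x y. x \<in> carrier R \<Longrightarrow> y \<in> carrier R \<Longrightarrow> d (x \<oplus>\<^bsub>R\<^esub> y) = d x \<oplus>\<^bsub>R\<^esub> d y"
    "\<And>x. x \<in> carrier R \<Longrightarrow> d (d x) = \<zero>\<^bsub>R\<^esub>"
    "\<And>x y. x \<in> carrier R \<Longrightarrow> y \<in> carrier R \<Longrightarrow>
      d (x \<otimes>\<^bsub>R\<^esub> y) = (d x \<otimes>\<^bsub>R\<^esub> y) \<oplus>\<^bsub>R\<^esub> (x \<otimes>\<^bsub>R\<^esub> d y)"
    using dg by (simp_all add: dg_algebra_def)
  have "f2_algebra S"
    using dg by (intro f2_algebra_iso[OF _ h h0]) (simp add: dg_algebra_def)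
  then show ?thesis
    unfolding dg_algebra_def S
    by (auto simp: hd dg' h0 simp flip: ring_hom_add[OF hom] ring_hom_mult[OF hom])
qed

lemma homology_zero_diff:
  assumes "ring R" and "\<And>x. x \<in> carrier R \<Longrightarrow> d x = \<zero>\<^bsub>R\<^esub>"
  shows "homology R d \<simeq> R"
proof -
  interpret ring R by fact
  have "cycles R d = carrier R" "boundaries R d = {\<zero>\<^bsub>R\<^esub>}"
    using assms(2) by (auto simp: cycles_def boundaries_def intro: image_eqI[of _ _ "\<zero>\<^bsub>R\<^esub>"])
  then show ?thesis
    using FactRing_zeroideal(1) by (simp add: homology_def)
qed

section \<open>A normal form for the quiver algebra\<close>

text \<open>
  The surviving paths: \<open>Stay i\<close> is \<open>(i)\<close>, \<open>Up i\<close> is \<open>(i|i+1)\<close>, \<open>Dn i\<close> is \<open>(i+1|i)\<close>, and \<open>Lp i\<close> is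
  \<open>(i+1|i|i+1)\<close>, which equals \<open>(i+1|i+2|i+1)\<close> in the quiver algebra if \<open>i + 2 \<le> m\<close>.
\<close>

datatype zz = Stay nat | Up nat | Dn nat | Lp nat

fun src :: "zz \<Rightarrow> nat" where
  "src (Stay i) = i"
| "src (Up i) = i"
| "src (Dn i) = Suc i"
| "src (Lp i) = Suc i"

fun tgt :: "zz \<Rightarrow> nat" where
  "tgt (Stay i) = i"
| "tgt (Up i) = Suc i"
| "tgt (Dn i) = i"
| "tgt (Lp i) = Suc i"

text \<open>The product of \<open>Up i\<close> and \<open>Dn i\<close> is \<open>(i|i+1|i)\<close>.
  For positive \<open>i\<close> it equals \<open>(i|i-1|i)\<close>, hence \<open>Lp (i - 1)\<close>,
  and for \<open>i = 0\<close> it is the relation \<open>(0|1|0) = 0\<close>. Loops are named by the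
  detour through the lower vertex because this one exists at the last vertex \<open>m\<close> as
  well.\<close>

fun zz_mult :: "zz \<Rightarrow> zz \<Rightarrow> zz option" where
  "zz_mult (Stay i) y = (if i = src y then Some y else None)"
| "zz_mult x (Stay j) = (if j = tgt x then Some x else None)"
| "zz_mult (Up i) (Dn j) = (if i = j \<and> 0 < i then Some (Lp (i - 1)) else None)"
| "zz_mult (Dn i) (Up j) = (if i = j then Some (Lp i) else None)"
| "zz_mult _ _ = None"

definition zz_set :: "nat \<Rightarrow> zz set" where
  "zz_set m = {p. src p \<le> m \<and> tgt p \<le> m}"

definition zz_alg :: "nat \<Rightarrow> (zz \<Rightarrow>\<^sub>0 bit) ring" where
  "zz_alg m = basis_algebra (zz_set m) zz_mult (Stay ` {..m})"

lemma zz_assoc: "Option.bind (zz_mult a b) (\<lambda>x. zz_mult x c) = Option.bind (zz_mult b c) (zz_mult a)"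
  by (cases a; cases b; cases c) auto

lemma zz_mult_SomeD: "zz_mult a b = Some c \<Longrightarrow> tgt a = src b \<and> src c = src a \<and> tgt c = tgt b"
  by (cases a; cases b) (auto split: if_splits)

lemma zz_mult_Stay_right: "zz_mult a (Stay j) = (if j = tgt a then Some a else None)"
  by (cases a) auto

interpretation zz: mult_basis "zz_set m" zz_mult "Stay ` {..m}"
  rewrites "basis_algebra (zz_set m) zz_mult (Stay ` {..m}) \<equiv> zz_alg m"
proof -
  show "mult_basis (zz_set m) zz_mult (Stay ` {..m})"
  proof
    fix a b c
    assume "a \<in> zz_set m" "b \<in> zz_set m" "zz_mult a b = Some c"
    then show "c \<in> zz_set m"
      by (auto simp: zz_set_def dest!: zz_mult_SomeD)
  next
    fix a assume a: "a \<in> zz_set m"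
    then show "\<exists>u\<in>Stay ` {..m}. zz_mult u a = Some a \<and> (\<forall>v\<in>Stay ` {..m} - {u}. zz_mult v a = None)"
      by (intro bexI[of _ "Stay (src a)"]) (auto simp: zz_set_def split: if_splits)
    from a show "\<exists>u\<in>Stay ` {..m}. zz_mult a u = Some a \<and> (\<forall>v\<in>Stay ` {..m} - {u}. zz_mult a v = None)"
      by (intro bexI[of _ "Stay (tgt a)"]) (auto simp: zz_set_def zz_mult_Stay_right split: if_splits)
  qed (auto simp: zz_assoc zz_set_def)
qed (simp add: zz_alg_def)

interpretation path: mult_basis "quiver_paths m" path_concat "(\<lambda>i. [i]) ` {..m}"
  rewrites "basis_algebra (quiver_paths m) path_concat ((\<lambda>i. [i]) ` {..m}) \<equiv> path_algebra m"
proof -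
  show "mult_basis (quiver_paths m) path_concat ((\<lambda>i. [i]) ` {..m})"
  proof
    fix a b c
    assume "a \<in> quiver_paths m" "b \<in> quiver_paths m" "path_concat a b = Some c"
    then show "c \<in> quiver_paths m"
      by (cases b) (auto simp: quiver_paths_def path_concat_def successively_append_iff
          successively_Cons split: if_splits)
  next
    fix a b c
    assume "a \<in> quiver_paths m" "b \<in> quiver_paths m" "c \<in> quiver_paths m"
    then show "Option.bind (path_concat a b) (\<lambda>x. path_concat x c) =
      Option.bind (path_concat b c) (path_concat a)"
      by (cases b; cases c) (auto simp: quiver_paths_def path_concat_def)
  next
    fix a assume a: "a \<in> quiver_paths m"
    then have ne: "a \<noteq> []" and "set a \<subseteq> {..m}"
      by (auto simp: quiver_paths_def)
    then have ends: "hd a \<le> m" "last a \<le> m"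
      using subsetD[of "set a" "{..m}" "hd a"] subsetD[of "set a" "{..m}" "last a"] by simp_all
    show "\<exists>u\<in>(\<lambda>i. [i]) ` {..m}. path_concat u a = Some a \<and>
        (\<forall>v\<in>(\<lambda>i. [i]) ` {..m} - {u}. path_concat v a = None)"
      using ne ends by (intro bexI[of _ "[hd a]"]) (auto simp: path_concat_def)
    show "\<exists>u\<in>(\<lambda>i. [i]) ` {..m}. path_concat a u = Some a \<and>
        (\<forall>v\<in>(\<lambda>i. [i]) ` {..m} - {u}. path_concat a v = None)"
      using ne ends by (intro bexI[of _ "[last a]"]) (auto simp: path_concat_def)
  qed (auto simp: quiver_paths_def)
qed (simp add: path_algebra_def)

text \<open>It is applied to adjacent vertices, where the second branch means
  \<open>i = Suc j\<close>.\<close>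

definition edge :: "nat \<Rightarrow> nat \<Rightarrow> zz" where
  "edge i j = (if j = Suc i then Up i else Dn j)"

text \<open>The path is multiplied out from its right end; \<open>None\<close> records that it
  vanishes in the quotient.\<close>

fun nf :: "nat list \<Rightarrow> zz option" where
  "nf [] = None"
| "nf [i] = Some (Stay i)"
| "nf (i # j # p) = Option.bind (nf (j # p)) (zz_mult (edge i j))"

fun rep :: "zz \<Rightarrow> nat list" where
  "rep (Stay i) = [i]"
| "rep (Up i) = [i, Suc i]"
| "rep (Dn i) = [Suc i, i]"
| "rep (Lp i) = [Suc i, i, Suc i]"

lemma rep_path: "z \<in> zz_set m \<Longrightarrow> rep z \<in> quiver_paths m"
  by (cases z) (auto simp: zz_set_def quiver_paths_def)

lemma nf_rep: "nf (rep z) = Some z"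
  by (cases z) (auto simp: edge_def)

lemma quiver_paths_ConsD: "i # j # p \<in> quiver_paths m \<Longrightarrow>
    j # p \<in> quiver_paths m \<and> i \<le> m \<and> j \<le> m \<and> (j = Suc i \<or> i = Suc j)"
  by (auto simp: quiver_paths_def)

text \<open>Reduction keeps the endpoints. Hence normal forms stay among the vertices up to
  \<open>m\<close>, and paths that do not compose have normal forms that do not compose
  either.\<close>

lemma nf_ends:
  "p \<in> quiver_paths m \<Longrightarrow> nf p = Some z \<Longrightarrow> src z = hd p \<and> tgt z = last p \<and> z \<in> zz_set m"
proof (induction p arbitrary: z rule: nf.induct)
  case (3 i j p)
  note q = quiver_paths_ConsD[OF 3(2)]
  obtain w where w: "nf (j # p) = Some w" "zz_mult (edge i j) w = Some z"
    using 3(3) by (auto simp: bind_eq_Some_conv)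
  have "src (edge i j) = i"
    using q by (auto simp: edge_def)
  with 3(1)[OF _ w(1)] q zz_mult_SomeD[OF w(2)] show ?case
    by (auto simp: zz_set_def)
qed (auto simp: zz_set_def quiver_paths_def)

text \<open>Induction along the first path: associativity of \<open>zz_mult\<close> moves its
  leading edge out of the product, and at a single vertex the idempotent acts trivially because
  reduction keeps the start of \<open>q\<close>.\<close>

lemma nf_concat:
  assumes "q \<in> quiver_paths m"
  shows "p \<in> quiver_paths m \<Longrightarrow> last p = hd q \<Longrightarrow>
    nf (p @ tl q) = Option.bind (nf p) (\<lambda>x. Option.bind (nf q) (zz_mult x))"
proof (induction p rule: nf.induct)
  case 1
  then show ?case by (simp add: quiver_paths_def)
next
  case (2 i)
  then have "i # tl q = q"
    using assms by (cases q) (auto simp: quiver_paths_def)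
  moreover have "Option.bind (nf q) (zz_mult (Stay i)) = nf q"
    using 2 nf_ends[OF assms] by (cases "nf q") auto
  ultimately show ?case by simp
next
  case (3 i j p)
  then have "nf ((j # p) @ tl q) = Option.bind (nf (j # p)) (\<lambda>x. Option.bind (nf q) (zz_mult x))"
    using quiver_paths_ConsD by (metis last_ConsR list.distinct(1))
  then show ?case
    by (cases "nf (j # p)"; cases "nf q") (simp_all add: zz_assoc)
qed

section \<open>Reduction as a homomorphism from the path algebra\<close>

definition path_red :: "(nat list \<Rightarrow>\<^sub>0 bit) \<Rightarrow> (zz \<Rightarrow>\<^sub>0 bit)" where
  "path_red = lin (\<lambda>p. obas (nf p))"

lemma path_red_0 [simp]: "path_red 0 = 0"
  and path_red_add [simp]: "path_red (x + y) = path_red x + path_red y"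
  by (simp_all add: path_red_def)

lemma path_red_bilinear_ext:
  assumes "Poly_Mapping.keys x \<subseteq> quiver_paths m" "Poly_Mapping.keys y \<subseteq> quiver_paths m"
  shows "path_red (bilinear_ext path_concat x y) = bilinear_ext zz_mult (path_red x) (path_red y)"
  using assms(1)
proof (induction x rule: pm_induct)
  case (bas p)
  show ?case using assms(2)
  proof (induction y rule: pm_induct)
    case (bas q)
    have "zz_mult a b = None" if "nf p = Some a" "nf q = Some b" "last p \<noteq> hd q" for a b
      using nf_ends[OF \<open>p \<in> _\<close> that(1)] nf_ends[OF \<open>q \<in> _\<close> that(2)] that(3)
        zz_mult_SomeD[of a b] by (cases "zz_mult a b") auto
    then show ?case
      using nf_concat[OF bas \<open>p \<in> _\<close>]
      by (cases "nf p"; cases "nf q") (auto simp: path_red_def path_concat_def)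
  qed (auto simp: path_red_def)
qed (auto simp: path_red_def)

lemma path_red_ring_hom: "ring_hom_ring (path_algebra m) (zz_alg m) path_red"
proof (rule ring_hom_ringI2[OF path.ring zz.ring], rule ring_hom_memI)
  fix x assume "x \<in> carrier (path_algebra m)"
  then show "path_red x \<in> carrier (zz_alg m)"
    unfolding path_red_def path.carrier_iff zz.carrier_iff
    by (intro keys_lin) (auto split: option.split dest: nf_ends)
next
  show "path_red \<one>\<^bsub>path_algebra m\<^esub> = \<one>\<^bsub>zz_alg m\<^esub>"
    by (simp add: path.one_eq zz.one_eq sum.reindex inj_on_def path_red_def)
qed (auto simp: path.carrier_iff path.mult_eq path.add_eq zz.mult_eq zz.add_eq path_red_bilinear_ext)


section \<open>The ideal of relations is the kernel of the reduction\<close>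

lemma A_relations_carrier: "A_relations m \<subseteq> carrier (path_algebra m)"
proof (rule subsetI)
  fix x assume "x \<in> A_relations m"
  then show "x \<in> carrier (path_algebra m)"
    unfolding A_relations_def path.carrier_iff
    by (auto simp: quiver_paths_def path.carrier_iff
        intro!: keys_plus_subset del: subsetI split: if_splits)
qed

lemma A_ideal_ideal: "ideal (A_ideal m) (path_algebra m)"
  unfolding A_ideal_def by (rule ring.genideal_ideal[OF path.ring A_relations_carrier])

lemma A_ideal_add: "x \<in> A_ideal m \<Longrightarrow> y \<in> A_ideal m \<Longrightarrow> x + y \<in> A_ideal m"
  using additive_subgroup.a_closed[OF ideal.axioms(1)[OF A_ideal_ideal]]
  by (simp add: path.add_eq)

lemma A_ideal_zero: "0 \<in> A_ideal m"
  using additive_subgroup.zero_closed[OF ideal.axioms(1)[OF A_ideal_ideal], of m]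
  by (simp add: path.zero_eq)

text \<open>Sums play the role of differences, so this is transitivity of congruence modulo the
  ideal.\<close>

lemma A_ideal_cancel: "x + y \<in> A_ideal m \<Longrightarrow> y + z \<in> A_ideal m \<Longrightarrow> x + z \<in> A_ideal m"
  using A_ideal_add[of "x + y" m "y + z"] by (simp add: add_ac)

lemma A_ideal_mult_left:
  "x \<in> A_ideal m \<Longrightarrow> Poly_Mapping.keys y \<subseteq> quiver_paths m \<Longrightarrow> bilinear_ext path_concat y x \<in> A_ideal m"
  using ideal.I_l_closed[OF A_ideal_ideal, of x m y] by (simp add: path.carrier_iff path.mult_eq)

lemma A_ideal_mult_right:
  "x \<in> A_ideal m \<Longrightarrow> Poly_Mapping.keys y \<subseteq> quiver_paths m \<Longrightarrow> bilinear_ext path_concat x y \<in> A_ideal m"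
  using ideal.I_r_closed[OF A_ideal_ideal, of x m y] by (simp add: path.carrier_iff path.mult_eq)

lemma A_relations_ideal: "x \<in> A_relations m \<Longrightarrow> x \<in> A_ideal m"
  unfolding A_ideal_def using ring.genideal_self[OF path.ring A_relations_carrier] by blast

lemma A_relation_up: "Suc (Suc i) \<le> m \<Longrightarrow> bas [i, Suc i, Suc (Suc i)] \<in> A_ideal m"
  by (rule A_relations_ideal) (auto simp: A_relations_def intro!: exI[of _ "Suc i"])

lemma A_relation_down: "Suc (Suc i) \<le> m \<Longrightarrow> bas [Suc (Suc i), Suc i, i] \<in> A_ideal m"
  by (rule A_relations_ideal) (auto simp: A_relations_def intro!: exI[of _ "Suc i"])

lemma A_relation_loop:
  "Suc (Suc i) \<le> m \<Longrightarrow>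
     bas [Suc i, Suc (Suc i), Suc i] + bas [Suc i, i, Suc i] \<in> A_ideal m"
  by (rule A_relations_ideal) (auto simp: A_relations_def intro!: exI[of _ "Suc i"])

lemma A_relation_start: "0 < m \<Longrightarrow> bas [0, Suc 0, 0] \<in> A_ideal m"
  by (rule A_relations_ideal) (auto simp: A_relations_def)

abbreviation orep :: "zz option \<Rightarrow> (nat list \<Rightarrow>\<^sub>0 bit)" where
  "orep x \<equiv> case x of None \<Rightarrow> 0 | Some z \<Rightarrow> bas (rep z)"

lemma A_ideal_append:
  assumes "bas (p @ [i]) \<in> A_ideal m" "i # q \<in> quiver_paths m"
  shows "bas (p @ i # q) \<in> A_ideal m"
  using A_ideal_mult_right[OF assms(1), of "bas (i # q)"] assms(2)
  by (simp add: path_concat_def)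

lemma A_ideal_prepend:
  assumes "bas (i # q) \<in> A_ideal m" "p @ [i] \<in> quiver_paths m"
  shows "bas (p @ i # q) \<in> A_ideal m"
  using A_ideal_mult_left[OF assms(1), of "bas (p @ [i])"] assms(2)
  by (simp add: path_concat_def)

text \<open>From above, the path begins with two descending edges. From \<open>j = 0\<close> it
  begins with \<open>(0|1|0)\<close>. From \<open>j = k + 1\<close> the loop
  \<open>(j|j+1|j)\<close> may be replaced by \<open>(j|k|j)\<close>, and then the ascending pair
  \<open>(k|j|j+1)\<close> appears.\<close>

lemma A_ideal_Lp_zero:
  assumes "j < m" and "i = j \<or> i = Suc (Suc j)" and "i \<le> m"
  shows "bas [i, Suc j, j, Suc j] \<in> A_ideal m"
proof -
  have e: "[j, Suc j] \<in> quiver_paths m"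
    using assms by (simp add: quiver_paths_def)
  consider "i = Suc (Suc j)" | "i = j" "j = 0" | k where "i = j" "j = Suc k"
    using assms(2) by (cases j) auto
  then show ?thesis
  proof cases
    case 1
    then show ?thesis
      using A_ideal_append[of "[Suc (Suc j), Suc j]" j m "[Suc j]"] A_relation_down[of j m] e assms
      by simp
  next
    case 2
    then show ?thesis
      using A_ideal_append[of "[0, Suc 0]" 0 m "[Suc 0]"] A_relation_start[of m] e assms
      by simp
  next
    case 3
    have "bas [j, Suc j, j, Suc j] + bas [j, k, j, Suc j] \<in> A_ideal m"
      using A_ideal_mult_right[OF A_relation_loop[of k m], of "bas [j, Suc j]"] 3 assms e
      by (simp add: path_concat_def)
    moreover have "bas [j, k, j, Suc j] \<in> A_ideal m"
      using A_ideal_prepend[of k "[j, Suc j]" m "[j]"] A_relation_up[of k m] 3 assms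
      by (simp add: quiver_paths_def)
    ultimately show ?thesis
      using A_ideal_add[of _ m "bas [j, k, j, Suc j]"] 3 by (fastforce simp: add.assoc)
  qed
qed

text \<open>Each rule of \<open>zz_mult\<close> for a leading edge is one of the defining relations
  or, for loops, a consequence of them. This makes the reduction correct modulo the ideal.\<close>

lemma A_ideal_step:
  assumes z: "z \<in> zz_set m" "src z = j" and ij: "j = Suc i \<or> i = Suc j" "i \<le> m"
  shows "bas (i # rep z) + orep (zz_mult (edge i j) z) \<in> A_ideal m"
proof (cases z)
  case (Stay k)
  then show ?thesis
    using z ij by (auto simp: edge_def A_ideal_zero)
next
  case (Up k)
  then show ?thesis
    using z ij by (auto simp: edge_def zz_set_def A_ideal_zero A_relation_up)
next
  case (Dn k)
  show ?thesis
  proof (cases "i = k")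
    case True
    then show ?thesis
      using z Dn A_relation_loop[of "i - 1" m] A_relation_start[of m]
      by (cases i) (auto simp: edge_def zz_set_def)
  next
    case False
    then show ?thesis
      using z ij Dn by (auto simp: edge_def A_relation_down)
  qed
next
  case (Lp k)
  then show ?thesis
    using z ij A_ideal_Lp_zero[of k m i] by (auto simp: edge_def zz_set_def)
qed

lemma A_ideal_path:
  "p \<in> quiver_paths m \<Longrightarrow> bas p + orep (nf p) \<in> A_ideal m"
proof (induction p rule: nf.induct)
  case 1
  then show ?case by (simp add: quiver_paths_def)
next
  case (2 i)
  then show ?case by (simp add: A_ideal_zero)
next
  case (3 i j p)
  note q = quiver_paths_ConsD[OF 3(2)]
  have "bas [i, j] \<in> carrier (path_algebra m)"
    using q by (simp add: path.carrier_iff quiver_paths_def)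
  \<comment> \<open>The congruence for the tail of the path is multiplied on the left by its first
    edge.\<close>
  then have "bilinear_ext path_concat (bas [i, j]) (bas (j # p) + orep (nf (j # p))) \<in> A_ideal m"
    using 3(1) q by (intro A_ideal_mult_left) (auto simp: path.carrier_iff)
  then have *: "bas (i # j # p) + bilinear_ext path_concat (bas [i, j]) (orep (nf (j # p))) \<in> A_ideal m"
    by (simp add: path_concat_def)
  show ?case
  proof (cases "nf (j # p)")
    case None
    with * show ?thesis by simp
  next
    case (Some z)
    have z: "src z = j" "z \<in> zz_set m"
      using nf_ends[of "j # p" m z] q Some by auto
    have "bilinear_ext path_concat (bas [i, j]) (bas (rep z)) = bas (i # rep z)"
      using z by (cases z) (auto simp: path_concat_def)
    with * Some A_ideal_step[OF z(2,1), of i] q show ?thesis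
      by (auto intro: A_ideal_cancel)
  qed
qed

lemma A_ideal_red:
  assumes "Poly_Mapping.keys x \<subseteq> quiver_paths m"
  shows "x + lin (\<lambda>z. bas (rep z)) (path_red x) \<in> A_ideal m"
  using assms
proof (induction x rule: pm_induct)
  case zero
  then show ?case by (simp add: path_red_def A_ideal_zero)
next
  case (bas p)
  have "lin (\<lambda>z. bas (rep z)) (path_red (bas p)) = orep (nf p)"
    by (simp add: path_red_def split: option.split)
  with A_ideal_path[OF bas] show ?case by simp
next
  case (add x y)
  from A_ideal_add[OF add(3,4)] show ?case by (simp add: path_red_def add_ac)
qed

text \<open>The generators reduce to zero, which gives one inclusion. Conversely an element is
  congruent to the lift of its reduction, so if the reduction vanishes, the element lies in the
  ideal.\<close>

lemma A_ideal_kernel: "A_ideal m = a_kernel (path_algebra m) (zz_alg m) path_red"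
proof
  interpret path_red: ring_hom_ring "path_algebra m" "zz_alg m" path_red by (rule path_red_ring_hom)
  have "path_red x = 0" if "x \<in> A_relations m" for x
    using that by (auto simp: A_relations_def path_red_def edge_def split: if_splits)
  then have "A_relations m \<subseteq> a_kernel (path_algebra m) (zz_alg m) path_red"
    unfolding a_kernel_def' zz.zero_eq using A_relations_carrier by blast
  then show "A_ideal m \<subseteq> a_kernel (path_algebra m) (zz_alg m) path_red"
    unfolding A_ideal_def by (rule ring.genideal_minimal[OF path.ring path_red.kernel_is_ideal])
  show "a_kernel (path_algebra m) (zz_alg m) path_red \<subseteq> A_ideal m"
  proof
    fix x assume "x \<in> a_kernel (path_algebra m) (zz_alg m) path_red"
    then have "Poly_Mapping.keys x \<subseteq> quiver_paths m" "path_red x = 0"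
      unfolding a_kernel_def' path.carrier_iff zz.zero_eq by blast+
    with A_ideal_red[of x m] show "x \<in> A_ideal m" by simp
  qed
qed

text \<open>This is the inverse of the map from the first isomorphism theorem. The vertices and
  ascending edges are recorded because the modules \<open>P k\<close> and the differential of
  \<open>Q j\<close> are built from them.\<close>

lemma zz_alg_iso:
  obtains \<theta> where "\<theta> \<in> ring_iso (zz_alg m) (A_alg m)"
    and "\<And>k. k \<le> m \<Longrightarrow> \<theta> (bas (Stay k)) = A_path m [k]"
    and "\<And>k. k < m \<Longrightarrow> \<theta> (bas (Up k)) = A_path m [k, Suc k]"
proof -
  interpret path_red: ring_hom_ring "path_algebra m" "zz_alg m" path_red by (rule path_red_ring_hom)
  \<comment> \<open>\<open>path_red\<close> is constant on each coset of its kernel, and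
    \<open>the_elem\<close> extracts this constant value.\<close>
  let ?\<psi> = "\<lambda>X. the_elem (path_red ` X)"
  have path_red_rep: "path_red (bas (rep z)) = bas z" for z
    by (simp add: path_red_def nf_rep)
  have surj: "path_red ` carrier (path_algebra m) = carrier (zz_alg m)"
  proof
    show "carrier (zz_alg m) \<subseteq> path_red ` carrier (path_algebra m)"
    proof
      fix x assume x: "x \<in> carrier (zz_alg m)"
      have "path_red (lin (\<lambda>z. bas (rep z)) x) = x"
        by (simp add: path_red_def lin_lin nf_rep)
      moreover have "lin (\<lambda>z. bas (rep z)) x \<in> carrier (path_algebra m)"
        using x rep_path unfolding path.carrier_iff zz.carrier_iff by (intro keys_lin) auto
      ultimately show "x \<in> path_red ` carrier (path_algebra m)" by (metis imageI)
    qed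
  qed auto
  have \<psi>: "?\<psi> \<in> ring_iso (A_alg m) (zz_alg m)"
    using path_red.FactRing_iso_set[OF surj] by (simp add: A_alg_def A_ideal_kernel)
  have A: "ring (A_alg m)"
    unfolding A_alg_def by (rule ideal.quotient_is_ring[OF A_ideal_ideal])
  have path: "inv_into (carrier (A_alg m)) ?\<psi> (bas z) = A_path m (rep z)" if z: "z \<in> zz_set m" for z
  proof (rule inv_into_f_eq)
    have c: "bas (rep z) \<in> carrier (path_algebra m)"
      using rep_path[OF z] by (simp add: path.carrier_iff)
    show "inj_on ?\<psi> (carrier (A_alg m))"
      using \<psi> by (simp add: ring_iso_def bij_betw_def)
    show "A_path m (rep z) \<in> carrier (A_alg m)"
      using c by (auto simp: A_path_def A_alg_def FactRing_def A_RCOSETS_def' a_r_coset_def')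
    show "?\<psi> (A_path m (rep z)) = bas z"
      using path_red.the_elem_simp[OF c] by (simp add: A_path_def A_ideal_kernel path_red_rep)
  qed
  show thesis
  proof (rule that[OF ring_iso_set_sym[OF A \<psi>]])
    show "inv_into (carrier (A_alg m)) ?\<psi> (bas (Stay k)) = A_path m [k]" if "k \<le> m" for k
      using path[of "Stay k"] that by (simp add: zz_set_def)
    show "inv_into (carrier (A_alg m)) ?\<psi> (bas (Up k)) = A_path m [k, Suc k]" if "k < m" for k
      using path[of "Up k"] that by (simp add: zz_set_def)
  qed
qed

section \<open>The endomorphism algebra of the complexes in matrix form\<close>

abbreviation zz_star :: "(zz \<Rightarrow>\<^sub>0 bit) \<Rightarrow> (zz \<Rightarrow>\<^sub>0 bit) \<Rightarrow> (zz \<Rightarrow>\<^sub>0 bit)" (infixl \<open>\<star>\<close> 70) where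
  "x \<star> y \<equiv> bilinear_ext zz_mult x y"

lemma star_assoc: "(x \<star> y) \<star> z = x \<star> (y \<star> z)"
  by (rule bilinear_ext_assoc[of UNIV]) (simp_all add: zz_assoc)

text \<open>This is the path basis of \<open>e_a A e_b\<close>, where \<open>e_a\<close> is
  \<open>idem a\<close>. The bounds are inequalities because \<open>Q a\<close> contains all of
  \<open>P 0\<close> to \<open>P a\<close>.\<close>

definition zz_block :: "nat \<Rightarrow> nat \<Rightarrow> zz set" where
  "zz_block a b = {p. src p \<le> a \<and> tgt p \<le> b}"

lemma zz_set_block: "zz_set m = zz_block m m"
  by (simp add: zz_set_def zz_block_def)

lemma zz_block_mono: "a \<le> a' \<Longrightarrow> b \<le> b' \<Longrightarrow> zz_block a b \<subseteq> zz_block a' b'"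
  by (auto simp: zz_block_def)

lemma keys_star:
  assumes "Poly_Mapping.keys x \<subseteq> zz_block a b" "Poly_Mapping.keys y \<subseteq> zz_block c d"
  shows "Poly_Mapping.keys (x \<star> y) \<subseteq> zz_block a d"
  unfolding bilinear_ext_lin
proof (intro keys_lin)
  fix p q assume "p \<in> Poly_Mapping.keys x" "q \<in> Poly_Mapping.keys y"
  with assms have "src p \<le> a" "tgt q \<le> d"
    by (auto simp: zz_block_def)
  then show "Poly_Mapping.keys (obas (zz_mult p q)) \<subseteq> zz_block a d"
    by (auto simp: zz_block_def split: option.split dest: zz_mult_SomeD)
qed

definition idem :: "nat \<Rightarrow> (zz \<Rightarrow>\<^sub>0 bit)" where
  "idem i = (\<Sum>k\<le>i. bas (Stay k))"

lemma idem_block: "Poly_Mapping.keys (idem i) \<subseteq> zz_block i i"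
  unfolding idem_def by (intro keys_sum_subset) (simp add: zz_block_def)

lemma star_idem_right: "Poly_Mapping.keys x \<subseteq> zz_block a i \<Longrightarrow> x \<star> idem i = x"
proof (induction x rule: pm_induct)
  case (bas p)
  have "bas p \<star> idem i = (\<Sum>k\<le>i. if k = tgt p then bas p else 0)"
    unfolding idem_def bilinear_ext_sum_right by (intro sum.cong) (auto simp: zz_mult_Stay_right)
  with bas show ?case by (simp add: zz_block_def)
qed auto

lemma star_idem_left: "Poly_Mapping.keys x \<subseteq> zz_block i b \<Longrightarrow> idem i \<star> x = x"
proof (induction x rule: pm_induct)
  case (bas p)
  have "idem i \<star> bas p = (\<Sum>k\<le>i. if k = src p then bas p else 0)"
    unfolding idem_def bilinear_ext_sum_left by (intro sum.cong) auto
  with bas show ?case by (simp add: zz_block_def)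
qed auto

text \<open>Right multiplication by this element is the differential of \<open>Q i\<close> on
  \<open>A e_i\<close>.\<close>

definition Q_edges :: "nat \<Rightarrow> (zz \<Rightarrow>\<^sub>0 bit)" where
  "Q_edges i = (\<Sum>k<i. bas (Up k))"

lemma Q_edges_block: "Poly_Mapping.keys (Q_edges i) \<subseteq> zz_block i i"
  unfolding Q_edges_def by (intro keys_sum_subset) (simp add: zz_block_def)

lemma Q_edges_Stay: "k \<le> i \<Longrightarrow> Q_edges i \<star> bas (Stay k) = (if k = 0 then 0 else bas (Up (k - 1)))"
proof -
  assume k: "k \<le> i"
  have "Q_edges i \<star> bas (Stay k) = (\<Sum>l<i. if 0 < k \<and> l = k - 1 then bas (Up l) else 0)"
    unfolding Q_edges_def bilinear_ext_sum_left by (intro sum.cong) auto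
  also have "\<dots> = (if k = 0 then 0 else bas (Up (k - 1)))"
    using k by (cases k) (auto simp: Suc_le_eq)
  finally show ?thesis .
qed

text \<open>
  The triple \<open>(i, p, j)\<close> stands for the map from \<open>Q i\<close> to \<open>Q j\<close> that is right multiplication by the
  path \<open>p\<close> on the summand indexed by the source of \<open>p\<close>.
\<close>

type_synonym hbasis = "nat \<times> zz \<times> nat"

fun h_mult :: "hbasis \<Rightarrow> hbasis \<Rightarrow> hbasis option" where
  "h_mult (i, p, j) (j', q, k) =
     (if j = j' then map_option (\<lambda>r. (i, r, k)) (zz_mult p q) else None)"

definition h_set :: "nat \<Rightarrow> hbasis set" where
  "h_set m = {(i, p, j). i \<le> m \<and> j \<le> m \<and> p \<in> zz_block i j}"

text \<open>The identity of each \<open>Q i\<close> splits into the projections onto its summands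
  \<open>P k\<close>, and these are the idempotents.\<close>

definition h_units :: "nat \<Rightarrow> hbasis set" where
  "h_units m = (\<lambda>(i, k). (i, Stay k, i)) ` (SIGMA i:{..m}. {..i})"

definition h_alg :: "nat \<Rightarrow> (hbasis \<Rightarrow>\<^sub>0 bit) ring" where
  "h_alg m = basis_algebra (h_set m) h_mult (h_units m)"

interpretation h: mult_basis "h_set m" h_mult "h_units m"
  rewrites "basis_algebra (h_set m) h_mult (h_units m) \<equiv> h_alg m"
proof -
  show "mult_basis (h_set m) h_mult (h_units m)"
  proof
    fix a b c
    assume "a \<in> h_set m" "b \<in> h_set m" "h_mult a b = Some c"
    then show "c \<in> h_set m"
      by (cases a; cases b) (auto simp: h_set_def zz_block_def split: if_splits dest!: zz_mult_SomeD)
  next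
    fix a b c
    show "Option.bind (h_mult a b) (\<lambda>x. h_mult x c) = Option.bind (h_mult b c) (h_mult a)"
    proof (cases a; cases b; cases c)
      fix i p j j' q k k' r l
      assume "a = (i, p, j)" "b = (j', q, k)" "c = (k', r, l)"
      then show ?thesis
        using zz_assoc[of p q r] by (cases "zz_mult p q"; cases "zz_mult q r") auto
    qed
  next
    fix a assume a: "a \<in> h_set m"
    obtain i p j where ipj: "a = (i, p, j)" by (cases a)
    have u: "(i, Stay (src p), i) \<in> h_units m" "(j, Stay (tgt p), j) \<in> h_units m"
      using a ipj by (auto simp: h_units_def h_set_def zz_block_def image_iff)
    show "\<exists>u\<in>h_units m. h_mult u a = Some a \<and> (\<forall>v\<in>h_units m - {u}. h_mult v a = None)"
      using ipj by (intro bexI[OF _ u(1)]) (auto simp: h_units_def split: if_splits)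
    show "\<exists>u\<in>h_units m. h_mult a u = Some a \<and> (\<forall>v\<in>h_units m - {u}. h_mult a v = None)"
      using ipj by (intro bexI[OF _ u(2)]) (auto simp: h_units_def zz_mult_Stay_right split: if_splits)
  qed (auto simp: h_units_def h_set_def zz_block_def)
qed (simp add: h_alg_def)

section \<open>Elements of \<open>h_alg\<close> as matrices with entries in the blocks\<close>

definition entry :: "nat \<Rightarrow> nat \<Rightarrow> (hbasis \<Rightarrow>\<^sub>0 bit) \<Rightarrow> (zz \<Rightarrow>\<^sub>0 bit)" where
  "entry i j = lin (\<lambda>(i', p, j'). if i' = i \<and> j' = j then bas p else 0)"

definition emb :: "nat \<Rightarrow> nat \<Rightarrow> (zz \<Rightarrow>\<^sub>0 bit) \<Rightarrow> (hbasis \<Rightarrow>\<^sub>0 bit)" where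
  "emb i j = lin (\<lambda>p. bas (i, p, j))"

lemma entry_0 [simp]: "entry i j 0 = 0"
  and entry_add [simp]: "entry i j (M + N) = entry i j M + entry i j N"
  and entry_sum [simp]: "entry i j (sum f I) = (\<Sum>x\<in>I. entry i j (f x))"
  and entry_bas: "entry i j (bas (i', p, j')) = (if i' = i \<and> j' = j then bas p else 0)"
  by (simp_all add: entry_def)

lemma emb_0 [simp]: "emb i j 0 = 0"
  and emb_add [simp]: "emb i j (x + y) = emb i j x + emb i j y"
  and emb_bas [simp]: "emb i j (bas p) = bas (i, p, j)"
  by (simp_all add: emb_def)

lemma entry_emb: "entry i j (emb i' j' x) = (if i' = i \<and> j' = j then x else 0)"
  by (auto simp: entry_def emb_def lin_lin)

lemma keys_emb:
  "Poly_Mapping.keys x \<subseteq> zz_block i j \<Longrightarrow> i \<le> m \<Longrightarrow> j \<le> m \<Longrightarrow>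
     Poly_Mapping.keys (emb i j x) \<subseteq> h_set m"
  unfolding emb_def by (intro keys_lin) (auto simp: h_set_def)

lemma keys_entry:
  "Poly_Mapping.keys M \<subseteq> h_set m \<Longrightarrow> Poly_Mapping.keys (entry i j M) \<subseteq> zz_block i j"
  unfolding entry_def by (intro keys_lin) (auto simp: h_set_def split: if_splits)

lemma emb_entry_sum:
  "Poly_Mapping.keys M \<subseteq> h_set m \<Longrightarrow> M = (\<Sum>i\<le>m. \<Sum>j\<le>m. emb i j (entry i j M))"
proof (induction M rule: pm_induct)
  case (bas a)
  obtain i p j where a: "a = (i, p, j)" by (cases a)
  then have "i \<le> m" "j \<le> m" using bas by (auto simp: h_set_def)
  moreover have "(\<Sum>i'\<le>m. \<Sum>j'\<le>m. emb i' j' (entry i' j' (bas (i, p, j)))) =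
      (\<Sum>i'\<le>m. \<Sum>j'\<le>m. if j' = j then if i' = i then bas (i, p, j) else 0 else 0)"
    by (intro sum.cong refl) (auto simp: entry_bas)
  ultimately show ?case using a by simp
qed (simp_all add: sum.distrib)

text \<open>Two triples multiply to something nonzero only if their middle indices agree, so the
  product is matrix multiplication; on basis elements at most one summand survives.\<close>

lemma entry_mult:
  assumes "Poly_Mapping.keys M \<subseteq> h_set m" "Poly_Mapping.keys N \<subseteq> h_set m"
  shows "entry i k (bilinear_ext h_mult M N) = (\<Sum>j\<le>m. entry i j M \<star> entry j k N)"
  using assms(1)
proof (induction M rule: pm_induct)
  case (bas a)
  obtain i' p j where a: "a = (i', p, j)" by (cases a)
  then have jm: "j \<le> m" using bas by (auto simp: h_set_def)
  show ?case using assms(2)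
  proof (induction N rule: pm_induct)
    case (bas b)
    obtain j' q k' where b: "b = (j', q, k')" by (cases b)
    have "(\<Sum>l\<le>m. entry i l (bas a) \<star> entry l k (bas b)) =
        (\<Sum>l\<le>m. if l = j then (if j' = j \<and> i' = i \<and> k' = k then bas p \<star> bas q else 0) else 0)"
      by (intro sum.cong refl) (auto simp: a b entry_bas simp del: bilinear_ext_bas)
    with jm show ?case
      by (cases "zz_mult p q") (auto simp: a b entry_bas)
  qed (simp_all add: sum.distrib)
qed (simp_all add: sum.distrib)

lemma entry_one:
  "i \<le> m \<Longrightarrow> entry i j \<one>\<^bsub>h_alg m\<^esub> = (if i = j then idem i else 0)"
proof -
  assume i: "i \<le> m"
  have "inj_on (\<lambda>(i, k). (i, Stay k, i)) (SIGMA i:{..m}. {..i})"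
    by (auto simp: inj_on_def)
  then have "entry i j \<one>\<^bsub>h_alg m\<^esub> = (\<Sum>(i', k)\<in>(SIGMA i:{..m}. {..i}). entry i j (bas (i', Stay k, i')))"
    by (simp add: h.one_eq h_units_def sum.reindex case_prod_unfold)
  also have "\<dots> = (\<Sum>i'\<le>m. \<Sum>k\<le>i'. entry i j (bas (i', Stay k, i')))"
    by (subst sum.Sigma) auto
  also have "\<dots> = (\<Sum>i'\<le>m. if i' = i then (if i = j then idem i else 0) else 0)"
    by (intro sum.cong refl) (auto simp: entry_bas idem_def)
  finally show ?thesis using i by simp
qed

definition h_diff_elem :: "nat \<Rightarrow> (hbasis \<Rightarrow>\<^sub>0 bit)" where
  "h_diff_elem m = (\<Sum>i\<le>m. emb i i (Q_edges i))"

lemma h_diff_elem_keys: "Poly_Mapping.keys (h_diff_elem m) \<subseteq> h_set m"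
  unfolding h_diff_elem_def by (intro keys_sum_subset keys_emb Q_edges_block) auto

lemma entry_h_diff_elem: "i \<le> m \<Longrightarrow> entry i j (h_diff_elem m) = (if i = j then Q_edges i else 0)"
proof -
  assume i: "i \<le> m"
  have "entry i j (h_diff_elem m) = (\<Sum>l\<le>m. if l = i then (if i = j then Q_edges i else 0) else 0)"
    unfolding h_diff_elem_def entry_sum by (intro sum.cong refl) (auto simp: entry_emb)
  with i show ?thesis by simp
qed

text \<open>Maps are right multiplications, so the first term applies the differential before the
  map and the second applies it afterwards. Together they form \<open>D(F)\<close>.\<close>

definition h_diff :: "nat \<Rightarrow> (hbasis \<Rightarrow>\<^sub>0 bit) \<Rightarrow> (hbasis \<Rightarrow>\<^sub>0 bit)" where
  "h_diff m M = (h_diff_elem m \<otimes>\<^bsub>h_alg m\<^esub> M) \<oplus>\<^bsub>h_alg m\<^esub> (M \<otimes>\<^bsub>h_alg m\<^esub> h_diff_elem m)"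

lemma entry_h_diff:
  assumes M: "Poly_Mapping.keys M \<subseteq> h_set m" and ij: "i \<le> m" "j \<le> m"
  shows "entry i j (h_diff m M) = Q_edges i \<star> entry i j M + entry i j M \<star> Q_edges j"
proof -
  have "entry i j (bilinear_ext h_mult (h_diff_elem m) M) =
      (\<Sum>l\<le>m. if l = i then Q_edges i \<star> entry i j M else 0)"
    unfolding entry_mult[OF h_diff_elem_keys M] using ij
    by (intro sum.cong refl) (auto simp: entry_h_diff_elem)
  moreover have "entry i j (bilinear_ext h_mult M (h_diff_elem m)) =
      (\<Sum>l\<le>m. if l = j then entry i j M \<star> Q_edges j else 0)"
    unfolding entry_mult[OF M h_diff_elem_keys] using ij
    by (intro sum.cong refl) (auto simp: entry_h_diff_elem)
  ultimately show ?thesis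
    using ij by (simp add: h_diff_def h.mult_eq h.add_eq)
qed

lemma h_eqI:
  assumes "Poly_Mapping.keys M \<subseteq> h_set m" "Poly_Mapping.keys N \<subseteq> h_set m"
    and "\<And>i j. i \<le> m \<Longrightarrow> j \<le> m \<Longrightarrow> entry i j M = entry i j N"
  shows "M = N"
  using emb_entry_sum[OF assms(1)] emb_entry_sum[OF assms(2)] assms(3) by simp

lemma h_dg: "dg_algebra (h_alg m) (h_diff m)"
proof -
  \<comment> \<open>Two consecutive ascending edges multiply to zero.\<close>
  have Qd2: "Q_edges i \<star> Q_edges i = 0" for i
    by (simp add: Q_edges_def)
  have "h_diff_elem m \<otimes>\<^bsub>h_alg m\<^esub> h_diff_elem m = \<zero>\<^bsub>h_alg m\<^esub>"
    unfolding h.mult_eq h.zero_eq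
  proof (rule h_eqI)
    show "entry i j (bilinear_ext h_mult (h_diff_elem m) (h_diff_elem m)) = entry i j 0"
      if "i \<le> m" "j \<le> m" for i j
      unfolding entry_mult[OF h_diff_elem_keys h_diff_elem_keys] entry_0
      using that by (intro sum.neutral) (auto simp: entry_h_diff_elem Qd2)
  qed (auto intro!: h.mult_closed h_diff_elem_keys del: subsetI)
  then show ?thesis
    unfolding h_diff_def[abs_def]
    by (intro dg_algebra_commutator h.f2) (simp_all add: h.carrier_iff h_diff_elem_keys)
qed

section \<open>Transport of the matrix model to the Hom algebra\<close>

locale A_model =
  fixes m :: nat and \<theta> :: "(zz \<Rightarrow>\<^sub>0 bit) \<Rightarrow> A_elem"
  assumes \<theta>_iso: "\<theta> \<in> ring_iso (zz_alg m) (A_alg m)"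
    and \<theta>_Stay: "k \<le> m \<Longrightarrow> \<theta> (bas (Stay k)) = A_path m [k]"
    and \<theta>_Up: "k < m \<Longrightarrow> \<theta> (bas (Up k)) = A_path m [k, Suc k]"
begin

sublocale A: ring "A_alg m"
  unfolding A_alg_def by (rule ideal.quotient_is_ring[OF A_ideal_ideal])

definition carr :: "(zz \<Rightarrow>\<^sub>0 bit) set" where
  "carr = {x. Poly_Mapping.keys x \<subseteq> zz_block m m}"

text \<open>Under \<open>\<theta>\<close> this is the left module \<open>A e_i\<close>, the future
  total module of \<open>Q i\<close>.\<close>

definition row :: "nat \<Rightarrow> (zz \<Rightarrow>\<^sub>0 bit) set" where
  "row i = {x. Poly_Mapping.keys x \<subseteq> zz_block m i}"

definition blk :: "nat \<Rightarrow> nat \<Rightarrow> (zz \<Rightarrow>\<^sub>0 bit) set" where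
  "blk i j = {x. Poly_Mapping.keys x \<subseteq> zz_block i j}"

lemma carr_eq: "carr = carrier (zz_alg m)"
  by (auto simp: carr_def zz.carrier_iff zz_set_block)

lemma carr_star: "x \<in> carr \<Longrightarrow> y \<in> carr \<Longrightarrow> x \<star> y \<in> carr"
  by (auto simp: carr_def intro!: keys_star del: subsetI)

lemma carr_sum: "(\<And>i. i \<in> I \<Longrightarrow> f i \<in> carr) \<Longrightarrow> sum f I \<in> carr"
  by (auto simp: carr_def intro!: keys_sum_subset del: subsetI)

lemma carr_Stay: "k \<le> m \<Longrightarrow> bas (Stay k) \<in> carr"
  by (simp add: carr_def zz_block_def)

lemma carr_Up: "k < m \<Longrightarrow> bas (Up k) \<in> carr"
  by (simp add: carr_def zz_block_def)

lemma row_carr: "i \<le> m \<Longrightarrow> x \<in> row i \<Longrightarrow> x \<in> carr"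
  using zz_block_mono[of m m i m] by (auto simp: row_def carr_def)

lemma row_add: "x \<in> row i \<Longrightarrow> y \<in> row i \<Longrightarrow> x + y \<in> row i"
  by (simp add: row_def keys_plus_subset)

lemma row_star: "x \<in> carr \<Longrightarrow> y \<in> row i \<Longrightarrow> x \<star> y \<in> row i"
  unfolding row_def carr_def using keys_star by blast

lemma row_blk: "x \<in> row i \<Longrightarrow> y \<in> blk i j \<Longrightarrow> x \<star> y \<in> row j"
  unfolding row_def blk_def using keys_star by blast

lemma idem_row: "i \<le> m \<Longrightarrow> idem i \<in> row i"
  using idem_block[of i] zz_block_mono[of i m i i] by (auto simp: row_def)

lemma row_idem: "x \<in> row i \<Longrightarrow> x \<star> idem i = x"
  by (auto simp: row_def intro!: star_idem_right)

lemma Q_edges_blk: "Q_edges i \<in> blk i i"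
  by (simp add: blk_def Q_edges_block)

lemma \<theta>_hom: "\<theta> \<in> ring_hom (zz_alg m) (A_alg m)"
  using \<theta>_iso by (simp add: ring_iso_def)

lemma \<theta>_closed: "x \<in> carr \<Longrightarrow> \<theta> x \<in> carrier (A_alg m)"
  using ring_hom_closed[OF \<theta>_hom] by (simp add: carr_eq)

lemma \<theta>_add: "x \<in> carr \<Longrightarrow> y \<in> carr \<Longrightarrow> \<theta> (x + y) = \<theta> x \<oplus>\<^bsub>A_alg m\<^esub> \<theta> y"
  using ring_hom_add[OF \<theta>_hom] by (simp add: carr_eq zz.add_eq)

lemma \<theta>_star: "x \<in> carr \<Longrightarrow> y \<in> carr \<Longrightarrow> \<theta> (x \<star> y) = \<theta> x \<otimes>\<^bsub>A_alg m\<^esub> \<theta> y"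
  using ring_hom_mult[OF \<theta>_hom] by (simp add: carr_eq zz.mult_eq)

lemma \<theta>_zero: "\<theta> 0 = \<zero>\<^bsub>A_alg m\<^esub>"
  using ring_hom_zero[OF \<theta>_hom zz.ring A.ring_axioms] by (simp add: zz.zero_eq)

lemma \<theta>_inj: "x \<in> carr \<Longrightarrow> y \<in> carr \<Longrightarrow> \<theta> x = \<theta> y \<Longrightarrow> x = y"
  using \<theta>_iso by (auto simp: ring_iso_def bij_betw_def carr_eq dest: inj_onD)

lemma \<theta>_surj: "a \<in> carrier (A_alg m) \<Longrightarrow> \<exists>x\<in>carr. a = \<theta> x"
  using \<theta>_iso by (auto simp: ring_iso_def bij_betw_def carr_eq)

lemma \<theta>_sum:
  assumes "finite I" "\<And>i. i \<in> I \<Longrightarrow> f i \<in> carr"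
  shows "(\<Oplus>\<^bsub>A_alg m\<^esub>i\<in>I. \<theta> (f i)) = \<theta> (sum f I)"
  using assms
proof (induction I)
  case (insert i I)
  then have "(\<Oplus>\<^bsub>A_alg m\<^esub>i\<in>insert i I. \<theta> (f i)) = \<theta> (f i) \<oplus>\<^bsub>A_alg m\<^esub> (\<Oplus>\<^bsub>A_alg m\<^esub>i\<in>I. \<theta> (f i))"
    by (intro A.finsum_insert) (auto simp: \<theta>_closed)
  with insert show ?case
    by (simp add: \<theta>_add carr_sum)
qed (simp add: \<theta>_zero)

text \<open>
  The identification of \<open>A e\<close>, with \<open>e\<close> the idempotent \<open>idem i\<close>, with the total module of \<open>Q i\<close>.
\<close>

definition \<tau> :: "nat \<Rightarrow> (zz \<Rightarrow>\<^sub>0 bit) \<Rightarrow> (nat \<Rightarrow> A_elem)" where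
  "\<tau> i x = (\<lambda>k\<in>{..i}. \<theta> (x \<star> bas (Stay k)))"

lemma P_mod_eq: "k \<le> m \<Longrightarrow> P_mod m k = {\<theta> (x \<star> bas (Stay k)) | x. x \<in> carr}"
proof -
  assume k: "k \<le> m"
  have "\<theta> (x \<star> bas (Stay k)) = \<theta> x \<otimes>\<^bsub>A_alg m\<^esub> A_path m [k]" if "x \<in> carr" for x
    using that k by (simp add: \<theta>_star carr_Stay \<theta>_Stay)
  then show ?thesis
    unfolding P_mod_def using \<theta>_surj \<theta>_closed by (metis (lifting))
qed

lemma \<tau>_closed:
  assumes "i \<le> m" "x \<in> row i"
  shows "\<tau> i x \<in> Q_mod m i"
proof -
  have "x \<in> carr" using assms by (rule row_carr)
  then show ?thesis
    using assms(1) by (auto simp: \<tau>_def Q_mod_def P_mod_eq)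
qed

text \<open>The components determine the products with all vertices up to \<open>i\<close>. Their
  sum is the product with \<open>idem i\<close>, which is the element itself.\<close>

lemma \<tau>_inj:
  assumes i: "i \<le> m" and x: "x \<in> row i" and y: "y \<in> row i" and eq: "\<tau> i x = \<tau> i y"
  shows "x = y"
proof -
  have "x \<star> bas (Stay k) = y \<star> bas (Stay k)" if "k \<le> i" for k
  proof (rule \<theta>_inj)
    show "\<theta> (x \<star> bas (Stay k)) = \<theta> (y \<star> bas (Stay k))"
      using fun_cong[OF eq, of k] that by (simp add: \<tau>_def)
  qed (use that i x y row_carr in \<open>auto intro!: carr_star carr_Stay\<close>)
  then have "x \<star> idem i = y \<star> idem i"
    by (simp add: idem_def)
  with x y show ?thesis by (simp add: row_idem)
qed

lemma \<tau>_surj: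
  assumes i: "i \<le> m" and x: "x \<in> Q_mod m i"
  obtains y where "y \<in> row i" "x = \<tau> i y"
proof -
  have "\<forall>k\<in>{..i}. \<exists>y\<in>carr. x k = \<theta> (y \<star> bas (Stay k))"
  proof
    fix k assume "k \<in> {..i}"
    then have "x k \<in> P_mod m k" "k \<le> m"
      using x i by (auto simp: Q_mod_def)
    then show "\<exists>y\<in>carr. x k = \<theta> (y \<star> bas (Stay k))"
      by (auto simp: P_mod_eq)
  qed
  then obtain g where g: "\<And>k. k \<le> i \<Longrightarrow> g k \<in> carr"
      "\<And>k. k \<le> i \<Longrightarrow> x k = \<theta> (g k \<star> bas (Stay k))"
    by (metis atMost_iff)
  \<comment> \<open>The components are added up; by orthogonality of the vertices, right
    multiplication by \<open>Stay l\<close> recovers the one with index \<open>l\<close>.\<close>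
  define y where "y = (\<Sum>k\<le>i. g k \<star> bas (Stay k))"
  have "y \<in> row i"
    unfolding row_def y_def mem_Collect_eq
  proof (intro keys_sum_subset)
    fix k assume "k \<in> {..i}"
    then have "bas (Stay k) \<in> row i" "g k \<in> carr"
      using i g by (auto simp: row_def zz_block_def)
    then show "Poly_Mapping.keys (g k \<star> bas (Stay k)) \<subseteq> zz_block m i"
      using row_star[of "g k" "bas (Stay k)" i] by (simp add: row_def)
  qed
  moreover have "y \<star> bas (Stay l) = g l \<star> bas (Stay l)" if "l \<le> i" for l
  proof -
    have "y \<star> bas (Stay l) = (\<Sum>k\<le>i. if k = l then g l \<star> bas (Stay l) else 0)"
      unfolding y_def bilinear_ext_sum_left by (intro sum.cong refl) (auto simp: star_assoc)
    with that show ?thesis by simp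
  qed
  then have "\<tau> i y = x"
    using x g by (auto simp: \<tau>_def Q_mod_def fun_eq_iff PiE_def extensional_def)
  ultimately show thesis using that by blast
qed

lemma \<tau>_add:
  "i \<le> m \<Longrightarrow> x \<in> row i \<Longrightarrow> y \<in> row i \<Longrightarrow> \<tau> i (x + y) = Q_add m i (\<tau> i x) (\<tau> i y)"
  unfolding \<tau>_def Q_add_def
  by (intro restrict_ext) (simp add: \<theta>_add carr_star carr_Stay row_carr)

lemma \<tau>_act:
  "i \<le> m \<Longrightarrow> a \<in> carr \<Longrightarrow> x \<in> row i \<Longrightarrow> \<tau> i (a \<star> x) = Q_act m i (\<theta> a) (\<tau> i x)"
  unfolding \<tau>_def Q_act_def
  by (intro restrict_ext) (simp add: \<theta>_star carr_star carr_Stay row_carr star_assoc)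

lemma \<tau>_zero: "\<tau> i 0 = Q_zero m i"
  by (simp add: \<tau>_def Q_zero_def \<theta>_zero)

lemma \<tau>_diff:
  assumes "i \<le> m" "x \<in> row i"
  shows "Q_diff m i (\<tau> i x) = \<tau> i (x \<star> Q_edges i)"
  unfolding \<tau>_def Q_diff_def
proof (intro restrict_ext)
  fix k assume "k \<in> {..i}"
  then have k: "k \<le> i" by simp
  have xc: "x \<in> carr" using assms by (rule row_carr)
  show "(if k = 0 then \<zero>\<^bsub>A_alg m\<^esub>
      else (\<lambda>k\<in>{..i}. \<theta> (x \<star> bas (Stay k))) (k - 1) \<otimes>\<^bsub>A_alg m\<^esub> A_path m [k - 1, k]) =
    \<theta> (x \<star> Q_edges i \<star> bas (Stay k))"
  proof (cases k)
    case 0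
    then show ?thesis
      by (simp add: star_assoc Q_edges_Stay \<theta>_zero)
  next
    case (Suc l)
    have l: "l < m" using Suc k assms by simp
    \<comment> \<open>The idempotent \<open>Stay l\<close> is inserted before \<open>Up l\<close>,
      so that the component of index \<open>k - 1\<close> becomes visible.\<close>
    have "\<theta> (x \<star> Q_edges i \<star> bas (Stay k)) = \<theta> ((x \<star> bas (Stay l)) \<star> bas (Up l))"
      using Suc k by (simp add: star_assoc Q_edges_Stay)
    also have "\<dots> = \<theta> (x \<star> bas (Stay l)) \<otimes>\<^bsub>A_alg m\<^esub> A_path m [l, Suc l]"
      using l xc by (simp add: \<theta>_star carr_star carr_Stay carr_Up \<theta>_Up)
    finally show ?thesis using Suc k by simp
  qed
qed

section \<open>Module maps as right multiplications\<close>

definition \<sigma> :: "nat \<Rightarrow> (nat \<Rightarrow> A_elem) \<Rightarrow> (zz \<Rightarrow>\<^sub>0 bit)" where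
  "\<sigma> i = inv_into (row i) (\<tau> i)"

lemma \<sigma>_\<tau>: "i \<le> m \<Longrightarrow> x \<in> row i \<Longrightarrow> \<sigma> i (\<tau> i x) = x"
  unfolding \<sigma>_def by (rule inv_into_f_f) (auto simp: inj_on_def intro: \<tau>_inj)

text \<open>The component from \<open>Q i\<close> to \<open>Q j\<close> is right multiplication by
  the matrix entry. The restrictions match the extensional functions of which \<open>Hom_alg\<close>
  consists.\<close>

definition \<Phi> :: "(hbasis \<Rightarrow>\<^sub>0 bit) \<Rightarrow> (nat \<times> nat \<Rightarrow> Q_map)" where
  "\<Phi> M = (\<lambda>(i, j)\<in>{..m} \<times> {..m}. \<lambda>x\<in>Q_mod m i. \<tau> j (\<sigma> i x \<star> entry i j M))"

lemma \<Phi>_apply: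
  "i \<le> m \<Longrightarrow> j \<le> m \<Longrightarrow> x \<in> row i \<Longrightarrow> \<Phi> M (i, j) (\<tau> i x) = \<tau> j (x \<star> entry i j M)"
  by (simp add: \<Phi>_def \<sigma>_\<tau> \<tau>_closed)

lemma entry_blk: "M \<in> carrier (h_alg m) \<Longrightarrow> entry i j M \<in> blk i j"
  by (simp add: h.carrier_iff blk_def keys_entry)

lemma pair_restrict_cong:
  assumes "\<And>i j. i \<le> m \<Longrightarrow> j \<le> m \<Longrightarrow> f i j = g i j"
  shows "(\<lambda>(i, j)\<in>{..m} \<times> {..m}. f i j) = (\<lambda>(i, j)\<in>{..m} \<times> {..m}. g i j)"
  by (intro restrict_ext) (auto simp: assms)

text \<open>Since \<open>\<tau> i\<close> is onto, maps on \<open>Q_mod m i\<close> can be compared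
  on elements of the form \<open>\<tau> i x\<close>.\<close>

lemma Q_mod_restrict_cong:
  assumes "i \<le> m" "\<And>x. x \<in> row i \<Longrightarrow> f (\<tau> i x) = g (\<tau> i x)"
  shows "(\<lambda>x\<in>Q_mod m i. f x) = (\<lambda>x\<in>Q_mod m i. g x)"
proof (rule restrict_ext)
  fix x assume "x \<in> Q_mod m i"
  with \<tau>_surj[OF assms(1)] obtain y where "y \<in> row i" "x = \<tau> i y" by blast
  with assms(2) show "f x = g x" by simp
qed

lemma \<Phi>_closed:
  assumes M: "M \<in> carrier (h_alg m)"
  shows "\<Phi> M \<in> carrier (Hom_alg m)"
proof -
  have "\<Phi> M (i, j) \<in> Q_Hom m i j" if ij: "i \<le> m" "j \<le> m" for i j
    unfolding Q_Hom_def
  proof (intro CollectI conjI ballI)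
    show "\<Phi> M (i, j) \<in> Q_mod m i \<rightarrow>\<^sub>E Q_mod m j"
    proof
      fix x assume x: "x \<in> Q_mod m i"
      obtain y where y: "y \<in> row i" "x = \<tau> i y" using \<tau>_surj[OF ij(1) x] .
      show "\<Phi> M (i, j) x \<in> Q_mod m j"
        using y ij row_blk[OF y(1) entry_blk[OF M]] by (simp add: \<Phi>_apply \<tau>_closed)
    qed (use ij in \<open>simp add: \<Phi>_def\<close>)
  next
    fix x x' assume "x \<in> Q_mod m i" "x' \<in> Q_mod m i"
    then obtain y y' where y: "y \<in> row i" "x = \<tau> i y" "y' \<in> row i" "x' = \<tau> i y'"
      using \<tau>_surj[OF ij(1)] by metis
    then show "\<Phi> M (i, j) (Q_add m i x x') = Q_add m j (\<Phi> M (i, j) x) (\<Phi> M (i, j) x')"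
      using ij row_blk[OF _ entry_blk[OF M]]
      by (simp add: \<Phi>_apply row_add flip: \<tau>_add)
  next
    fix a x assume "a \<in> carrier (A_alg m)" "x \<in> Q_mod m i"
    then obtain b y where y: "b \<in> carr" "a = \<theta> b" "y \<in> row i" "x = \<tau> i y"
      using \<tau>_surj[OF ij(1)] \<theta>_surj by metis
    then show "\<Phi> M (i, j) (Q_act m i a x) = Q_act m j a (\<Phi> M (i, j) x)"
      using ij row_blk[OF _ entry_blk[OF M]]
      by (simp add: \<Phi>_apply row_star star_assoc flip: \<tau>_act)
  qed
  moreover have "\<Phi> M \<in> extensional ({..m} \<times> {..m})"
    by (simp add: \<Phi>_def)
  ultimately show ?thesis
    by (auto simp: Hom_alg_def PiE_def)
qed

lemma \<Phi>_add:
  assumes "M \<in> carrier (h_alg m)" "N \<in> carrier (h_alg m)"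
  shows "\<Phi> (M \<oplus>\<^bsub>h_alg m\<^esub> N) = \<Phi> M \<oplus>\<^bsub>Hom_alg m\<^esub> \<Phi> N"
proof -
  have "\<Phi> (M + N) = (\<lambda>(i, j)\<in>{..m} \<times> {..m}. \<lambda>x\<in>Q_mod m i. Q_add m j (\<Phi> M (i, j) x) (\<Phi> N (i, j) x))"
    unfolding \<Phi>_def[of "M + N"]
    using row_blk[OF _ entry_blk[OF assms(1)]] row_blk[OF _ entry_blk[OF assms(2)]]
    by (intro pair_restrict_cong Q_mod_restrict_cong) (simp_all add: \<sigma>_\<tau> \<Phi>_apply \<tau>_add)
  then show ?thesis by (simp add: h.add_eq Hom_alg_def)
qed

text \<open>Applying \<open>M\<close> first and \<open>N\<close> second multiplies \<open>x\<close>
  on the right by both entries in this order. The work lies in moving the sum over the middle index,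
  taken in \<open>A_alg m\<close> component by component, through \<open>\<theta>\<close>.\<close>

lemma \<Phi>_mult:
  assumes M: "M \<in> carrier (h_alg m)" and N: "N \<in> carrier (h_alg m)"
  shows "\<Phi> (M \<otimes>\<^bsub>h_alg m\<^esub> N) = \<Phi> M \<otimes>\<^bsub>Hom_alg m\<^esub> \<Phi> N"
proof -
  have "\<Phi> (bilinear_ext h_mult M N) = (\<lambda>(i, k)\<in>{..m} \<times> {..m}. \<lambda>x\<in>Q_mod m i.
                \<lambda>l\<in>{..k}. \<Oplus>\<^bsub>A_alg m\<^esub>j\<in>{..m}. \<Phi> N (j, k) (\<Phi> M (i, j) x) l)"
    unfolding \<Phi>_def[of "bilinear_ext h_mult M N"]
  proof (intro pair_restrict_cong Q_mod_restrict_cong)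
    fix i k x assume i: "i \<le> m" and k: "k \<le> m" and x: "x \<in> row i"
    have r: "x \<star> entry i j M \<in> row j" for j
      by (rule row_blk[OF x entry_blk[OF M]])
    have r': "x \<star> entry i j M \<star> entry j k N \<in> row k" for j
      by (rule row_blk[OF r entry_blk[OF N]])
    have "\<tau> k (x \<star> entry i k (bilinear_ext h_mult M N)) =
        \<tau> k (\<Sum>j\<le>m. x \<star> entry i j M \<star> entry j k N)"
      using M N by (simp add: entry_mult[of M m N] h.carrier_iff star_assoc)
    also have "\<dots> = (\<lambda>l\<in>{..k}. \<Oplus>\<^bsub>A_alg m\<^esub>j\<in>{..m}. \<theta> (x \<star> entry i j M \<star> entry j k N \<star> bas (Stay l)))"
      unfolding \<tau>_def
    proof (intro restrict_ext)
      fix l assume "l \<in> {..k}"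
      then have "x \<star> entry i j M \<star> entry j k N \<star> bas (Stay l) \<in> carr" for j
        using row_carr[OF k r'[of j]] k by (auto intro!: carr_star carr_Stay)
      then show "\<theta> ((\<Sum>j\<le>m. x \<star> entry i j M \<star> entry j k N) \<star> bas (Stay l)) =
        (\<Oplus>\<^bsub>A_alg m\<^esub>j\<in>{..m}. \<theta> (x \<star> entry i j M \<star> entry j k N \<star> bas (Stay l)))"
        by (simp add: \<theta>_sum)
    qed
    also have "\<dots> = (\<lambda>l\<in>{..k}. \<Oplus>\<^bsub>A_alg m\<^esub>j\<in>{..m}. \<Phi> N (j, k) (\<Phi> M (i, j) (\<tau> i x)) l)"
    proof (intro restrict_ext A.finsum_cong' refl)
      fix l j assume lj: "l \<in> {..k}" "j \<in> {..m}"
      then show eq: "\<theta> (x \<star> entry i j M \<star> entry j k N \<star> bas (Stay l)) =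
          \<Phi> N (j, k) (\<Phi> M (i, j) (\<tau> i x)) l"
        using i k x r by (simp add: \<Phi>_apply) (simp add: \<tau>_def)
    next
      fix l assume l: "l \<in> {..k}"
      have "\<Phi> N (j, k) (\<Phi> M (i, j) (\<tau> i x)) l \<in> carrier (A_alg m)" if "j \<in> {..m}" for j
      proof -
        have "\<Phi> N (j, k) (\<Phi> M (i, j) (\<tau> i x)) l = \<theta> (x \<star> entry i j M \<star> entry j k N \<star> bas (Stay l))"
          using i k x r l that by (simp add: \<Phi>_apply) (simp add: \<tau>_def)
        then show ?thesis
          using row_carr[OF k r'[of j]] k l by (auto intro!: carr_star carr_Stay \<theta>_closed)
      qed
      then show "(\<lambda>j. \<Phi> N (j, k) (\<Phi> M (i, j) (\<tau> i x)) l) \<in> {..m} \<rightarrow> carrier (A_alg m)"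
        by blast
    qed
    finally show "\<tau> k (\<sigma> i (\<tau> i x) \<star> entry i k (bilinear_ext h_mult M N)) =
        (\<lambda>l\<in>{..k}. \<Oplus>\<^bsub>A_alg m\<^esub>j\<in>{..m}. \<Phi> N (j, k) (\<Phi> M (i, j) (\<tau> i x)) l)"
      using i x by (simp add: \<sigma>_\<tau>)
  qed
  then show ?thesis by (simp add: h.mult_eq Hom_alg_def)
qed

lemma \<Phi>_zero: "\<Phi> \<zero>\<^bsub>h_alg m\<^esub> = \<zero>\<^bsub>Hom_alg m\<^esub>"
  by (simp add: \<Phi>_def h.zero_eq Hom_alg_def \<tau>_zero)

lemma \<Phi>_one: "\<Phi> \<one>\<^bsub>h_alg m\<^esub> = \<one>\<^bsub>Hom_alg m\<^esub>"
proof -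
  have "\<Phi> \<one>\<^bsub>h_alg m\<^esub> = (\<lambda>(i, j)\<in>{..m} \<times> {..m}. \<lambda>x\<in>Q_mod m i. if i = j then x else Q_zero m j)"
    unfolding \<Phi>_def
    by (intro pair_restrict_cong Q_mod_restrict_cong)
      (auto simp: entry_one \<sigma>_\<tau> row_idem \<tau>_zero)
  then show ?thesis by (simp add: Hom_alg_def)
qed

lemma \<Phi>_diff:
  assumes M: "M \<in> carrier (h_alg m)"
  shows "Hom_diff m (\<Phi> M) = \<Phi> (h_diff m M)"
proof -
  have M': "Poly_Mapping.keys M \<subseteq> h_set m"
    using M by (simp add: h.carrier_iff)
  show ?thesis
    unfolding \<Phi>_def[of "h_diff m M"] Hom_diff_def Q_Hom_diff_def
  proof (intro pair_restrict_cong Q_mod_restrict_cong)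
    fix i j x assume ij: "i \<le> m" "j \<le> m" and x: "x \<in> row i"
    have 1: "x \<star> entry i j M \<in> row j" "x \<star> Q_edges i \<in> row i"
      using row_blk[OF x entry_blk[OF M]] row_blk[OF x Q_edges_blk] .
    then have 2: "x \<star> entry i j M \<star> Q_edges j \<in> row j" "x \<star> Q_edges i \<star> entry i j M \<in> row j"
      using row_blk[OF _ entry_blk[OF M]] row_blk[OF _ Q_edges_blk] by blast+
    have "Q_add m j (Q_diff m j (\<Phi> M (i, j) (\<tau> i x))) (\<Phi> M (i, j) (Q_diff m i (\<tau> i x))) =
        \<tau> j (x \<star> entry i j M \<star> Q_edges j + x \<star> Q_edges i \<star> entry i j M)"
      using 1 2 ij x by (simp add: \<Phi>_apply \<tau>_diff \<tau>_add)
    also have "\<dots> = \<tau> j (\<sigma> i (\<tau> i x) \<star> entry i j (h_diff m M))"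
      using ij x by (simp add: entry_h_diff[OF M'] \<sigma>_\<tau> star_assoc add_ac)
    finally show "Q_add m j (Q_diff m j (\<Phi> M (i, j) (\<tau> i x))) (\<Phi> M (i, j) (Q_diff m i (\<tau> i x))) =
        \<tau> j (\<sigma> i (\<tau> i x) \<star> entry i j (h_diff m M))" .
  qed
qed

text \<open>Evaluation at the generator \<open>idem i\<close> recovers the entry, which is fixed by
  left multiplication with \<open>idem i\<close>.\<close>

lemma \<Phi>_inj: "inj_on \<Phi> (carrier (h_alg m))"
proof (rule inj_onI)
  fix M N assume M: "M \<in> carrier (h_alg m)" and N: "N \<in> carrier (h_alg m)" and eq: "\<Phi> M = \<Phi> N"
  show "M = N"
  proof (rule h_eqI)
    fix i j assume ij: "i \<le> m" "j \<le> m"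
    have *: "idem i \<star> entry i j K = entry i j K" "entry i j K \<in> row j" if "K \<in> carrier (h_alg m)" for K
      using entry_blk[OF that, of i j] zz_block_mono[of i m j j] ij
      by (auto simp: blk_def row_def intro!: star_idem_left)
    have "\<tau> j (idem i \<star> entry i j M) = \<tau> j (idem i \<star> entry i j N)"
      using eq idem_row[OF ij(1)] by (metis \<Phi>_apply ij)
    then show "entry i j M = entry i j N"
      using ij * M N by (auto intro: \<tau>_inj)
  qed (use M N in \<open>simp_all add: h.carrier_iff\<close>)
qed

text \<open>A module map out of \<open>A e_i\<close> is determined by the image \<open>c\<close> of
  the generator \<open>e_i\<close>, since every \<open>x\<close> in \<open>A e_i\<close> equals
  \<open>x e_i\<close>.\<close>

lemma Q_Hom_right_mult:
  assumes ij: "i \<le> m" "j \<le> m" and f: "f \<in> Q_Hom m i j"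
  obtains c where "c \<in> blk i j" "\<And>x. x \<in> row i \<Longrightarrow> f (\<tau> i x) = \<tau> j (x \<star> c)"
proof -
  have "f (\<tau> i (idem i)) \<in> Q_mod m j"
    using f \<tau>_closed[OF ij(1) idem_row[OF ij(1)]] by (auto simp: Q_Hom_def)
  then obtain c where c: "c \<in> row j" "f (\<tau> i (idem i)) = \<tau> j c"
    using \<tau>_surj[OF ij(2)] by blast
  have *: "f (\<tau> i x) = \<tau> j (x \<star> c)" if "x \<in> row i" for x
  proof -
    have xc: "x \<in> carr" using ij(1) that by (rule row_carr)
    have "f (\<tau> i x) = f (Q_act m i (\<theta> x) (\<tau> i (idem i)))"
      using that xc ij by (simp add: row_idem idem_row flip: \<tau>_act)
    also have "\<dots> = Q_act m j (\<theta> x) (\<tau> j c)"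
      using f c \<theta>_closed[OF xc] \<tau>_closed[OF ij(1) idem_row[OF ij(1)]] by (simp add: Q_Hom_def)
    also have "\<dots> = \<tau> j (x \<star> c)"
      using c xc ij by (simp add: \<tau>_act)
    finally show ?thesis .
  qed
  have ic: "idem i \<in> carr"
    using ij(1) idem_row[OF ij(1)] by (rule row_carr)
  \<comment> \<open>The formula \<open>*\<close> at the generator itself gives
    \<open>e_i c = c\<close>, so the paths in \<open>c\<close> start at vertices up to
    \<open>i\<close>.\<close>
  have "idem i \<star> c = c"
    using *[OF idem_row[OF ij(1)]] c ij row_star[OF ic c(1)] by (auto intro: \<tau>_inj)
  moreover have "Poly_Mapping.keys (idem i \<star> c) \<subseteq> zz_block i j"
    using c(1) by (intro keys_star[OF idem_block]) (simp add: row_def)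
  ultimately have "c \<in> blk i j" by (simp add: blk_def)
  with * that show thesis by blast
qed

lemma \<Phi>_surj:
  assumes f: "f \<in> carrier (Hom_alg m)"
  shows "f \<in> \<Phi> ` carrier (h_alg m)"
proof -
  have f': "f (i, j) \<in> Q_Hom m i j" if "i \<le> m" "j \<le> m" for i j
    using f that by (auto simp: Hom_alg_def PiE_def Pi_def)
  have "\<forall>i j. \<exists>c. i \<le> m \<and> j \<le> m \<longrightarrow>
      c \<in> blk i j \<and> (\<forall>x\<in>row i. f (i, j) (\<tau> i x) = \<tau> j (x \<star> c))"
    using Q_Hom_right_mult f' by metis
  then obtain c where c: "\<And>i j. i \<le> m \<Longrightarrow> j \<le> m \<Longrightarrow> c i j \<in> blk i j"
      "\<And>i j x. i \<le> m \<Longrightarrow> j \<le> m \<Longrightarrow> x \<in> row i \<Longrightarrow> f (i, j) (\<tau> i x) = \<tau> j (x \<star> c i j)"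
    by metis
  define M where "M = (\<Sum>i\<le>m. \<Sum>j\<le>m. emb i j (c i j))"
  have M: "M \<in> carrier (h_alg m)"
    unfolding M_def h.carrier_iff using c(1)
    by (intro keys_sum_subset keys_emb) (auto simp: blk_def)
  have entry_M: "entry i j M = c i j" if "i \<le> m" "j \<le> m" for i j
  proof -
    have "entry i j M = (\<Sum>i'\<le>m. \<Sum>j'\<le>m. if j' = j then if i' = i then c i j else 0 else 0)"
      unfolding M_def entry_sum by (intro sum.cong refl) (auto simp: entry_emb)
    with that show ?thesis by simp
  qed
  \<comment> \<open>Both layers of \<open>f\<close> are extensional, so restricting them changes
    nothing, even where the value is \<open>undefined\<close>.\<close>
  have f_eq: "f = (\<lambda>(i, j)\<in>{..m} \<times> {..m}. \<lambda>x\<in>Q_mod m i. f (i, j) x)"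
  proof
    fix z
    show "f z = (\<lambda>(i, j)\<in>{..m} \<times> {..m}. \<lambda>x\<in>Q_mod m i. f (i, j) x) z"
    proof (cases "z \<in> {..m} \<times> {..m}")
      case True
      then obtain i j where z: "z = (i, j)" "i \<le> m" "j \<le> m" by (cases z) auto
      then have "f (i, j) \<in> extensional (Q_mod m i)"
        using f'[of i j] by (auto simp: Q_Hom_def PiE_def)
      then show ?thesis using z by (simp add: extensional_restrict)
    next
      case False
      moreover have "f \<in> extensional ({..m} \<times> {..m})"
        using f by (simp add: Hom_alg_def PiE_def)
      ultimately have "f z = undefined" by (rule extensional_arb[rotated])
      with False show ?thesis by (simp add: restrict_def)
    qed
  qed
  have "\<Phi> M = (\<lambda>(i, j)\<in>{..m} \<times> {..m}. \<lambda>x\<in>Q_mod m i. f (i, j) x)"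
    unfolding \<Phi>_def
    by (intro pair_restrict_cong Q_mod_restrict_cong) (simp_all add: \<sigma>_\<tau> entry_M c(2) \<tau>_closed)
  with f_eq have "f = \<Phi> M" by (rule trans[OF _ sym])
  then show ?thesis using M by (rule image_eqI)
qed

lemma \<Phi>_iso: "\<Phi> \<in> ring_iso (h_alg m) (Hom_alg m)"
  unfolding ring_iso_def
proof (intro CollectI conjI)
  show "\<Phi> \<in> ring_hom (h_alg m) (Hom_alg m)"
    by (rule ring_hom_memI) (simp_all add: \<Phi>_closed \<Phi>_mult \<Phi>_add \<Phi>_one)
  show "bij_betw \<Phi> (carrier (h_alg m)) (carrier (Hom_alg m))"
    unfolding bij_betw_def using \<Phi>_inj \<Phi>_surj \<Phi>_closed by blast
qed

end

lemma h_alg_iso_Hom_alg: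
  obtains \<Phi> where "\<Phi> \<in> ring_iso (h_alg m) (Hom_alg m)"
    and "\<Phi> \<zero>\<^bsub>h_alg m\<^esub> = \<zero>\<^bsub>Hom_alg m\<^esub>"
    and "\<And>M. M \<in> carrier (h_alg m) \<Longrightarrow> Hom_diff m (\<Phi> M) = \<Phi> (h_diff m M)"
proof -
  obtain \<theta> where \<theta>: "\<theta> \<in> ring_iso (zz_alg m) (A_alg m)"
    "\<And>k. k \<le> m \<Longrightarrow> \<theta> (bas (Stay k)) = A_path m [k]"
    "\<And>k. k < m \<Longrightarrow> \<theta> (bas (Up k)) = A_path m [k, Suc k]"
    using zz_alg_iso[of m] by blast
  then interpret A_model m \<theta> by unfold_locales
  show thesis
    by (rule that[OF \<Phi>_iso \<Phi>_zero \<Phi>_diff])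
qed

section \<open>The homology of the endomorphism algebra\<close>

text \<open>
  A model of \<open>B\<^sup>K\<^sup>h\<close> on the same basis as \<open>B\<^sup>H\<^sup>F\<close>: here \<^const>\<open>StrandRho\<close> and \<^const>\<open>StrandSigma\<close> play the
  roles of \<open>a\<close> and \<open>b\<close>.
\<close>

fun kh_mult :: "strand \<Rightarrow> strand \<Rightarrow> strand option" where
  "kh_mult (StrandId i) (StrandId j) = (if i = j then Some (StrandId i) else None)"
| "kh_mult (StrandId i) (StrandRho j k) = (if i = j then Some (StrandRho j k) else None)"
| "kh_mult (StrandId i) (StrandSigma j k) = (if i = j then Some (StrandSigma j k) else None)"
| "kh_mult (StrandRho i j) (StrandId k) = (if j = k then Some (StrandRho i j) else None)"
| "kh_mult (StrandSigma i j) (StrandId k) = (if j = k then Some (StrandSigma i j) else None)"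
| "kh_mult (StrandRho i j) (StrandRho k l) = (if j = k then Some (StrandRho i l) else None)"
| "kh_mult (StrandRho i j) (StrandSigma k l) = (if j = k then Some (StrandSigma i l) else None)"
| "kh_mult (StrandSigma i j) (StrandRho k l) = (if j = k then Some (StrandSigma i l) else None)"
| "kh_mult (StrandSigma i j) (StrandSigma k l) = None"

definition kh_alg :: "nat \<Rightarrow> (strand \<Rightarrow>\<^sub>0 bit) ring" where
  "kh_alg m = basis_algebra (strands m) kh_mult (StrandId ` {..m})"

fun strand_src :: "strand \<Rightarrow> nat" where
  "strand_src (StrandId i) = i"
| "strand_src (StrandRho i j) = i"
| "strand_src (StrandSigma i j) = i"

fun strand_tgt :: "strand \<Rightarrow> nat" where
  "strand_tgt (StrandId i) = i"
| "strand_tgt (StrandRho i j) = j"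
| "strand_tgt (StrandSigma i j) = j"

lemma kh_mult_Id:
  "kh_mult (StrandId i) a = (if i = strand_src a then Some a else None)"
  "kh_mult a (StrandId i) = (if i = strand_tgt a then Some a else None)"
  by (cases a; auto)+

lemma strand_mult_Id:
  "strand_mult (StrandId i) a = (if i = strand_src a then Some a else None)"
  "strand_mult a (StrandId i) = (if i = strand_tgt a then Some a else None)"
  by (cases a; auto)+

lemma strand_ends: "a \<in> strands m \<Longrightarrow> strand_src a \<le> m \<and> strand_tgt a \<le> m"
  by (auto simp: strands_def)

interpretation kh: mult_basis "strands m" kh_mult "StrandId ` {..m}"
  rewrites "basis_algebra (strands m) kh_mult (StrandId ` {..m}) \<equiv> kh_alg m"
proof -
  show "mult_basis (strands m) kh_mult (StrandId ` {..m})"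
  proof
    fix a b c
    assume "a \<in> strands m" "b \<in> strands m" "kh_mult a b = Some c"
    then show "c \<in> strands m"
      by (cases a; cases b) (auto simp: strands_def split: if_splits)
  next
    fix a b c
    show "Option.bind (kh_mult a b) (\<lambda>x. kh_mult x c) = Option.bind (kh_mult b c) (kh_mult a)"
      by (cases a; cases b; cases c) auto
  next
    fix a assume a: "a \<in> strands m"
    show "\<exists>u\<in>StrandId ` {..m}. kh_mult u a = Some a \<and> (\<forall>v\<in>StrandId ` {..m} - {u}. kh_mult v a = None)"
      using strand_ends[OF a] by (intro bexI[of _ "StrandId (strand_src a)"]) (auto simp: kh_mult_Id split: if_splits)
    show "\<exists>u\<in>StrandId ` {..m}. kh_mult a u = Some a \<and> (\<forall>v\<in>StrandId ` {..m} - {u}. kh_mult a v = None)"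
      using strand_ends[OF a] by (intro bexI[of _ "StrandId (strand_tgt a)"]) (auto simp: kh_mult_Id split: if_splits)
  qed (auto simp: strands_def)
qed (simp add: kh_alg_def)

interpretation hf: mult_basis "strands m" strand_mult "StrandId ` {..m}"
  rewrites "basis_algebra (strands m) strand_mult (StrandId ` {..m}) \<equiv> B_HF m"
proof -
  show "mult_basis (strands m) strand_mult (StrandId ` {..m})"
  proof
    fix a b c
    assume "a \<in> strands m" "b \<in> strands m" "strand_mult a b = Some c"
    then show "c \<in> strands m"
      by (cases a; cases b) (auto simp: strands_def split: if_splits)
  next
    fix a b c
    show "Option.bind (strand_mult a b) (\<lambda>x. strand_mult x c) = Option.bind (strand_mult b c) (strand_mult a)"
      by (cases a; cases b; cases c) auto
  next
    fix a assume a: "a \<in> strands m"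
    show "\<exists>u\<in>StrandId ` {..m}. strand_mult u a = Some a \<and> (\<forall>v\<in>StrandId ` {..m} - {u}. strand_mult v a = None)"
      using strand_ends[OF a] by (intro bexI[of _ "StrandId (strand_src a)"]) (auto simp: strand_mult_Id split: if_splits)
    show "\<exists>u\<in>StrandId ` {..m}. strand_mult a u = Some a \<and> (\<forall>v\<in>StrandId ` {..m} - {u}. strand_mult a v = None)"
      using strand_ends[OF a] by (intro bexI[of _ "StrandId (strand_tgt a)"]) (auto simp: strand_mult_Id split: if_splits)
  qed (auto simp: strands_def)
qed (simp add: B_HF_def)

section \<open>The differential on basis elements\<close>

lemma h_diff_add [simp]: "h_diff m (M + N) = h_diff m M + h_diff m N"
  by (simp add: h_diff_def h.mult_eq h.add_eq add_ac)

lemma h_diff_0 [simp]: "h_diff m 0 = 0"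
  by (simp add: h_diff_def h.mult_eq h.add_eq)

lemma h_diff_keys: "Poly_Mapping.keys M \<subseteq> h_set m \<Longrightarrow> Poly_Mapping.keys (h_diff m M) \<subseteq> h_set m"
  unfolding h_diff_def h.mult_eq h.add_eq
  by (intro keys_plus_subset h.mult_closed h_diff_elem_keys)

lemma h_diff_emb:
  assumes ij: "i \<le> m" "j \<le> m" and x: "Poly_Mapping.keys x \<subseteq> zz_block i j"
  shows "h_diff m (emb i j x) = emb i j (Q_edges i \<star> x + x \<star> Q_edges j)"
proof (rule h_eqI)
  show k: "Poly_Mapping.keys (h_diff m (emb i j x)) \<subseteq> h_set m"
    by (intro h_diff_keys keys_emb x ij)
  show "Poly_Mapping.keys (emb i j (Q_edges i \<star> x + x \<star> Q_edges j)) \<subseteq> h_set m"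
    by (intro keys_emb keys_plus_subset keys_star[OF Q_edges_block x] keys_star[OF x Q_edges_block] ij)
  show "entry i' j' (h_diff m (emb i j x)) = entry i' j' (emb i j (Q_edges i \<star> x + x \<star> Q_edges j))"
    if "i' \<le> m" "j' \<le> m" for i' j'
    using entry_h_diff[OF keys_emb[OF x ij] that] by (simp add: entry_emb del: emb_add)
qed

lemma Stay_Q_edges: "bas (Stay k) \<star> Q_edges j = (if k < j then bas (Up k) else 0)"
proof -
  have "bas (Stay k) \<star> Q_edges j = (\<Sum>l<j. if l = k then bas (Up k) else 0)"
    unfolding Q_edges_def bilinear_ext_sum_right by (intro sum.cong) auto
  then show ?thesis by simp
qed

lemma Dn_Q_edges: "bas (Dn k) \<star> Q_edges j = (if k < j then bas (Lp k) else 0)"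
proof -
  have "bas (Dn k) \<star> Q_edges j = (\<Sum>l<j. if l = k then bas (Lp k) else 0)"
    unfolding Q_edges_def bilinear_ext_sum_right by (intro sum.cong) auto
  then show ?thesis by simp
qed

lemma Q_edges_Dn: "k < i \<Longrightarrow> Q_edges i \<star> bas (Dn k) = (if k = 0 then 0 else bas (Lp (k - 1)))"
proof -
  assume "k < i"
  have "Q_edges i \<star> bas (Dn k) = (\<Sum>l<i. if l = k then (if k = 0 then 0 else bas (Lp (k - 1))) else 0)"
    unfolding Q_edges_def bilinear_ext_sum_left by (intro sum.cong) auto
  with \<open>k < i\<close> show ?thesis by simp
qed

lemma Q_edges_Up_Lp [simp]:
  "Q_edges i \<star> bas (Up k) = 0" "bas (Up k) \<star> Q_edges i = 0" "Q_edges i \<star> bas (Lp k) = 0" "bas (Lp k) \<star> Q_edges i = 0"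
  by (simp_all add: Q_edges_def)

text \<open>
  The differential of \<open>Stay l\<close> is \<open>Up (l - 1) + Up l\<close> (with missing terms read as zero), and that of
  \<open>Dn l\<close> is \<open>Lp (l - 1) + Lp l\<close>, so telescoping sums are preimages of \<open>Up k\<close> and \<open>Lp k\<close>.
\<close>

fun htpy :: "zz \<Rightarrow> (zz \<Rightarrow>\<^sub>0 bit)" where
  "htpy (Up k) = (\<Sum>l\<le>k. bas (Stay l))"
| "htpy (Lp k) = (\<Sum>l\<le>k. bas (Dn l))"
| "htpy _ = 0"

lemma htpy_block: "p \<in> zz_block i j \<Longrightarrow> Poly_Mapping.keys (htpy p) \<subseteq> zz_block i j"
  by (cases p) (auto simp: zz_block_def intro!: keys_sum_subset del: subsetI)

text \<open>Neighbouring differentials share one ascending edge, which cancels. The bound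
  \<open>k < j\<close> keeps the last edge \<open>Up k\<close> inside
  \<open>Q_edges j\<close>.\<close>

lemma diff_sum_Stay:
  "k \<le> i \<Longrightarrow> k < j \<Longrightarrow>
     Q_edges i \<star> (\<Sum>l\<le>k. bas (Stay l)) + (\<Sum>l\<le>k. bas (Stay l)) \<star> Q_edges j = bas (Up k)"
proof (induction k)
  case (Suc k)
  have "Q_edges i \<star> (\<Sum>l\<le>Suc k. bas (Stay l)) + (\<Sum>l\<le>Suc k. bas (Stay l)) \<star> Q_edges j =
      (Q_edges i \<star> (\<Sum>l\<le>k. bas (Stay l)) + (\<Sum>l\<le>k. bas (Stay l)) \<star> Q_edges j)
      + (Q_edges i \<star> bas (Stay (Suc k)) + bas (Stay (Suc k)) \<star> Q_edges j)"
    by (simp add: add_ac)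
  also have "\<dots> = bas (Up k) + (bas (Up k) + bas (Up (Suc k)))"
    using Suc by (simp only: Q_edges_Stay Stay_Q_edges) simp
  finally show ?case by simp
qed (simp add: Q_edges_Stay Stay_Q_edges)

lemma diff_sum_Dn:
  "k < i \<Longrightarrow> k < j \<Longrightarrow>
     Q_edges i \<star> (\<Sum>l\<le>k. bas (Dn l)) + (\<Sum>l\<le>k. bas (Dn l)) \<star> Q_edges j = bas (Lp k)"
proof (induction k)
  case (Suc k)
  have "Q_edges i \<star> (\<Sum>l\<le>Suc k. bas (Dn l)) + (\<Sum>l\<le>Suc k. bas (Dn l)) \<star> Q_edges j =
      (Q_edges i \<star> (\<Sum>l\<le>k. bas (Dn l)) + (\<Sum>l\<le>k. bas (Dn l)) \<star> Q_edges j)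
      + (Q_edges i \<star> bas (Dn (Suc k)) + bas (Dn (Suc k)) \<star> Q_edges j)"
    by (simp add: add_ac)
  also have "\<dots> = bas (Lp k) + (bas (Lp k) + bas (Lp (Suc k)))"
    using Suc by (simp only: Q_edges_Dn Dn_Q_edges) simp
  finally show ?case by simp
qed (simp add: Q_edges_Dn Dn_Q_edges)

text \<open>At the top index \<open>j\<close> the edge \<open>Up j\<close> is absent from
  \<open>Q_edges j\<close>, so the telescoping sum leaves nothing. This makes the projection of
  \<open>Q i\<close> onto \<open>Q j\<close> a cycle.\<close>

lemma diff_sum_Stay_top:
  assumes "j \<le> i"
  shows "Q_edges i \<star> (\<Sum>l\<le>j. bas (Stay l)) + (\<Sum>l\<le>j. bas (Stay l)) \<star> Q_edges j = 0"
proof (cases j)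
  case (Suc k)
  have "Q_edges i \<star> (\<Sum>l\<le>Suc k. bas (Stay l)) + (\<Sum>l\<le>Suc k. bas (Stay l)) \<star> Q_edges j =
      (Q_edges i \<star> (\<Sum>l\<le>k. bas (Stay l)) + (\<Sum>l\<le>k. bas (Stay l)) \<star> Q_edges j)
      + (Q_edges i \<star> bas (Stay (Suc k)) + bas (Stay (Suc k)) \<star> Q_edges j)"
    by (simp add: add_ac)
  also have "\<dots> = 0"
    using assms Suc by (simp add: diff_sum_Stay Q_edges_Stay Stay_Q_edges
        del: bilinear_ext_sum_left bilinear_ext_sum_right)
  finally show ?thesis by (simp add: Suc)
qed (simp add: Q_edges_Stay Stay_Q_edges)

text \<open>The same effect for descending edges yields the second family of cycles;
  \<open>j < i\<close> ensures that \<open>Dn j\<close> starts at a vertex of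
  \<open>Q i\<close>.\<close>

lemma diff_sum_Dn_top:
  assumes "j < i"
  shows "Q_edges i \<star> (\<Sum>l\<le>j. bas (Dn l)) + (\<Sum>l\<le>j. bas (Dn l)) \<star> Q_edges j = 0"
proof (cases j)
  case (Suc k)
  have "Q_edges i \<star> (\<Sum>l\<le>Suc k. bas (Dn l)) + (\<Sum>l\<le>Suc k. bas (Dn l)) \<star> Q_edges j =
      (Q_edges i \<star> (\<Sum>l\<le>k. bas (Dn l)) + (\<Sum>l\<le>k. bas (Dn l)) \<star> Q_edges j)
      + (Q_edges i \<star> bas (Dn (Suc k)) + bas (Dn (Suc k)) \<star> Q_edges j)"
    by (simp add: add_ac)
  also have "\<dots> = 0"
    using assms Suc by (simp add: diff_sum_Dn Q_edges_Dn Dn_Q_edges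
        del: bilinear_ext_sum_left bilinear_ext_sum_right)
  finally show ?thesis by (simp add: Suc)
qed (use assms in \<open>simp add: Q_edges_Dn Dn_Q_edges\<close>)

text \<open>The coefficient of a cycle is read off at its last term, of index \<open>j\<close>. In a
  block, \<open>Stay j\<close> occurs only for \<open>j \<le> i\<close> and \<open>Dn j\<close> only
  for \<open>j < i\<close>, so the values are genuine strands there.\<close>

fun kh_proj :: "nat \<Rightarrow> nat \<Rightarrow> zz \<Rightarrow> (strand \<Rightarrow>\<^sub>0 bit)" where
  "kh_proj i j (Stay k) = (if k = j then bas (if i = j then StrandId j else StrandRho i j) else 0)"
| "kh_proj i j (Dn k) = (if k = j then bas (StrandSigma i j) else 0)"
| "kh_proj i j _ = 0"

fun kh_cycle :: "strand \<Rightarrow> (hbasis \<Rightarrow>\<^sub>0 bit)" where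
  "kh_cycle (StrandId i) = (\<Sum>k\<le>i. bas (i, Stay k, i))"
| "kh_cycle (StrandRho i j) = (\<Sum>k\<le>j. bas (i, Stay k, j))"
| "kh_cycle (StrandSigma i j) = (\<Sum>k\<le>j. bas (i, Dn k, j))"

definition kh_pr :: "(hbasis \<Rightarrow>\<^sub>0 bit) \<Rightarrow> (strand \<Rightarrow>\<^sub>0 bit)" where
  "kh_pr = lin (\<lambda>(i, p, j). kh_proj i j p)"

definition kh_in :: "(strand \<Rightarrow>\<^sub>0 bit) \<Rightarrow> (hbasis \<Rightarrow>\<^sub>0 bit)" where
  "kh_in = lin kh_cycle"

definition h_htpy :: "(hbasis \<Rightarrow>\<^sub>0 bit) \<Rightarrow> (hbasis \<Rightarrow>\<^sub>0 bit)" where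
  "h_htpy = lin (\<lambda>(i, p, j). emb i j (htpy p))"

section \<open>The contraction onto the span of the cycles\<close>

lemma kh_pr_emb: "kh_pr (emb i j x) = lin (kh_proj i j) x"
  by (simp add: kh_pr_def emb_def lin_lin)

lemma h_htpy_emb: "h_htpy (emb i j x) = emb i j (lin htpy x)"
  by (simp add: h_htpy_def emb_def lin_lin)

lemma emb_sum: "emb i j (sum f I) = (\<Sum>k\<in>I. emb i j (f k))"
  by (simp add: emb_def)

text \<open>For \<open>Stay k\<close> with \<open>k < j\<close>, contracting the differential gives
  the sums up to \<open>k - 1\<close> and up to \<open>k\<close>, whose total is
  \<open>Stay k\<close>. For \<open>k = j\<close> the second sum is missing and the cycle supplies
  it. The same holds for \<open>Dn k\<close>. On \<open>Up k\<close> and \<open>Lp k\<close> the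
  differential vanishes and the telescoping sums apply.\<close>

lemma block_homotopy:
  assumes p: "p \<in> zz_block i j"
  shows "bas p = lin (\<lambda>s. entry i j (kh_cycle s)) (kh_proj i j p)
    + (Q_edges i \<star> htpy p + htpy p \<star> Q_edges j) + lin htpy (Q_edges i \<star> bas p + bas p \<star> Q_edges j)"
proof (cases p)
  case (Stay k)
  then have k: "k \<le> i" "k \<le> j" using p by (auto simp: zz_block_def)
  have "lin htpy (Q_edges i \<star> bas p + bas p \<star> Q_edges j) = (\<Sum>l<k. bas (Stay l)) + (if k < j then \<Sum>l\<le>k. bas (Stay l) else 0)"
    using k unfolding Stay by (cases k) (simp_all add: Q_edges_Stay Stay_Q_edges lessThan_Suc_atMost)
  with k show ?thesis
    by (auto simp: Stay entry_bas lessThan_Suc_atMost[symmetric] add_ac)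
next
  case (Dn k)
  then have k: "k < i" "k \<le> j" using p by (auto simp: zz_block_def)
  have "lin htpy (Q_edges i \<star> bas p + bas p \<star> Q_edges j) = (\<Sum>l<k. bas (Dn l)) + (if k < j then \<Sum>l\<le>k. bas (Dn l) else 0)"
    using k unfolding Dn by (cases k) (simp_all add: Q_edges_Dn Dn_Q_edges lessThan_Suc_atMost)
  with k show ?thesis
    by (auto simp: Dn entry_bas lessThan_Suc_atMost[symmetric] add_ac)
next
  case (Up k)
  then show ?thesis
    using p diff_sum_Stay[of k i j] by (auto simp: zz_block_def simp del: bilinear_ext_sum_left bilinear_ext_sum_right)
next
  case (Lp k)
  then show ?thesis
    using p diff_sum_Dn[of k i j] by (auto simp: zz_block_def simp del: bilinear_ext_sum_left bilinear_ext_sum_right)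
qed

lemma kh_in_pr_emb: "kh_in (kh_proj i j p) = emb i j (lin (\<lambda>s. entry i j (kh_cycle s)) (kh_proj i j p))"
  by (cases p) (auto simp: kh_in_def entry_bas emb_sum)

text \<open>The identity differs from the retraction \<open>kh_in\<close> after \<open>kh_pr\<close>
  by a homotopy; hence every cycle is a combination of the chosen cycles plus a boundary.\<close>

lemma h_homotopy:
  assumes "Poly_Mapping.keys M \<subseteq> h_set m"
  shows "M = kh_in (kh_pr M) + h_diff m (h_htpy M) + h_htpy (h_diff m M)"
  using assms
proof (induction M rule: pm_induct)
  case zero
  then show ?case by (simp add: kh_in_def kh_pr_def h_htpy_def)
next
  case (bas a)
  obtain i p j where a: "a = (i, p, j)" by (cases a)
  have ij: "i \<le> m" "j \<le> m" and p: "p \<in> zz_block i j"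
    using bas a by (auto simp: h_set_def)
  have e: "bas a = emb i j (bas p)" by (simp add: a)
  have "kh_in (kh_pr (bas a)) = emb i j (lin (\<lambda>s. entry i j (kh_cycle s)) (kh_proj i j p))"
    by (simp add: a kh_pr_def kh_in_pr_emb)
  moreover have "h_diff m (h_htpy (bas a)) = emb i j (Q_edges i \<star> htpy p + htpy p \<star> Q_edges j)"
    unfolding e h_htpy_emb using h_diff_emb[OF ij htpy_block[OF p]] by simp
  moreover have "h_htpy (h_diff m (bas a)) = emb i j (lin htpy (Q_edges i \<star> bas p + bas p \<star> Q_edges j))"
  proof -
    have "h_diff m (bas a) = emb i j (Q_edges i \<star> bas p + bas p \<star> Q_edges j)"
      unfolding e using p by (intro h_diff_emb ij) simp
    then show ?thesis by (simp only: h_htpy_emb)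
  qed
  ultimately show ?case
    unfolding e using block_homotopy[OF p] by (metis emb_add)
next
  case (add x y)
  have "x + y = (kh_in (kh_pr x) + h_diff m (h_htpy x) + h_htpy (h_diff m x))
      + (kh_in (kh_pr y) + h_diff m (h_htpy y) + h_htpy (h_diff m y))"
    using add(3,4) by simp
  also have "\<dots> = kh_in (kh_pr (x + y)) + h_diff m (h_htpy (x + y)) + h_htpy (h_diff m (x + y))"
    by (simp add: kh_in_def kh_pr_def h_htpy_def add_ac)
  finally show ?case .
qed

lemma kh_pr_in: "Poly_Mapping.keys t \<subseteq> strands m \<Longrightarrow> kh_pr (kh_in t) = t"
proof (induction t rule: pm_induct)
  case (bas s)
  then show ?case
    by (cases s) (auto simp: kh_in_def kh_pr_def strands_def)
qed (simp_all add: kh_in_def kh_pr_def)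

text \<open>Differentials involve only \<open>Up\<close> and \<open>Lp\<close>, and the projection
  vanishes on both.\<close>

lemma kh_pr_diff: "Poly_Mapping.keys M \<subseteq> h_set m \<Longrightarrow> kh_pr (h_diff m M) = 0"
proof (induction M rule: pm_induct)
  case (bas a)
  obtain i p j where a: "a = (i, p, j)" by (cases a)
  have ij: "i \<le> m" "j \<le> m" and p: "p \<in> zz_block i j"
    using bas a by (auto simp: h_set_def)
  have "kh_pr (h_diff m (bas a)) = lin (kh_proj i j) (Q_edges i \<star> bas p + bas p \<star> Q_edges j)"
    using h_diff_emb[OF ij, of "bas p"] p by (simp add: a kh_pr_emb del: emb_add lin_add)
  also have "\<dots> = 0"
    using p by (cases p) (auto simp: zz_block_def Q_edges_Stay Stay_Q_edges Q_edges_Dn Dn_Q_edges)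
  finally show ?case .
qed (simp_all add: kh_pr_def)

lemma kh_pr_keys: "Poly_Mapping.keys M \<subseteq> h_set m \<Longrightarrow> Poly_Mapping.keys (kh_pr M) \<subseteq> strands m"
proof -
  assume M: "Poly_Mapping.keys M \<subseteq> h_set m"
  have "Poly_Mapping.keys (kh_proj i j p) \<subseteq> strands m" if "(i, p, j) \<in> h_set m" for i p j
    using that by (cases p) (auto simp: h_set_def zz_block_def strands_def)
  then have "\<forall>a\<in>h_set m. Poly_Mapping.keys ((\<lambda>(i, p, j). kh_proj i j p) a) \<subseteq> strands m"
    by (simp add: case_prod_unfold)
  with M show ?thesis
    unfolding kh_pr_def by (intro keys_lin) blast
qed

lemma kh_cycle_keys: "s \<in> strands m \<Longrightarrow> Poly_Mapping.keys (kh_cycle s) \<subseteq> h_set m"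
  by (cases s) (auto simp: strands_def h_set_def zz_block_def intro!: keys_sum_subset del: subsetI)

lemma kh_in_keys: "Poly_Mapping.keys t \<subseteq> strands m \<Longrightarrow> Poly_Mapping.keys (kh_in t) \<subseteq> h_set m"
  unfolding kh_in_def using kh_cycle_keys by (intro keys_lin) auto

lemma htpy_keys: "Poly_Mapping.keys M \<subseteq> h_set m \<Longrightarrow> Poly_Mapping.keys (h_htpy M) \<subseteq> h_set m"
proof -
  assume M: "Poly_Mapping.keys M \<subseteq> h_set m"
  have "Poly_Mapping.keys (emb i j (htpy p)) \<subseteq> h_set m" if "(i, p, j) \<in> h_set m" for i p j
    using that by (intro keys_emb htpy_block) (auto simp: h_set_def)
  then have "\<forall>a\<in>h_set m. Poly_Mapping.keys ((\<lambda>(i, p, j). emb i j (htpy p)) a) \<subseteq> h_set m"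
    by (simp add: case_prod_unfold)
  with M show ?thesis
    unfolding h_htpy_def by (intro keys_lin) blast
qed

lemma h_diff_kh_in: "Poly_Mapping.keys t \<subseteq> strands m \<Longrightarrow> h_diff m (kh_in t) = 0"
proof (induction t rule: pm_induct)
  case (bas s)
  have a: "h_diff m (\<Sum>k\<le>j. bas (i, Stay k, j)) = 0" if "j \<le> i" "i \<le> m" for i j
  proof -
    have "Poly_Mapping.keys (\<Sum>k\<le>j. bas (Stay k)) \<subseteq> zz_block i j"
      using that by (intro keys_sum_subset) (auto simp: zz_block_def)
    from h_diff_emb[OF _ _ this, of m] that diff_sum_Stay_top[OF that(1)] show ?thesis
      by (simp add: emb_sum del: bilinear_ext_sum_left bilinear_ext_sum_right emb_add)
  qed
  have b: "h_diff m (\<Sum>k\<le>j. bas (i, Dn k, j)) = 0" if "j < i" "i \<le> m" for i j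
  proof -
    have "Poly_Mapping.keys (\<Sum>k\<le>j. bas (Dn k)) \<subseteq> zz_block i j"
      using that by (intro keys_sum_subset) (auto simp: zz_block_def)
    from h_diff_emb[OF _ _ this, of m] that diff_sum_Dn_top[OF that(1)] show ?thesis
      by (simp add: emb_sum del: bilinear_ext_sum_left bilinear_ext_sum_right emb_add)
  qed
  show ?case
    using bas by (cases s) (auto simp: kh_in_def strands_def a b)
qed (simp_all add: kh_in_def)

section \<open>Multiplicativity of the inclusion of cycles\<close>

lemma mult_sum_sum:
  "bilinear_ext \<mu> (\<Sum>a\<in>I. bas (f a)) (\<Sum>b\<in>J. bas (g b)) = (\<Sum>b\<in>J. \<Sum>a\<in>I. obas (\<mu> (f a) (g b)))"
  by simp

text \<open>The relations hold for the cycles themselves, not merely up to boundaries: matching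
  indices leave the diagonal terms of the double sum, and two descending edges multiply to zero.
  Thus \<open>kh_in\<close> is an algebra homomorphism before passing to homology.\<close>

lemma kh_cycle_mult:
  assumes "s \<in> strands m" "t \<in> strands m"
  shows "bilinear_ext h_mult (kh_cycle s) (kh_cycle t) = kh_in (obas (kh_mult s t))"
proof -
  \<comment> \<open>Products of basis elements appear as options of conditionals; this turns them
    into conditionals, whose sums collapse.\<close>
  have case_if: "(case if P then Some x else None of None \<Rightarrow> 0 | Some z \<Rightarrow> f z) = (if P then f x else 0)"
    for P and x :: 'b and f :: "'b \<Rightarrow> (hbasis \<Rightarrow>\<^sub>0 bit)"
    by simp
  show ?thesis
    using assms
    by (cases s; cases t)
      (auto simp: mult_sum_sum case_if kh_in_def strands_def
        intro!: sum.cong sum.neutral simp del: bilinear_ext_sum_left bilinear_ext_sum_right)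
qed

lemma kh_in_mult:
  assumes "Poly_Mapping.keys x \<subseteq> strands m" "Poly_Mapping.keys y \<subseteq> strands m"
  shows "kh_in (bilinear_ext kh_mult x y) = bilinear_ext h_mult (kh_in x) (kh_in y)"
  using assms(1)
proof (induction x rule: pm_induct)
  case (bas s)
  show ?case using assms(2)
  proof (induction y rule: pm_induct)
    case (bas t)
    then show ?case
      using kh_cycle_mult[OF \<open>s \<in> _\<close> \<open>t \<in> _\<close>] by (simp add: kh_in_def)
  qed (simp_all add: kh_in_def)
qed (simp_all add: kh_in_def)

lemma kh_in_one: "kh_in \<one>\<^bsub>kh_alg m\<^esub> = \<one>\<^bsub>h_alg m\<^esub>"
proof -
  have "inj_on (\<lambda>(i, k). (i, Stay k, i)) (SIGMA i:{..m}. {..i})"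
    by (auto simp: inj_on_def)
  then have "\<one>\<^bsub>h_alg m\<^esub> = (\<Sum>(i, k)\<in>(SIGMA i:{..m}. {..i}). bas (i, Stay k, i))"
    by (simp add: h.one_eq h_units_def sum.reindex case_prod_unfold)
  also have "\<dots> = (\<Sum>i\<le>m. \<Sum>k\<le>i. bas (i, Stay k, i))"
    by (subst sum.Sigma) auto
  finally show ?thesis
    by (simp add: kh.one_eq kh_in_def sum.reindex inj_on_def)
qed

text \<open>The criterion \<open>homology_iso\<close> is applied to \<open>\<Phi>\<close> after
  \<open>kh_in\<close>. Injectivity holds because \<open>kh_pr\<close> kills boundaries and inverts
  \<open>kh_in\<close>; surjectivity is the homotopy formula for cycles.\<close>

lemma kh_alg_iso_B_Kh: "kh_alg m \<simeq> B_Kh m"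
proof -
  obtain \<Phi> where \<Phi>: "\<Phi> \<in> ring_iso (h_alg m) (Hom_alg m)"
    and \<Phi>0: "\<Phi> \<zero>\<^bsub>h_alg m\<^esub> = \<zero>\<^bsub>Hom_alg m\<^esub>"
    and \<Phi>d: "\<And>M. M \<in> carrier (h_alg m) \<Longrightarrow> Hom_diff m (\<Phi> M) = \<Phi> (h_diff m M)"
    using h_alg_iso_Hom_alg[of m] by blast
  have hom: "\<Phi> \<in> ring_hom (h_alg m) (Hom_alg m)" and inj: "inj_on \<Phi> (carrier (h_alg m))"
    and surj: "carrier (Hom_alg m) = \<Phi> ` carrier (h_alg m)"
    using \<Phi> by (simp_all add: ring_iso_def bij_betw_def)
  have in_closed: "kh_in t \<in> carrier (h_alg m)" if "t \<in> carrier (kh_alg m)" for t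
    using that by (simp add: kh.carrier_iff h.carrier_iff kh_in_keys)
  have d_closed: "h_diff m M \<in> carrier (h_alg m)" if "M \<in> carrier (h_alg m)" for M
    using that by (simp add: h.carrier_iff h_diff_keys)
  have kh_hom: "kh_in \<in> ring_hom (kh_alg m) (h_alg m)"
    by (rule ring_hom_memI)
      (simp_all add: in_closed kh_in_one, simp_all add: kh.carrier_iff kh.mult_eq h.mult_eq kh_in_mult
        kh.add_eq h.add_eq, simp add: kh_in_def)
  show ?thesis
    unfolding B_Kh_def
  proof (rule homology_iso)
    show "dg_algebra (Hom_alg m) (Hom_diff m)"
      by (rule dg_algebra_iso[OF h_dg \<Phi> \<Phi>0 \<Phi>d])
    show "ring (kh_alg m)" by (rule kh.ring)
    show "\<Phi> \<circ> kh_in \<in> ring_hom (kh_alg m) (Hom_alg m)"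
      by (rule ring_hom_trans[OF kh_hom hom])
    show "Hom_diff m ((\<Phi> \<circ> kh_in) t) = \<zero>\<^bsub>Hom_alg m\<^esub>" if "t \<in> carrier (kh_alg m)" for t
      using that \<Phi>0 by (simp add: \<Phi>d in_closed h_diff_kh_in[of t m] kh.carrier_iff[symmetric] h.zero_eq)
  next
    fix t assume t: "t \<in> carrier (kh_alg m)"
      and "(\<Phi> \<circ> kh_in) t \<in> boundaries (Hom_alg m) (Hom_diff m)"
    then obtain M where M: "M \<in> carrier (h_alg m)" "\<Phi> (kh_in t) = \<Phi> (h_diff m M)"
      by (auto simp: boundaries_def surj \<Phi>d)
    then have "kh_in t = h_diff m M"
      using inj_onD[OF inj] in_closed[OF t] d_closed by blast
    then have "kh_pr (kh_in t) = 0"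
      using M(1) by (simp add: kh_pr_diff[of M m] h.carrier_iff)
    then show "t = \<zero>\<^bsub>kh_alg m\<^esub>"
      using t kh_pr_in[of t m] by (simp add: kh.carrier_iff kh.zero_eq)
  next
    fix z assume "z \<in> cycles (Hom_alg m) (Hom_diff m)"
    then obtain M where M: "M \<in> carrier (h_alg m)" "z = \<Phi> M" and "\<Phi> (h_diff m M) = \<zero>\<^bsub>Hom_alg m\<^esub>"
      by (auto simp: cycles_def surj \<Phi>d)
    then have "h_diff m M = 0"
      using inj_onD[OF inj, of "h_diff m M" "\<zero>\<^bsub>h_alg m\<^esub>"] d_closed[of M] \<Phi>0
      by (simp add: h.zero_eq h.carrier_iff)
    moreover have Mk: "Poly_Mapping.keys M \<subseteq> h_set m"
      using M(1) by (simp add: h.carrier_iff)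
    ultimately have eq: "M = h_diff m (h_htpy M) \<oplus>\<^bsub>h_alg m\<^esub> kh_in (kh_pr M)"
      using h_homotopy[of M m] by (simp add: h_htpy_def h.add_eq add.commute)
    have c: "h_htpy M \<in> carrier (h_alg m)" "kh_pr M \<in> carrier (kh_alg m)"
      using htpy_keys[OF Mk] kh_pr_keys[OF Mk] by (simp_all add: h.carrier_iff kh.carrier_iff)
    have "z = \<Phi> (h_diff m (h_htpy M) \<oplus>\<^bsub>h_alg m\<^esub> kh_in (kh_pr M))"
      using M(2) eq by simp
    also have "\<dots> = Hom_diff m (\<Phi> (h_htpy M)) \<oplus>\<^bsub>Hom_alg m\<^esub> (\<Phi> \<circ> kh_in) (kh_pr M)"
      using c by (simp add: ring_hom_add[OF hom] d_closed in_closed \<Phi>d)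
    finally show "\<exists>t\<in>carrier (kh_alg m). \<exists>b\<in>boundaries (Hom_alg m) (Hom_diff m).
        z = b \<oplus>\<^bsub>Hom_alg m\<^esub> (\<Phi> \<circ> kh_in) t"
      using c surj unfolding boundaries_def by blast
  qed
qed

section \<open>The filtration on the strands algebra\<close>

fun strand_deg :: "strand \<Rightarrow> int" where
  "strand_deg (StrandId i) = 0"
| "strand_deg (StrandRho i j) = 0"
| "strand_deg (StrandSigma i j) = 1"

text \<open>The labels \<open>StrandRho\<close> and \<open>StrandSigma\<close>, read as
  \<open>a\<close> and \<open>b\<close>, are expanded in the standard basis of \<open>B_HF\<close>.
  In characteristic two this map is its own inverse, so it also computes coordinates with respect to
  \<open>a\<close> and \<open>b\<close>.\<close>

fun shear_basis :: "strand \<Rightarrow> (strand \<Rightarrow>\<^sub>0 bit)" where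
  "shear_basis (StrandRho i j) = bas (StrandRho i j) + bas (StrandSigma i j)"
| "shear_basis s = bas s"

definition shear :: "(strand \<Rightarrow>\<^sub>0 bit) \<Rightarrow> (strand \<Rightarrow>\<^sub>0 bit)" where
  "shear = lin shear_basis"

lemma shear_0 [simp]: "shear 0 = 0"
  and shear_add [simp]: "shear (x + y) = shear x + shear y"
  and shear_sum [simp]: "shear (sum f I) = (\<Sum>i\<in>I. shear (f i))"
  and shear_bas [simp]: "shear (bas s) = shear_basis s"
  by (simp_all add: shear_def)

lemma shear_shear [simp]: "shear (shear x) = x"
proof -
  have "shear (shear_basis s) = bas s" for s
    by (cases s) (simp_all add: add.assoc)
  then have "shear (shear x) = lin bas x"
    by (simp add: shear_def lin_lin)
  then show ?thesis by simp
qed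

text \<open>The multiplication of \<open>B\<^sup>H\<^sup>F\<close> in the basis consisting of \<open>a = \<rho> + \<sigma>\<close> and \<open>b = \<sigma>\<close>.\<close>

fun fl_mult :: "strand \<Rightarrow> strand \<Rightarrow> strand option" where
  "fl_mult (StrandSigma i j) (StrandSigma k l) = (if j = k then Some (StrandSigma i l) else None)"
| "fl_mult s t = kh_mult s t"

lemma shear_mult: "bilinear_ext strand_mult (shear x) (shear y) = shear (bilinear_ext fl_mult x y)"
proof -
  have *: "bilinear_ext strand_mult (shear_basis s) (shear_basis t) = shear (obas (fl_mult s t))" for s t
    by (cases s; cases t) (auto simp: add_ac)
  have "Poly_Mapping.keys x \<subseteq> UNIV" "Poly_Mapping.keys y \<subseteq> UNIV" by simp_all
  then show ?thesis
  proof (induction x rule: pm_induct)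
    case (bas s)
    from bas(2) show ?case
      by (induction y rule: pm_induct) (simp_all add: *)
  qed simp_all
qed

definition level :: "nat \<Rightarrow> int \<Rightarrow> strand set" where
  "level m p = {s \<in> strands m. strand_deg s \<le> p}"

text \<open>The support of \<open>shear y\<close> lists the elements \<open>a\<close> and
  \<open>b\<close> that occur in \<open>y\<close>. The filtration is zero below degree 0, spanned by
  the idempotents and the \<open>a\<close> in degree 0, and everything from degree 1 on.\<close>

definition Fil :: "nat \<Rightarrow> int \<Rightarrow> (strand \<Rightarrow>\<^sub>0 bit) set" where
  "Fil m p = {y. Poly_Mapping.keys (shear y) \<subseteq> level m p}"

definition part :: "int \<Rightarrow> (strand \<Rightarrow>\<^sub>0 bit) \<Rightarrow> (strand \<Rightarrow>\<^sub>0 bit)" where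
  "part p = lin (\<lambda>s. if strand_deg s = p then bas s else 0)"

definition homog :: "nat \<Rightarrow> int \<Rightarrow> (strand \<Rightarrow>\<^sub>0 bit) set" where
  "homog m p = {x. Poly_Mapping.keys x \<subseteq> {s \<in> strands m. strand_deg s = p}}"

lemma deg_range: "strand_deg s = 0 \<or> strand_deg s = 1"
  by (cases s) auto

lemma level_mono: "p \<le> q \<Longrightarrow> level m p \<subseteq> level m q"
  by (auto simp: level_def)

lemma shear_keys: "Poly_Mapping.keys x \<subseteq> strands m \<Longrightarrow> Poly_Mapping.keys (shear x) \<subseteq> strands m"
  unfolding shear_def
proof (intro keys_lin)
  fix s assume "Poly_Mapping.keys x \<subseteq> strands m" "s \<in> Poly_Mapping.keys x"
  then have "s \<in> strands m" by blast
  then show "Poly_Mapping.keys (shear_basis s) \<subseteq> strands m"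
    by (cases s) (auto simp: strands_def intro!: keys_plus_subset del: subsetI)
qed

lemma Fil_carrier: "x \<in> Fil m p \<Longrightarrow> x \<in> carrier (B_HF m)"
proof -
  assume "x \<in> Fil m p"
  then have "Poly_Mapping.keys (shear x) \<subseteq> strands m"
    by (auto simp: Fil_def level_def)
  from shear_keys[OF this] show ?thesis by (simp add: hf.carrier_iff)
qed

lemma Fil_zero [simp]: "0 \<in> Fil m p"
  by (simp add: Fil_def)

lemma Fil_add: "x \<in> Fil m p \<Longrightarrow> y \<in> Fil m p \<Longrightarrow> x + y \<in> Fil m p"
  by (simp add: Fil_def keys_plus_subset)

lemma Fil_sum: "(\<And>i. i \<in> I \<Longrightarrow> f i \<in> Fil m p) \<Longrightarrow> sum f I \<in> Fil m p"
  by (auto simp: Fil_def intro!: keys_sum_subset del: subsetI)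

lemma Fil_mono: "p \<le> q \<Longrightarrow> Fil m p \<subseteq> Fil m q"
  using level_mono[of p q m] by (auto simp: Fil_def)

lemma shear_Fil: "shear x \<in> Fil m p \<longleftrightarrow> Poly_Mapping.keys x \<subseteq> level m p"
  by (simp add: Fil_def)

text \<open>Degrees add up except for \<open>b b = b\<close>, where the degree drops from 2 to 1.
  This drop is what the associated graded algebra forgets.\<close>

lemma fl_mult_deg:
  "s \<in> strands m \<Longrightarrow> t \<in> strands m \<Longrightarrow> fl_mult s t = Some u \<Longrightarrow> u \<in> strands m \<and> strand_deg u \<le> strand_deg s + strand_deg t"
  by (cases s; cases t) (auto simp: strands_def split: if_splits)

lemma Fil_mult:
  assumes "x \<in> Fil m p" "y \<in> Fil m q"
  shows "bilinear_ext strand_mult x y \<in> Fil m (p + q)"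
proof -
  have "Poly_Mapping.keys (bilinear_ext fl_mult (shear x) (shear y)) \<subseteq> level m (p + q)"
    unfolding bilinear_ext_lin
  proof (intro keys_lin)
    fix s t assume "s \<in> Poly_Mapping.keys (shear x)" "t \<in> Poly_Mapping.keys (shear y)"
    with assms have "s \<in> level m p" "t \<in> level m q"
      by (auto simp: Fil_def)
    then show "Poly_Mapping.keys (obas (fl_mult s t)) \<subseteq> level m (p + q)"
      using fl_mult_deg[of s m t] by (cases "fl_mult s t") (auto simp: level_def)
  qed
  then show ?thesis
    using shear_mult[of "shear x" "shear y"] by (simp add: shear_Fil)
qed

lemma Fil_filtration: "algebra_filtration (B_HF m) B_HF_diff (Fil m)"
  unfolding algebra_filtration_def
proof (intro conjI allI impI ballI)
  interpret ring "B_HF m" by (rule hf.ring)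
  fix i
  show "additive_subgroup (Fil m i) (B_HF m)"
  proof (rule additive_subgroupI, rule add.subgroupI)
    show "\<ominus>\<^bsub>B_HF m\<^esub> a \<in> Fil m i" if "a \<in> Fil m i" for a
      using that minus_equality[of a a] Fil_carrier[OF that] by (simp add: hf.add_eq hf.zero_eq)
    show "Fil m i \<noteq> {}" using Fil_zero by blast
  qed (auto simp: Fil_carrier hf.add_eq Fil_add)
qed (use Fil_mono Fil_mult in \<open>auto simp: hf.mult_eq B_HF_diff_def\<close>)

section \<open>Homogeneous parts and leading terms\<close>

lemma part_0 [simp]: "part p 0 = 0"
  and part_add [simp]: "part p (x + y) = part p x + part p y"
  by (simp_all add: part_def)

lemma part_homog: "Poly_Mapping.keys x \<subseteq> strands m \<Longrightarrow> part p x \<in> homog m p"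
  unfolding homog_def part_def by (auto intro!: keys_lin split: if_splits)

lemma part_out: "p \<notin> {0, 1} \<Longrightarrow> part p x = 0"
  unfolding part_def using deg_range by (intro trans[OF lin_cong lin_zero_fun]) auto

lemma part_sum: "part 0 x + part 1 x = x"
proof -
  have "part 0 x + part 1 x = lin bas x"
    unfolding part_def lin_add_fun[symmetric]
  proof (intro lin_cong)
    fix s show "(if strand_deg s = 0 then bas s else 0) + (if strand_deg s = 1 then bas s else 0) = bas s"
      using deg_range[of s] by auto
  qed
  then show ?thesis by simp
qed

lemma part_homog_eq: "x \<in> homog m q \<Longrightarrow> part p x = (if p = q then x else 0)"
proof -
  assume "x \<in> homog m q"
  then have "\<And>s. s \<in> Poly_Mapping.keys x \<Longrightarrow> strand_deg s = q"
    by (auto simp: homog_def)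
  then have "part p x = lin (\<lambda>s. if p = q then bas s else 0) x"
    unfolding part_def by (intro lin_cong) auto
  then show ?thesis by simp
qed

lemma homog_add: "x \<in> homog m p \<Longrightarrow> y \<in> homog m p \<Longrightarrow> x + y \<in> homog m p"
  by (simp add: homog_def keys_plus_subset)

lemma homog_Fil: "x \<in> homog m p \<Longrightarrow> shear x \<in> Fil m p"
  by (auto simp: homog_def shear_Fil level_def)

text \<open>A homogeneous element is faithfully represented by its class in the quotient of
  successive levels.\<close>

lemma homog_Fil_zero: "x \<in> homog m p \<Longrightarrow> shear x \<in> Fil m (p - 1) \<Longrightarrow> x = 0"
proof -
  assume "x \<in> homog m p" "shear x \<in> Fil m (p - 1)"
  then have "s \<notin> Poly_Mapping.keys x" for s
    by (auto simp: homog_def shear_Fil level_def dest!: subsetD[of _ _ s])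
  then have "Poly_Mapping.keys x = {}" by blast
  then show "x = 0" by simp
qed

text \<open>Removing the part of top degree \<open>p\<close> leaves degrees at most
  \<open>p - 1\<close>, so a class is represented by its leading part.\<close>

lemma Fil_decomp:
  assumes "y \<in> Fil m p"
  shows "y + shear (part p (shear y)) \<in> Fil m (p - 1)"
proof -
  have k: "Poly_Mapping.keys (shear y) \<subseteq> level m p"
    using assms by (simp add: Fil_def)
  have "shear y + part p (shear y) = lin (\<lambda>s. bas s + (if strand_deg s = p then bas s else 0)) (shear y)"
    by (simp add: part_def lin_add_fun)
  moreover have "Poly_Mapping.keys \<dots> \<subseteq> level m (p - 1)"
    using k by (intro keys_lin) (auto simp: level_def)
  ultimately show ?thesis by (simp add: Fil_def)
qed

section \<open>Cosets in the graded pieces\<close>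

definition cst :: "nat \<Rightarrow> int \<Rightarrow> (strand \<Rightarrow>\<^sub>0 bit) \<Rightarrow> (strand \<Rightarrow>\<^sub>0 bit) set" where
  "cst m p x = Fil m (p - 1) +>\<^bsub>B_HF m\<^esub> x"

lemma cst_iff: "y \<in> cst m p x \<longleftrightarrow> y + x \<in> Fil m (p - 1)"
proof
  assume "y + x \<in> Fil m (p - 1)"
  moreover have "y = (y + x) + x" by (simp add: add.assoc)
  ultimately show "y \<in> cst m p x"
    unfolding cst_def a_r_coset_def' hf.add_eq by blast
qed (auto simp: cst_def a_r_coset_def' hf.add_eq add.assoc)

lemma cst_self: "x \<in> cst m p x"
  by (simp add: cst_iff)

lemma cst_eq_iff: "cst m p x = cst m p y \<longleftrightarrow> x + y \<in> Fil m (p - 1)"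
proof
  assume "cst m p x = cst m p y"
  with cst_self[of x m p] show "x + y \<in> Fil m (p - 1)" by (simp add: cst_iff)
next
  assume xy: "x + y \<in> Fil m (p - 1)"
  have "z + x \<in> Fil m (p - 1) \<longleftrightarrow> z + y \<in> Fil m (p - 1)" for z
    using Fil_add[OF xy, of "z + x"] Fil_add[OF xy, of "z + y"] by (auto simp: add_ac)
  then show "cst m p x = cst m p y"
    by (intro Set.set_eqI) (simp add: cst_iff)
qed

lemma cst_zero [simp]: "cst m p 0 = Fil m (p - 1)"
  by (intro Set.set_eqI) (simp add: cst_iff)

abbreviation sq :: "nat \<Rightarrow> int \<Rightarrow> (strand \<Rightarrow>\<^sub>0 bit) set ring" where
  "sq m p \<equiv> subquotient (B_HF m) (Fil m) (\<lambda>i. Fil m (i - 1)) p"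

lemma sq_carrier: "carrier (sq m p) = cst m p ` Fil m p"
  by (auto simp: subquotient_def FactRing_def A_RCOSETS_def' cst_def a_r_coset_def')

lemma sq_zero: "\<zero>\<^bsub>sq m p\<^esub> = Fil m (p - 1)"
  by (simp add: subquotient_def FactRing_def)

lemma sq_add: "cst m p x \<oplus>\<^bsub>sq m p\<^esub> cst m p y = cst m p (x + y)"
proof -
  have "cst m p x \<oplus>\<^bsub>sq m p\<^esub> cst m p y = {a + b | a b. a \<in> cst m p x \<and> b \<in> cst m p y}"
    by (auto simp: subquotient_def FactRing_def set_add_def' hf.add_eq)
  also have "\<dots> = cst m p (x + y)"
  proof (intro Set.set_eqI iffI)
    fix z assume "z \<in> {a + b | a b. a \<in> cst m p x \<and> b \<in> cst m p y}"
    then obtain a b where "z = a + b" "a + x \<in> Fil m (p - 1)" "b + y \<in> Fil m (p - 1)"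
      by (auto simp: cst_iff)
    with Fil_add[of "a + x" m "p - 1" "b + y"] show "z \<in> cst m p (x + y)"
      by (simp add: cst_iff add_ac)
  next
    fix z assume "z \<in> cst m p (x + y)"
    then have "z + y \<in> cst m p x"
      by (simp add: cst_iff add_ac)
    moreover have "z = (z + y) + y" by (simp add: add.assoc)
    ultimately show "z \<in> {a + b | a b. a \<in> cst m p x \<and> b \<in> cst m p y}"
      using cst_self by blast
  qed
  finally show ?thesis .
qed

text \<open>The product in \<open>graded_quotient\<close> is a finite sum in this structure, and
  evaluating such sums requires the laws of a commutative monoid.\<close>

lemma sq_abelian_monoid: "abelian_monoid (sq m p)"
proof (rule abelian_monoidI)
  show "\<zero>\<^bsub>sq m p\<^esub> \<in> carrier (sq m p)"
    unfolding sq_zero sq_carrier using cst_zero[symmetric] Fil_zero by (rule image_eqI)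
  show "\<zero>\<^bsub>sq m p\<^esub> \<oplus>\<^bsub>sq m p\<^esub> X = X" if "X \<in> carrier (sq m p)" for X
    using that sq_add[of m p 0] by (auto simp: sq_carrier sq_zero)
qed (auto simp: sq_carrier sq_add Fil_add add_ac)

lemma sq_finsum:
  assumes "finite I" "\<And>i. i \<in> I \<Longrightarrow> f i \<in> Fil m p"
  shows "(\<Oplus>\<^bsub>sq m p\<^esub>i\<in>I. cst m p (f i)) = cst m p (sum f I)"
  using assms
proof (induction I)
  case empty
  interpret abelian_monoid "sq m p" by (rule sq_abelian_monoid)
  show ?case using finsum_empty by (simp add: sq_zero)
next
  case (insert i I)
  interpret abelian_monoid "sq m p" by (rule sq_abelian_monoid)
  have "(\<Oplus>\<^bsub>sq m p\<^esub>i\<in>insert i I. cst m p (f i)) = cst m p (f i) \<oplus>\<^bsub>sq m p\<^esub> (\<Oplus>\<^bsub>sq m p\<^esub>i\<in>I. cst m p (f i))"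
    using insert by (intro finsum_insert) (auto simp: sq_carrier)
  with insert show ?case
    by (simp add: sq_add)
qed

section \<open>The isomorphism with the associated graded algebra\<close>

abbreviation gr :: "nat \<Rightarrow> (int \<Rightarrow> (strand \<Rightarrow>\<^sub>0 bit) set) ring" where
  "gr m \<equiv> assoc_graded (B_HF m) (Fil m)"

definition gr_in :: "nat \<Rightarrow> (strand \<Rightarrow>\<^sub>0 bit) \<Rightarrow> (int \<Rightarrow> (strand \<Rightarrow>\<^sub>0 bit) set)" where
  "gr_in m t = (\<lambda>p. cst m p (shear (part p t)))"

lemma gr_in_eq_iff:
  assumes "Poly_Mapping.keys s \<subseteq> strands m" "Poly_Mapping.keys t \<subseteq> strands m"
  shows "gr_in m s p = gr_in m t p \<longleftrightarrow> part p s = part p t"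
proof
  assume "gr_in m s p = gr_in m t p"
  then have "shear (part p s + part p t) \<in> Fil m (p - 1)"
    unfolding gr_in_def cst_eq_iff by simp
  then have "part p s + part p t = 0"
    using homog_Fil_zero[OF homog_add[OF part_homog part_homog]] assms by blast
  then show "part p s = part p t" using pm_eq_iff by blast
qed (simp add: gr_in_def)

lemma gr_in_zero_iff:
  assumes "Poly_Mapping.keys t \<subseteq> strands m"
  shows "gr_in m t p = Fil m (p - 1) \<longleftrightarrow> part p t = 0"
  using gr_in_eq_iff[OF assms, of 0 p] by (simp add: gr_in_def)

lemma part_Fil: "Poly_Mapping.keys t \<subseteq> strands m \<Longrightarrow> shear (part p t) \<in> Fil m p"
  by (intro homog_Fil part_homog)

lemma gr_in_closed:
  assumes "Poly_Mapping.keys t \<subseteq> strands m"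
  shows "gr_in m t \<in> carrier (gr m)"
proof -
  have "finite {p. gr_in m t p \<noteq> Fil m (p - 1)}"
    by (rule finite_subset[of _ "{0, 1}"]) (use part_out[of _ t] in \<open>auto simp: gr_in_zero_iff[OF assms]\<close>)
  moreover have "gr_in m t p \<in> carrier (sq m p)" for p
    unfolding sq_carrier gr_in_def using part_Fil[OF assms] by (rule imageI)
  ultimately show ?thesis
    by (simp add: assoc_graded_def graded_quotient_def)
qed

lemma gr_in_surj:
  assumes u: "u \<in> carrier (gr m)"
  obtains t where "Poly_Mapping.keys t \<subseteq> strands m" "u = gr_in m t"
proof -
  have "u p \<in> cst m p ` Fil m p" for p
    using u by (simp add: assoc_graded_def graded_quotient_def sq_carrier)
  then have "\<exists>y\<in>Fil m p. u p = cst m p y" for p by blast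
  then obtain y where y: "\<And>p. y p \<in> Fil m p" "\<And>p. u p = cst m p (y p)"
    by metis
  \<comment> \<open>Each chosen representative is replaced by its leading part. Only degrees 0 and 1
    occur, so two of these parts determine \<open>u\<close>.\<close>
  define w where "w p = part p (shear (y p))" for p
  have wh: "w p \<in> homog m p" for p
    unfolding w_def using y(1)[of p] by (intro part_homog) (auto simp: Fil_def level_def)
  have up: "u p = cst m p (shear (w p))" for p
    unfolding y(2) cst_eq_iff w_def by (rule Fil_decomp[OF y(1)])
  define t where "t = w 0 + w 1"
  have "part p t = w p" for p
    using part_homog_eq[OF wh[of 0], of p] part_homog_eq[OF wh[of 1], of p] part_out[of p "shear (y p)"]
    by (auto simp: t_def w_def)
  then have "u = gr_in m t"
    using up by (auto simp: gr_in_def fun_eq_iff)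
  moreover have "Poly_Mapping.keys t \<subseteq> strands m"
    unfolding t_def using wh[of 0] wh[of 1] by (intro keys_plus_subset) (auto simp: homog_def)
  ultimately show thesis using that by blast
qed

lemma gr_in_inj:
  assumes "Poly_Mapping.keys s \<subseteq> strands m" "Poly_Mapping.keys t \<subseteq> strands m" "gr_in m s = gr_in m t"
  shows "s = t"
  using gr_in_eq_iff[OF assms(1,2)] assms(3) part_sum[of s] part_sum[of t] by metis

lemma gr_in_add: "gr_in m (s + t) = gr_in m s \<oplus>\<^bsub>gr m\<^esub> gr_in m t"
  by (simp add: assoc_graded_def graded_quotient_def gr_in_def sq_add)

lemma gr_in_zero: "gr_in m 0 = \<zero>\<^bsub>gr m\<^esub>"
  by (simp add: assoc_graded_def graded_quotient_def gr_in_def)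

lemma gr_in_one: "gr_in m \<one>\<^bsub>kh_alg m\<^esub> = \<one>\<^bsub>gr m\<^esub>"
proof -
  have "part p \<one>\<^bsub>kh_alg m\<^esub> = (if p = 0 then \<one>\<^bsub>kh_alg m\<^esub> else 0)" for p
    by (simp add: kh.one_eq part_def sum.reindex inj_on_def)
  moreover have "shear \<one>\<^bsub>kh_alg m\<^esub> = \<one>\<^bsub>B_HF m\<^esub>"
    by (simp add: kh.one_eq hf.one_eq sum.reindex inj_on_def)
  ultimately show ?thesis
    by (auto simp: assoc_graded_def graded_quotient_def gr_in_def cst_def[of m 0] fun_eq_iff)
qed

text \<open>All products of representatives lie in one coset, so the union in the definition of the
  graded product is that coset.\<close>

lemma sq_mult:
  assumes x: "x \<in> Fil m p" and y: "y \<in> Fil m q"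
  shows "(\<Union>a\<in>cst m p x. \<Union>b\<in>cst m q y. Fil m (p + q - 1) +>\<^bsub>B_HF m\<^esub> (a \<otimes>\<^bsub>B_HF m\<^esub> b)) =
    cst m (p + q) (bilinear_ext strand_mult x y)"
proof -
  have "cst m (p + q) (bilinear_ext strand_mult a b) = cst m (p + q) (bilinear_ext strand_mult x y)"
    if "a \<in> cst m p x" "b \<in> cst m q y" for a b
    unfolding cst_eq_iff
  proof -
    have a: "a + x \<in> Fil m (p - 1)" and b: "b + y \<in> Fil m (q - 1)"
      using that by (simp_all only: cst_iff)
    have b': "b \<in> Fil m q"
      using Fil_add[OF subsetD[OF Fil_mono b] y] by (simp add: add.assoc)
    \<comment> \<open>The difference of the two products is written as
      \<open>(a + x) b + x (b + y)\<close>; each term contains a factor of lower level.\<close>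
    have "bilinear_ext strand_mult (a + x) b + bilinear_ext strand_mult x (b + y) \<in> Fil m (p + q - 1)"
      using Fil_add[OF Fil_mult[OF a b'], of "bilinear_ext strand_mult x (b + y)"] Fil_mult[OF x b]
      by (simp add: algebra_simps)
    then show "bilinear_ext strand_mult a b + bilinear_ext strand_mult x y \<in> Fil m (p + q - 1)"
      by (simp add: add_ac)
  qed
  then have "(\<Union>a\<in>cst m p x. \<Union>b\<in>cst m q y. cst m (p + q) (bilinear_ext strand_mult a b)) =
      (\<Union>a\<in>cst m p x. \<Union>b\<in>cst m q y. cst m (p + q) (bilinear_ext strand_mult x y))"
    by (intro SUP_cong refl)
  moreover have "cst m p x \<noteq> {}" "cst m q y \<noteq> {}"
    using cst_self by blast+
  ultimately show ?thesis
    unfolding hf.mult_eq cst_def[of m "p + q", symmetric] by simp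
qed

text \<open>The two multiplications differ only on two factors \<open>b\<close>, where
  \<open>p + q = 2\<close> while the product \<open>b\<close> has degree 1. So the difference sits
  one level lower.\<close>

lemma fl_kh_mult:
  assumes "x \<in> homog m p" "y \<in> homog m q"
  shows "shear (bilinear_ext fl_mult x y + bilinear_ext kh_mult x y) \<in> Fil m (p + q - 1)"
proof -
  have "bilinear_ext fl_mult x y + bilinear_ext kh_mult x y =
      lin (\<lambda>s. lin (\<lambda>t. obas (fl_mult s t) + obas (kh_mult s t)) y) x"
    by (simp add: bilinear_ext_lin lin_add_fun)
  moreover have "Poly_Mapping.keys \<dots> \<subseteq> level m (p + q - 1)"
  proof (intro keys_lin)
    fix s t assume "s \<in> Poly_Mapping.keys x" "t \<in> Poly_Mapping.keys y"
    with assms have "s \<in> strands m" "t \<in> strands m" "strand_deg s = p" "strand_deg t = q"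
      by (auto simp: homog_def)
    then show "Poly_Mapping.keys (obas (fl_mult s t) + obas (kh_mult s t)) \<subseteq> level m (p + q - 1)"
      by (cases s; cases t) (auto simp: level_def strands_def)
  qed
  ultimately show ?thesis by (simp only: shear_Fil)
qed

lemma kh_mult_homog:
  assumes "x \<in> homog m p" "y \<in> homog m q"
  shows "bilinear_ext kh_mult x y \<in> homog m (p + q)"
  unfolding homog_def bilinear_ext_lin mem_Collect_eq
proof (intro keys_lin)
  fix s t assume "s \<in> Poly_Mapping.keys x" "t \<in> Poly_Mapping.keys y"
  with assms have "s \<in> strands m" "t \<in> strands m" "strand_deg s = p" "strand_deg t = q"
    by (auto simp: homog_def)
  then show "Poly_Mapping.keys (obas (kh_mult s t)) \<subseteq> {s \<in> strands m. strand_deg s = p + q}"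
    by (cases s; cases t) (auto simp: strands_def)
qed

text \<open>The multiplication \<open>kh_mult\<close> is graded and only the degrees 0 and 1 occur,
  which bounds the range of the sum.\<close>

lemma part_mult:
  assumes s: "Poly_Mapping.keys s \<subseteq> strands m" and t: "Poly_Mapping.keys t \<subseteq> strands m"
  shows "part n (bilinear_ext kh_mult s t) = (\<Sum>p\<in>{0, 1}. bilinear_ext kh_mult (part p s) (part (n - p) t))"
proof -
  have *: "part n (bilinear_ext kh_mult (part p s) t) = bilinear_ext kh_mult (part p s) (part (n - p) t)" for p
  proof -
    have "part n (bilinear_ext kh_mult (part p s) t) =
        part n (bilinear_ext kh_mult (part p s) (part 0 t)) + part n (bilinear_ext kh_mult (part p s) (part 1 t))"
      by (simp add: part_sum flip: part_add bilinear_ext_add_right)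
    then show ?thesis
      using part_homog_eq[OF kh_mult_homog[OF part_homog[OF s] part_homog[OF t]], of n p 0]
        part_homog_eq[OF kh_mult_homog[OF part_homog[OF s] part_homog[OF t]], of n p 1]
        part_out[of "n - p" t] by auto
  qed
  have "part n (bilinear_ext kh_mult s t) =
      part n (bilinear_ext kh_mult (part 0 s) t) + part n (bilinear_ext kh_mult (part 1 s) t)"
    by (simp add: part_sum flip: part_add bilinear_ext_add_left)
  then show ?thesis by (simp add: *)
qed

lemma gr_in_mult:
  assumes s: "Poly_Mapping.keys s \<subseteq> strands m" and t: "Poly_Mapping.keys t \<subseteq> strands m"
  shows "gr_in m (bilinear_ext kh_mult s t) = gr_in m s \<otimes>\<^bsub>gr m\<^esub> gr_in m t"
proof
  fix n
  define P where "P = {p. gr_in m s p \<noteq> Fil m (p - 1) \<and> gr_in m t (n - p) \<noteq> Fil m (n - p - 1)}"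
  define f where "f p = bilinear_ext strand_mult (shear (part p s)) (shear (part (n - p) t))" for p
  have P: "P = {p. part p s \<noteq> 0 \<and> part (n - p) t \<noteq> 0}"
    by (simp add: P_def gr_in_zero_iff[OF s] gr_in_zero_iff[OF t])
  have sub: "P \<subseteq> {0, 1}"
    using part_out[of _ s] by (auto simp: P)
  have fF: "f p \<in> Fil m n" for p
    using Fil_mult[OF part_Fil[OF s] part_Fil[OF t], of p "n - p"] by (simp add: f_def)
  have "(gr_in m s \<otimes>\<^bsub>gr m\<^esub> gr_in m t) n =
      (\<Oplus>\<^bsub>sq m n\<^esub>p\<in>P. \<Union>x\<in>gr_in m s p. \<Union>y\<in>gr_in m t (n - p). Fil m (n - 1) +>\<^bsub>B_HF m\<^esub> (x \<otimes>\<^bsub>B_HF m\<^esub> y))"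
    by (simp add: assoc_graded_def graded_quotient_def P_def)
  also have "\<dots> = (\<Oplus>\<^bsub>sq m n\<^esub>p\<in>P. cst m n (f p))"
  proof -
    have "(\<Union>x\<in>gr_in m s p. \<Union>y\<in>gr_in m t (n - p). Fil m (n - 1) +>\<^bsub>B_HF m\<^esub> (x \<otimes>\<^bsub>B_HF m\<^esub> y)) = cst m n (f p)" for p
      using sq_mult[OF part_Fil[OF s] part_Fil[OF t], of p "n - p"] by (simp add: gr_in_def f_def)
    then show ?thesis by simp
  qed
  also have "\<dots> = cst m n (sum f P)"
    by (rule sq_finsum) (use sub fF finite_subset in auto)
  \<comment> \<open>The indices added to \<open>P\<close> contribute zero, since one of the two
    homogeneous parts vanishes there.\<close>
  also have "sum f P = sum f {0, 1}"
    by (rule sum.mono_neutral_left) (use sub in \<open>auto simp: P f_def\<close>)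
  also have "cst m n (sum f {0, 1}) = cst m n (shear (part n (bilinear_ext kh_mult s t)))"
  proof -
    \<comment> \<open>The products in \<open>B_HF\<close> are computed by \<open>fl_mult\<close>;
      replacing it by \<open>kh_mult\<close> costs only terms of level \<open>n - 1\<close>, which
      vanish in the coset.\<close>
    have "sum f {0, 1} + shear (part n (bilinear_ext kh_mult s t)) =
        (\<Sum>p\<in>{0, 1}. shear (bilinear_ext fl_mult (part p s) (part (n - p) t)
          + bilinear_ext kh_mult (part p s) (part (n - p) t)))"
      unfolding part_mult[OF s t] by (simp add: f_def shear_mult add_ac)
    also have "\<dots> \<in> Fil m (n - 1)"
      using fl_kh_mult[OF part_homog[OF s] part_homog[OF t]]
      by (intro Fil_sum) (metis add.commute diff_add_cancel)
    finally show ?thesis unfolding cst_eq_iff .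
  qed
  finally show "gr_in m (bilinear_ext kh_mult s t) n = (gr_in m s \<otimes>\<^bsub>gr m\<^esub> gr_in m t) n"
    by (simp add: gr_in_def)
qed

lemma gr_in_iso: "gr_in m \<in> ring_iso (kh_alg m) (gr m)"
  unfolding ring_iso_def
proof (intro CollectI conjI)
  show "gr_in m \<in> ring_hom (kh_alg m) (gr m)"
    by (rule ring_hom_memI)
      (simp_all add: kh.carrier_iff kh.mult_eq kh.add_eq gr_in_closed gr_in_mult gr_in_add gr_in_one)
  have "inj_on (gr_in m) (carrier (kh_alg m))"
    by (rule inj_onI) (auto simp: kh.carrier_iff intro: gr_in_inj)
  moreover have "gr_in m ` carrier (kh_alg m) = carrier (gr m)"
  proof (intro equalityI subsetI)
    fix u assume "u \<in> carrier (gr m)"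
    then obtain t where "Poly_Mapping.keys t \<subseteq> strands m" "u = gr_in m t"
      by (rule gr_in_surj)
    then show "u \<in> gr_in m ` carrier (kh_alg m)" by (simp add: kh.carrier_iff)
  qed (auto simp: kh.carrier_iff gr_in_closed)
  ultimately show "bij_betw (gr_in m) (carrier (kh_alg m)) (carrier (gr m))"
    by (simp add: bij_betw_def)
qed

lemma gr_f2: "f2_algebra (gr m)"
  using gr_in_zero[of m] by (intro f2_algebra_iso[OF kh.f2 gr_in_iso]) (simp add: kh.zero_eq)

section \<open>The pages for the zero differential\<close>

lemma ss_Z_HF: "ss_Z B_HF_diff (Fil m) r = Fil m"
  by (auto simp: ss_Z_def B_HF_diff_def)

text \<open>The image of the differential is zero and only the previous level remains. Hence all
  pages are equal to the associated graded algebra, not just isomorphic to it.\<close>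

lemma ss_B_HF: "ss_B (B_HF m) B_HF_diff (Fil m) r = (\<lambda>p. Fil m (p - 1))"
proof
  fix p
  have "B_HF_diff ` Fil m q = {0}" for q
    using Fil_zero[of m q] unfolding B_HF_diff_def[abs_def] by (rule image_constant)
  then show "ss_B (B_HF m) B_HF_diff (Fil m) r p = Fil m (p - 1)"
    by (simp add: ss_B_def ss_Z_HF set_add_def' hf.add_eq)
qed

lemma ss_page_HF: "ss_page (B_HF m) B_HF_diff (Fil m) r = gr m"
  by (simp add: ss_page_def ss_Z_HF ss_B_HF assoc_graded_def)

lemma graded_diff_HF:
  assumes "u \<in> carrier (gr m)"
  shows "graded_diff (B_HF m) B_HF_diff (\<lambda>p. Fil m (p - 1)) r u = \<zero>\<^bsub>gr m\<^esub>"
proof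
  fix p
  have "u (p + r) \<in> carrier (sq m (p + r))"
    using assms by (simp add: assoc_graded_def graded_quotient_def)
  then obtain x where "u (p + r) = cst m (p + r) x"
    by (auto simp: sq_carrier)
  \<comment> \<open>The induced differential is a union over a coset; the coset must be nonempty for
    the union to be the zero class instead of the empty set.\<close>
  with cst_self[of x m "p + r"] have "u (p + r) \<noteq> {}" by blast
  then show "graded_diff (B_HF m) B_HF_diff (\<lambda>p. Fil m (p - 1)) r u p = \<zero>\<^bsub>gr m\<^esub> p"
    by (simp add: graded_diff_def cst_def[symmetric] B_HF_diff_def assoc_graded_def graded_quotient_def)
qed

lemma dg_algebra_zero_diff:
  assumes "f2_algebra R" "\<And>x. x \<in> carrier R \<Longrightarrow> d x = \<zero>\<^bsub>R\<^esub>"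
  shows "dg_algebra R d"
proof -
  interpret ring R using assms(1) by (simp add: f2_algebra_def)
  have "d \<zero>\<^bsub>R\<^esub> = \<zero>\<^bsub>R\<^esub>" using assms(2) zero_closed .
  then show ?thesis
    unfolding dg_algebra_def using assms by (intro conjI ballI) simp_all
qed

theorem theorem5p1:
  fixes m :: nat
  shows "\<exists>F :: int \<Rightarrow> (strand \<Rightarrow>\<^sub>0 bit) set.
    algebra_filtration (B_HF m) B_HF_diff F \<and>
    assoc_graded (B_HF m) F \<simeq> B_Kh m \<and>
    spectral_sequence (ss_page (B_HF m) B_HF_diff F) (ss_diff (B_HF m) B_HF_diff F) \<and>
    E1_page (B_HF m) B_HF_diff F \<simeq> ss_page (B_HF m) B_HF_diff F 1 \<and>
    E1_page (B_HF m) B_HF_diff F \<simeq> B_Kh m \<and>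
    Einf_page (B_HF m) B_HF_diff \<simeq> B_HF m"
proof (intro exI conjI)
  have gr_ring: "ring (gr m)" using gr_f2 by (simp add: f2_algebra_def)
  show "algebra_filtration (B_HF m) B_HF_diff (Fil m)" by (rule Fil_filtration)
  \<comment> \<open>The model \<open>kh_alg m\<close> links the two sides: it is isomorphic both to
    the associated graded algebra and to \<open>B_Kh m\<close>.\<close>
  have "kh_alg m \<simeq> gr m"
    using gr_in_iso by (auto simp: is_ring_iso_def)
  then show Kh: "gr m \<simeq> B_Kh m"
    by (rule ring_iso_trans[OF ring_iso_sym[OF kh.ring] kh_alg_iso_B_Kh])
  show "spectral_sequence (ss_page (B_HF m) B_HF_diff (Fil m)) (ss_diff (B_HF m) B_HF_diff (Fil m))"
    \<comment> \<open>Every page is \<open>gr m\<close> with zero differential, so its homology is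
      again \<open>gr m\<close>, the next page.\<close>
    unfolding spectral_sequence_def ss_page_HF ss_diff_def ss_B_HF
    by (intro allI impI conjI dg_algebra_zero_diff homology_zero_diff gr_f2 gr_ring graded_diff_HF)
  have E1: "E1_page (B_HF m) B_HF_diff (Fil m) \<simeq> gr m"
    unfolding E1_page_def assoc_graded_diff_def
    by (intro homology_zero_diff gr_ring graded_diff_HF)
  then show "E1_page (B_HF m) B_HF_diff (Fil m) \<simeq> ss_page (B_HF m) B_HF_diff (Fil m) 1"
    by (simp add: ss_page_HF)
  show "E1_page (B_HF m) B_HF_diff (Fil m) \<simeq> B_Kh m"
    by (rule ring_iso_trans[OF E1 Kh])
  show "Einf_page (B_HF m) B_HF_diff \<simeq> B_HF m"
    unfolding Einf_page_def
    by (intro homology_zero_diff hf.ring) (simp add: B_HF_diff_def hf.zero_eq)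
qed

end
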